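(* Let $\{u_\eta\}$ be a uniformly bounded sequence in $W^{1,2}(\Omega)$. Then there exist a subsequence $\{u_{\eta_k}\}$ and functions $u\in W^{1,2}(\Omega)$ and $\mathrm{grad}_{\mathbf R}\,u_1(\boldsymbol x,\boldsymbol y)\in L^2(\Omega,L^2_\sharp(Y^m;\mathbb{R}^3))$ such that, as $\eta_k\to 0$, $u_{\eta_k}$ two-scale converges strongly for the matrix $\mathbf R$ to $u(\boldsymbol x)$, and $\mathrm{grad}\,u_{\eta_k}$ two-scale converges weakly for the matrix $\mathbf R$ to $\mathrm{grad}\,u(\boldsymbol x)+\mathrm{grad}_{\mathbf R}\,u_1(\boldsymbol x,\boldsymbol y)$.
   Context: $\Omega\subset\mathbb{R}^3$ is a bounded open set with Lipschitz boundary; $\eta>0$ is a parameter tending to $0$. $\mathbf R$ is a real matrix with $m$ rows and $3$ columns, $m>3$, satisfying $\mathbf R^T\boldsymbol k\neq\boldsymbol 0$ for all $\boldsymbol k\in\mathbb{Z}^m\setminus\{\boldsymbol 0\}$. $Y^m=]0,1[^m$; the subscript $\sharp$ denotes $Y^m$-periodicity in $\boldsymbol y$. Two-scale convergence: a sequence $(u_\eta)$ in $L^2(\Omega)$ two-scale converges weakly, for the matrix $\mathbf R$, to $u_0\in L^2(\Omega\times Y^m)$ if $\lim_{\eta\to0}\int_\Omega u_\eta(\boldsymbol x)\varphi(\boldsymbol x,\mathbf R\boldsymbol x/\eta)\,d\boldsymbol x=\int\!\!\int_{\Omega\times Y^m}u_0(\boldsymbol x,\boldsymbol y)\varphi(\boldsymbol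 x,\boldsymbol y)\,d\boldsymbol x\,d\boldsymbol y$ for every $\varphi\in L^2(\Omega,C_\sharp(Y^m))$ (componentwise for vector-valued sequences). It two-scale converges strongly if in addition $\|u_\eta\|_{L^2(\Omega)}\to\|u_0\|_{L^2(\Omega\times Y^m)}$. Operator: $\mathrm{grad}_{\mathbf R}\,u(\boldsymbol y)=(\mathbf R^T\nabla_{\boldsymbol y})u(\boldsymbol y)$. An element of $L^2_\sharp(Y^m;\mathbb{R}^3)$ is written $\mathrm{grad}_{\mathbf R}\,\phi$ if its Fourier coefficients are $2\pi i\,\mathbf R^T\boldsymbol k\,\phi_{\boldsymbol k}$, $\boldsymbol k\in\mathbb{Z}^m$, for some complex scalars $\phi_{\boldsymbol k}$; the potential $\phi$ itself need not belong to $L^2(Y^m)$. For functions of $(\boldsymbol x,\boldsymbol y)$ this is understood for a.e. $\boldsymbol x$. *)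

theory Defs
  imports "HOL-Analysis.Analysis"
begin

section \<open>Square-integrable functions\<close>

text \<open>
  Elements of Lebesgue and Sobolev spaces are represented by functions (not by classes modulo
  null sets). All notions below are invariant under changes on a Lebesgue null set.
\<close>

definition L2 :: "'a measure \<Rightarrow> ('a \<Rightarrow> 'b::euclidean_space) set" where
  "L2 M = {f \<in> borel_measurable M. integrable M (\<lambda>x. (norm (f x))\<^sup>2)}"

definition L2_norm :: "'a measure \<Rightarrow> ('a \<Rightarrow> 'b::euclidean_space) \<Rightarrow> real" where
  "L2_norm M f = sqrt (\<integral>x. (norm (f x))\<^sup>2 \<partial>M)"


section \<open>The Sobolev space \<open>W\<^sup>1\<^sup>,\<^sup>2\<close>\<close>

fun C_k :: "nat \<Rightarrow> ('a::euclidean_space \<Rightarrow> real) \<Rightarrow> bool" where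
  "C_k 0 f \<longleftrightarrow> continuous_on UNIV f"
| "C_k (Suc k) f \<longleftrightarrow> f differentiable_on UNIV \<and>
     (\<forall>b\<in>Basis. C_k k (\<lambda>x. frechet_derivative f (at x) b))"

text \<open>The space of smooth functions with compact support contained in \<open>\<Omega>\<close>, extended by zero.\<close>

definition test_functions :: "'a::euclidean_space set \<Rightarrow> ('a \<Rightarrow> real) set" where
  "test_functions \<Omega> = {\<psi>. (\<forall>k. C_k k \<psi>) \<and>
     compact (closure {x. \<psi> x \<noteq> 0}) \<and> closure {x. \<psi> x \<noteq> 0} \<subseteq> \<Omega>}"

definition has_weak_grad ::
    "'a::euclidean_space set \<Rightarrow> ('a \<Rightarrow> real) \<Rightarrow> ('a \<Rightarrow> 'a) \<Rightarrow> bool" where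
  "has_weak_grad \<Omega> u g \<longleftrightarrow> (\<forall>\<psi>\<in>test_functions \<Omega>. \<forall>b\<in>Basis.
     (\<integral>x. u x * frechet_derivative \<psi> (at x) b \<partial>lebesgue_on \<Omega>) =
     - (\<integral>x. (g x \<bullet> b) * \<psi> x \<partial>lebesgue_on \<Omega>))"

definition W12 :: "'a::euclidean_space set \<Rightarrow> ('a \<Rightarrow> real) set" where
  "W12 \<Omega> = {u \<in> L2 (lebesgue_on \<Omega>). \<exists>g\<in>L2 (lebesgue_on \<Omega>). has_weak_grad \<Omega> u g}"

text \<open>For \<open>u \<in> W12 \<Omega>\<close> with \<open>\<Omega>\<close> open, the function chosen here is unique almost everywhere
  on \<open>\<Omega>\<close>.\<close>

definition weak_grad :: "'a::euclidean_space set \<Rightarrow> ('a \<Rightarrow> real) \<Rightarrow> 'a \<Rightarrow> 'a" where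
  "weak_grad \<Omega> u = (SOME g. g \<in> L2 (lebesgue_on \<Omega>) \<and> has_weak_grad \<Omega> u g)"

definition W12_norm :: "'a::euclidean_space set \<Rightarrow> ('a \<Rightarrow> real) \<Rightarrow> real" where
  "W12_norm \<Omega> u =
     sqrt ((L2_norm (lebesgue_on \<Omega>) u)\<^sup>2 + (L2_norm (lebesgue_on \<Omega>) (weak_grad \<Omega> u))\<^sup>2)"


section \<open>Lipschitz boundary\<close>

text \<open>
  Near each boundary point, in suitable orthonormal coordinates \<open>T x\<close>, the set lies strictly
  above the graph of a Lipschitz function of the first two coordinates. Translations need not
  be considered since they can be absorbed into \<open>\<gamma>\<close>.
\<close>

definition lipschitz_boundary :: "(real^3) set \<Rightarrow> bool" where
  "lipschitz_boundary \<Omega> \<longleftrightarrow> (\<forall>p\<in>frontier \<Omega>.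
     \<exists>r>0. \<exists>T :: real^3 \<Rightarrow> real^3. \<exists>\<gamma> :: real^2 \<Rightarrow> real. \<exists>L.
       orthogonal_transformation T \<and> L-lipschitz_on UNIV \<gamma> \<and>
       \<Omega> \<inter> ball p r = {x \<in> ball p r. \<gamma> (vector [T x $ 1, T x $ 2]) < T x $ 3})"


section \<open>Periodic functions\<close>

definition unit_cell :: "(real^'m) set" where
  "unit_cell = {y. \<forall>i. 0 < y $ i \<and> y $ i < 1}"

definition int_lattice :: "(real^'m) set" where
  "int_lattice = {k. \<forall>i. k $ i \<in> \<int>}"

definition cell_periodic :: "(real^'m \<Rightarrow> 'b) \<Rightarrow> bool" where
  "cell_periodic f \<longleftrightarrow> (\<forall>y. \<forall>k\<in>int_lattice. f (y + k) = f y)"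

definition L2_per :: "(real^'m \<Rightarrow> 'b::euclidean_space) set" where
  "L2_per = {f \<in> L2 (lebesgue_on unit_cell). cell_periodic f}"

text \<open>
  The space of square-integrable functions on \<open>\<Omega>\<close> with values in \<open>L2_per\<close> is identified, as
  usual, with the functions of \<open>(x, y)\<close> that are square-integrable on \<open>\<Omega> \<times> unit_cell\<close> and
  periodic in \<open>y\<close>.
\<close>

definition L2_L2_per :: "(real^3) set \<Rightarrow> ((real^3) \<times> (real^'m) \<Rightarrow> 'b::euclidean_space) set" where
  "L2_L2_per \<Omega> = {f \<in> L2 (lebesgue_on (\<Omega> \<times> unit_cell)).
     \<forall>x\<in>\<Omega>. cell_periodic (\<lambda>y. f (x, y))}"

text \<open>
  The Bochner space of square-integrable functions on \<open>\<Omega>\<close> with values in the continuous periodic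
  functions under the supremum norm. Periodic continuous functions form a separable closed
  subspace of the bounded continuous ones, so that Borel measurability into the latter
  coincides with strong measurability.
\<close>

definition L2_C_per :: "(real^3) set \<Rightarrow> (real^3 \<Rightarrow> ((real^'m) \<Rightarrow>\<^sub>C real)) set" where
  "L2_C_per \<Omega> = {\<phi> \<in> borel_measurable (lebesgue_on \<Omega>).
     (\<forall>x\<in>\<Omega>. cell_periodic (apply_bcontfun (\<phi> x))) \<and>
     integrable (lebesgue_on \<Omega>) (\<lambda>x. (norm (\<phi> x))\<^sup>2)}"


section \<open>Gradients along a matrix\<close>

definition fourier_coeff :: "(real^'m \<Rightarrow> real) \<Rightarrow> real^'m \<Rightarrow> complex" where
  "fourier_coeff f k =
     (\<integral>y. of_real (f y) * exp (- 2 * of_real pi * \<i> * of_real (k \<bullet> y)) \<partial>lebesgue_on unit_cell)"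

text \<open>The potential enters only through its formal Fourier coefficients \<open>\<phi> k\<close>, which need not be
  square-summable.\<close>

definition is_grad_R :: "real^3^'m \<Rightarrow> (real^'m \<Rightarrow> real^3) \<Rightarrow> bool" where
  "is_grad_R R g \<longleftrightarrow> g \<in> L2_per \<and> (\<exists>\<phi> :: real^'m \<Rightarrow> complex. \<forall>k\<in>int_lattice. \<forall>j.
     fourier_coeff (\<lambda>y. g y $ j) k =
       2 * of_real pi * \<i> * of_real ((transpose R *v k) $ j) * \<phi> k)"

definition L2_grad_R ::
    "(real^3) set \<Rightarrow> real^3^'m \<Rightarrow> ((real^3) \<times> (real^'m) \<Rightarrow> real^3) set" where
  "L2_grad_R \<Omega> R = {G \<in> L2_L2_per \<Omega>. AE x in lebesgue_on \<Omega>. is_grad_R R (\<lambda>y. G (x, y))}"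


section \<open>Two-scale convergence\<close>

definition two_scale_weak ::
    "(real^3) set \<Rightarrow> real^3^'m \<Rightarrow> (nat \<Rightarrow> real) \<Rightarrow> (nat \<Rightarrow> real^3 \<Rightarrow> real) \<Rightarrow>
     ((real^3) \<times> (real^'m) \<Rightarrow> real) \<Rightarrow> bool" where
  "two_scale_weak \<Omega> R \<eta> u u0 \<longleftrightarrow>
     (\<forall>n. u n \<in> L2 (lebesgue_on \<Omega>)) \<and> u0 \<in> L2 (lebesgue_on (\<Omega> \<times> unit_cell)) \<and>
     (\<forall>\<phi>\<in>L2_C_per \<Omega>.
        (\<lambda>n. \<integral>x. u n x * \<phi> x ((R *v x) /\<^sub>R \<eta> n) \<partial>lebesgue_on \<Omega>) \<longlonglongrightarrow>
        (\<integral>(x, y). u0 (x, y) * \<phi> x y \<partial>lebesgue_on (\<Omega> \<times> unit_cell)))"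

definition two_scale_weak_vec ::
    "(real^3) set \<Rightarrow> real^3^'m \<Rightarrow> (nat \<Rightarrow> real) \<Rightarrow> (nat \<Rightarrow> real^3 \<Rightarrow> real^3) \<Rightarrow>
     ((real^3) \<times> (real^'m) \<Rightarrow> real^3) \<Rightarrow> bool" where
  "two_scale_weak_vec \<Omega> R \<eta> u u0 \<longleftrightarrow>
     (\<forall>j. two_scale_weak \<Omega> R \<eta> (\<lambda>n x. u n x $ j) (\<lambda>z. u0 z $ j))"

definition two_scale_strong ::
    "(real^3) set \<Rightarrow> real^3^'m \<Rightarrow> (nat \<Rightarrow> real) \<Rightarrow> (nat \<Rightarrow> real^3 \<Rightarrow> real) \<Rightarrow>
     ((real^3) \<times> (real^'m) \<Rightarrow> real) \<Rightarrow> bool" where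
  "two_scale_strong \<Omega> R \<eta> u u0 \<longleftrightarrow> two_scale_weak \<Omega> R \<eta> u u0 \<and>
     (\<lambda>n. L2_norm (lebesgue_on \<Omega>) (u n)) \<longlonglongrightarrow> L2_norm (lebesgue_on (\<Omega> \<times> unit_cell)) u0"

end

theory Submission
  imports Defs "HOL-Library.Diagonal_Subsequence"
begin

text \<open>Two compactness arguments are combined with one identity. Rellich's theorem makes a subsequence of
\<open>u \<eta>\<close> converge strongly to some \<open>v\<close>, so that these functions do not oscillate in the limit. Their
gradients are merely bounded; along the same subsequence they have a two-scale limit
\<open>w (x, y)\<close>. Let \<open>w k x\<close> be the Fourier coefficients of \<open>w\<close> in \<open>y\<close>. Testing the gradients against
\<open>\<psi> x * exp (2 \<pi> i k \<bullet> R x / \<eta>)\<close> in a constant direction \<open>z\<close> and integrating by parts produces the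
derivative of the exponential, which carries the factor \<open>(R\<^sup>T k \<bullet> z) / \<eta>\<close>. It disappears when \<open>z\<close> is
orthogonal to \<open>R\<^sup>T k\<close>; what remains pairs \<open>u \<eta>\<close> with a fixed amplitude times a rapidly oscillating
wave, and tends to \<open>0\<close> for \<open>k \<noteq> 0\<close> because \<open>u \<eta>\<close> converges strongly. So \<open>w k x\<close> is orthogonal to every
\<open>z\<close> orthogonal to \<open>R\<^sup>T k\<close>, hence a multiple of \<open>R\<^sup>T k\<close>, and this is what it means for \<open>w\<close> minus its
mean to be a gradient along \<open>R\<close> (\<open>gradient_limit_waves_parallel\<close>, \<open>corrector_is_grad_R\<close>). For
\<open>k = 0\<close> the same computation identifies the mean of \<open>w\<close> over the unit cell with the weak gradient
of \<open>v\<close> (\<open>mean_of_two_scale_limit\<close>).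

Weak compactness comes from a diagonal argument and one minimisation argument in the space of
square-integrable functions.
A functional \<open>L\<close> that is bounded on a subspace is represented by the minimiser of
\<open>\<parallel>f\<parallel>\<^sup>2 - 2 L f\<close> in the closure of that subspace (\<open>L2_Riesz\<close>). This yields weak limits of bounded
sequences (\<open>L2_weak_limit\<close>), density of the test functions (\<open>test_functions_dense\<close>) and the two-scale
limit itself (\<open>two_scale_limit_exists\<close>): the limit of \<open>\<integral> f\<^sub>n \<phi>(x, R x / \<eta>)\<close> is a functional of \<open>\<phi>\<close>, and the
mean value property, \<open>\<integral> \<phi>(x, R x / \<eta>)\<^sup>2 \<longlonglongrightarrow> \<integral>\<integral> \<phi>(x, y)\<^sup>2\<close>, bounds it by the norm of \<open>\<phi>\<close> on the product. The
mean value property is the Riemann--Lebesgue lemma: \<open>exp (2 \<pi> i k \<bullet> R x / \<eta>)\<close> is a wave in \<open>x\<close> of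
frequency \<open>R\<^sup>T k / \<eta>\<close>, and \<open>R\<^sup>T k\<close> is nonzero for \<open>k \<noteq> 0\<close>.

Rellich's theorem is proved by averaging over translations. Near each point of the closure of
\<open>\<Omega>\<close> there are balls of arbitrarily small shifts that keep the nearby part of \<open>\<Omega>\<close> inside \<open>\<Omega>\<close>
(\<open>lipschitz_boundary_inward_shifts\<close>); at the boundary they point inwards. Averaging a function over
such shifts changes it little if its gradient is bounded (\<open>translation_estimate\<close>,
\<open>L2_norm_le_average\<close>), and the averages of a weakly null sequence tend to \<open>0\<close> pointwise and
boundedly.\<close>

section \<open>Square-integrable functions\<close>

lemma L2_real_iff:
  fixes f :: "'a \<Rightarrow> real"
  shows "f \<in> L2 M \<longleftrightarrow> f \<in> borel_measurable M \<and> integrable M (\<lambda>x. (f x)\<^sup>2)"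
  by (simp add: L2_def)

lemma L2_measurable [measurable_dest]: "f \<in> L2 M \<Longrightarrow> f \<in> borel_measurable M"
  by (simp add: L2_def)

lemma L2_norm_real_sq:
  fixes f :: "'a \<Rightarrow> real"
  shows "(L2_norm M f)\<^sup>2 = (\<integral>x. (f x)\<^sup>2 \<partial>M)"
  by (simp add: L2_norm_def)

lemma L2_norm_nonneg [simp]: "0 \<le> L2_norm M f"
  by (simp add: L2_norm_def)

lemma L2_mult_integrable:
  fixes f g :: "'a \<Rightarrow> real"
  assumes f: "f \<in> L2 M" and g: "g \<in> L2 M"
  shows "integrable M (\<lambda>x. f x * g x)"
proof (rule Bochner_Integration.integrable_bound)
  show "integrable M (\<lambda>x. (f x)\<^sup>2 + (g x)\<^sup>2)"
    using assms by (simp add: L2_real_iff)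
  show "(\<lambda>x. f x * g x) \<in> borel_measurable M"
    using assms[THEN L2_measurable] by simp
  have "\<bar>f x * g x\<bar> \<le> (f x)\<^sup>2 + (g x)\<^sup>2" for x
  proof -
    have "0 \<le> (\<bar>f x\<bar> - \<bar>g x\<bar>)\<^sup>2" "0 \<le> \<bar>f x\<bar> * \<bar>g x\<bar>" by simp_all
    then show ?thesis by (simp only: power2_diff abs_mult) (simp only: power2_abs)
  qed
  then show "AE x in M. norm (f x * g x) \<le> norm ((f x)\<^sup>2 + (g x)\<^sup>2)"
    by (intro AE_I2) (simp add: abs_of_nonneg)
qed

lemma L2_add:
  fixes f g :: "'a \<Rightarrow> real"
  assumes "f \<in> L2 M" "g \<in> L2 M"
  shows "(\<lambda>x. f x + g x) \<in> L2 M"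
  using assms L2_mult_integrable[OF assms]
  by (auto simp: L2_real_iff power2_sum mult.assoc)

lemma L2_scale:
  fixes f :: "'a \<Rightarrow> real"
  assumes "f \<in> L2 M"
  shows "(\<lambda>x. c * f x) \<in> L2 M"
  using assms by (auto simp: L2_real_iff power_mult_distrib)

lemma L2_diff:
  fixes f g :: "'a \<Rightarrow> real"
  assumes "f \<in> L2 M" "g \<in> L2 M"
  shows "(\<lambda>x. f x - g x) \<in> L2 M"
  using L2_add[OF assms(1) L2_scale[OF assms(2), of "-1"]] by simp

lemma L2_zero: "(\<lambda>x. 0::real) \<in> L2 M"
  by (simp add: L2_real_iff)

lemma L2_bound:
  fixes f g :: "'a \<Rightarrow> real"
  assumes g: "g \<in> L2 M" and f: "f \<in> borel_measurable M" and le: "AE x in M. \<bar>f x\<bar> \<le> \<bar>g x\<bar>"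
  shows "f \<in> L2 M" and "L2_norm M f \<le> L2_norm M g"
proof -
  have le': "AE x in M. (f x)\<^sup>2 \<le> (g x)\<^sup>2"
    using le by eventually_elim (simp only: abs_le_square_iff)
  have "integrable M (\<lambda>x. (f x)\<^sup>2)"
  proof (rule Bochner_Integration.integrable_bound)
    show "integrable M (\<lambda>x. (g x)\<^sup>2)" using g by (simp add: L2_real_iff)
    show "AE x in M. norm ((f x)\<^sup>2) \<le> norm ((g x)\<^sup>2)"
      using le' by eventually_elim (simp only: real_norm_def abs_power2)
  qed (use f in measurable)
  then show "f \<in> L2 M" using f by (simp add: L2_real_iff)
  then have "(\<integral>x. (f x)\<^sup>2 \<partial>M) \<le> (\<integral>x. (g x)\<^sup>2 \<partial>M)"
    using g by (intro integral_mono_AE[OF _ _ le']) (simp_all add: L2_real_iff)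
  then show "L2_norm M f \<le> L2_norm M g" by (simp add: L2_norm_def)
qed

lemma L2_mult_bounded:
  fixes f h :: "'a \<Rightarrow> real"
  assumes f: "f \<in> L2 M" and h: "h \<in> borel_measurable M" and le: "\<And>x. x \<in> space M \<Longrightarrow> \<bar>h x\<bar> \<le> C"
  shows "(\<lambda>x. f x * h x) \<in> L2 M" and "L2_norm M (\<lambda>x. f x * h x) \<le> \<bar>C\<bar> * L2_norm M f"
proof -
  have le': "AE x in M. \<bar>f x * h x\<bar> \<le> \<bar>C * f x\<bar>"
  proof (intro AE_I2)
    fix x assume "x \<in> space M"
    then have "\<bar>f x\<bar> * \<bar>h x\<bar> \<le> \<bar>f x\<bar> * \<bar>C\<bar>" using le[of x] by (intro mult_left_mono) auto
    then show "\<bar>f x * h x\<bar> \<le> \<bar>C * f x\<bar>" by (simp add: abs_mult mult.commute)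
  qed
  have m: "(\<lambda>x. f x * h x) \<in> borel_measurable M" using f[THEN L2_measurable] h by simp
  show "(\<lambda>x. f x * h x) \<in> L2 M" using L2_bound(1)[OF L2_scale[OF f] m le'] .
  have "L2_norm M (\<lambda>x. C * f x) = \<bar>C\<bar> * L2_norm M f"
    by (simp add: L2_norm_def power_mult_distrib real_sqrt_mult)
  then show "L2_norm M (\<lambda>x. f x * h x) \<le> \<bar>C\<bar> * L2_norm M f"
    using L2_bound(2)[OF L2_scale[OF f] m le'] by simp
qed

lemma nonneg_quadratic_discriminant:
  fixes a b c :: real
  assumes "\<And>t. 0 \<le> a + 2 * t * b + t\<^sup>2 * c"
  shows "b\<^sup>2 \<le> a * c"
proof (cases "c = 0")
  case True
  have "b = 0"
  proof (rule ccontr)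
    assume "b \<noteq> 0"
    with assms[of "- (a + 1) / (2 * b)"] True show False by (simp add: field_simps)
  qed
  then show ?thesis using True by simp
next
  case False
  have "0 \<le> c"
  proof (rule ccontr)
    assume "\<not> 0 \<le> c"
    then have c: "c < 0" by simp
    have "0 \<le> a + t\<^sup>2 * c" for t
      using assms[of t] assms[of "-t"] by simp
    from this[of "sqrt ((\<bar>a\<bar> + 1) / (- c))"] c
    have "0 \<le> a + (\<bar>a\<bar> + 1) / (- c) * c" by (subst (asm) real_sqrt_pow2) (auto intro: divide_nonneg_pos simp: field_simps)
    moreover have "(\<bar>a\<bar> + 1) / (- c) * c = - (\<bar>a\<bar> + 1)" using c by simp
    ultimately show False by linarith
  qed
  with False have "0 < c" by simp
  with assms[of "- b / c"] show ?thesis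
    by (simp add: field_simps power2_eq_square)
qed

lemma L2_expand_sq:
  fixes f g :: "'a \<Rightarrow> real"
  assumes f: "f \<in> L2 M" and g: "g \<in> L2 M"
  shows "(\<integral>x. (f x + t * g x)\<^sup>2 \<partial>M) = (\<integral>x. (f x)\<^sup>2 \<partial>M) + 2 * t * (\<integral>x. f x * g x \<partial>M) + t\<^sup>2 * (\<integral>x. (g x)\<^sup>2 \<partial>M)"
proof -
  have "(\<integral>x. (f x + t * g x)\<^sup>2 \<partial>M) = (\<integral>x. (f x)\<^sup>2 + (2 * t * (f x * g x) + t\<^sup>2 * (g x)\<^sup>2) \<partial>M)"
    by (intro Bochner_Integration.integral_cong refl) (simp add: power2_eq_square algebra_simps)
  also have "\<dots> = (\<integral>x. (f x)\<^sup>2 \<partial>M) + (2 * t * (\<integral>x. f x * g x \<partial>M) + t\<^sup>2 * (\<integral>x. (g x)\<^sup>2 \<partial>M))"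
    using f g L2_mult_integrable[OF f g] by (simp add: L2_real_iff)
  finally show ?thesis by simp
qed

lemma L2_Cauchy_Schwarz:
  fixes f g :: "'a \<Rightarrow> real"
  assumes f: "f \<in> L2 M" and g: "g \<in> L2 M"
  shows "\<bar>\<integral>x. f x * g x \<partial>M\<bar> \<le> L2_norm M f * L2_norm M g"
proof -
  have "(\<integral>x. f x * g x \<partial>M)\<^sup>2 \<le> (\<integral>x. (f x)\<^sup>2 \<partial>M) * (\<integral>x. (g x)\<^sup>2 \<partial>M)"
  proof (rule nonneg_quadratic_discriminant)
    fix t :: real
    have "0 \<le> (\<integral>x. (f x + t * g x)\<^sup>2 \<partial>M)" by simp
    then show "0 \<le> (\<integral>x. (f x)\<^sup>2 \<partial>M) + 2 * t * (\<integral>x. f x * g x \<partial>M) + t\<^sup>2 * (\<integral>x. (g x)\<^sup>2 \<partial>M)"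
      by (simp only: L2_expand_sq[OF f g])
  qed
  then have "(\<integral>x. f x * g x \<partial>M)\<^sup>2 \<le> (L2_norm M f * L2_norm M g)\<^sup>2"
    by (simp add: power_mult_distrib L2_norm_real_sq)
  then have "\<bar>\<integral>x. f x * g x \<partial>M\<bar> \<le> \<bar>L2_norm M f * L2_norm M g\<bar>" by (simp only: abs_le_square_iff)
  then show ?thesis by (simp add: abs_mult)
qed

lemma L2_norm_triangle:
  fixes f g :: "'a \<Rightarrow> real"
  assumes f: "f \<in> L2 M" and g: "g \<in> L2 M"
  shows "L2_norm M (\<lambda>x. f x + g x) \<le> L2_norm M f + L2_norm M g"
proof (rule power2_le_imp_le)
  have "(L2_norm M (\<lambda>x. f x + g x))\<^sup>2 = (L2_norm M f)\<^sup>2 + 2 * (\<integral>x. f x * g x \<partial>M) + (L2_norm M g)\<^sup>2"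
    using L2_expand_sq[OF f g, of 1] by (simp add: L2_norm_real_sq)
  also have "\<dots> \<le> (L2_norm M f + L2_norm M g)\<^sup>2"
    using L2_Cauchy_Schwarz[OF f g] by (simp add: power2_sum)
  finally show "(L2_norm M (\<lambda>x. f x + g x))\<^sup>2 \<le> (L2_norm M f + L2_norm M g)\<^sup>2" .
qed simp

lemma L2_norm_minus_commute:
  fixes f g :: "'a \<Rightarrow> real"
  shows "L2_norm M (\<lambda>x. f x - g x) = L2_norm M (\<lambda>x. g x - f x)"
  by (simp add: L2_norm_def power2_commute)

lemma L2_norm_triangle_diff:
  fixes f g :: "'a \<Rightarrow> real"
  assumes f: "f \<in> L2 M" and g: "g \<in> L2 M"
  shows "\<bar>L2_norm M f - L2_norm M g\<bar> \<le> L2_norm M (\<lambda>x. f x - g x)"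
  using L2_norm_triangle[OF L2_diff[OF f g] g] L2_norm_triangle[OF L2_diff[OF g f] f]
    L2_norm_minus_commute[of M f g] by simp

lemma (in finite_measure) L2_bounded:
  fixes f :: "'a \<Rightarrow> real"
  assumes "f \<in> borel_measurable M" "\<And>x. x \<in> space M \<Longrightarrow> \<bar>f x\<bar> \<le> C"
  shows "f \<in> L2 M"
proof -
  have "(\<lambda>x. 1::real) \<in> L2 M" by (simp add: L2_real_iff)
  from L2_mult_bounded(1)[OF this assms] show ?thesis by simp
qed

lemma (in finite_measure) L2_integrable:
  fixes f :: "'a \<Rightarrow> real"
  assumes "f \<in> L2 M"
  shows "integrable M f"
  using L2_mult_integrable[OF assms, of "\<lambda>x. 1"] by (simp add: L2_real_iff)

lemma (in finite_measure) L2_norm_one: "L2_norm M (\<lambda>x. 1::real) = sqrt (measure M (space M))"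
  by (simp add: L2_norm_def)

lemma (in finite_measure) integral_abs_le_L2_norm:
  fixes f :: "'a \<Rightarrow> real"
  assumes f: "f \<in> L2 M"
  shows "(\<integral>x. \<bar>f x\<bar> \<partial>M) \<le> L2_norm M f * sqrt (measure M (space M))"
proof -
  have "(\<lambda>x. \<bar>f x\<bar>) \<in> L2 M" "(\<lambda>x. 1::real) \<in> L2 M"
    using f f[THEN L2_measurable] by (simp_all add: L2_real_iff)
  from L2_Cauchy_Schwarz[OF this] show ?thesis by (simp add: L2_norm_def)
qed


section \<open>Completeness, representation of functionals and weak compactness\<close>

text \<open>Riesz--Fischer: a rapidly Cauchy subsequence converges almost everywhere because its
  increments are summable in the mean, and Fatou's lemma turns this into convergence in the norm.\<close>

lemma (in finite_measure) L2_complete: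
  fixes f :: "nat \<Rightarrow> 'a \<Rightarrow> real"
  assumes f: "\<And>n. f n \<in> L2 M"
    and Cauchy: "\<And>e. e > 0 \<Longrightarrow> \<exists>N. \<forall>m\<ge>N. \<forall>n\<ge>N. L2_norm M (\<lambda>x. f m x - f n x) < e"
  shows "\<exists>g\<in>L2 M. (\<lambda>n. L2_norm M (\<lambda>x. f n x - g x)) \<longlonglongrightarrow> 0"
proof -
  have "\<exists>N. \<forall>j. \<forall>m\<ge>N j. \<forall>n\<ge>N j. L2_norm M (\<lambda>x. f m x - f n x) < (1/2)^j"
    by (intro choice allI Cauchy) simp
  then obtain N0 where N0: "\<And>j m n. m \<ge> N0 j \<Longrightarrow> n \<ge> N0 j \<Longrightarrow> L2_norm M (\<lambda>x. f m x - f n x) < (1/2)^j"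
    by blast
  \<comment> \<open>The partial sums dominate \<open>N0\<close> and increase; the summand \<open>j\<close> makes \<open>N\<close> tend to infinity.\<close>
  define N where "N j = (\<Sum>i\<le>j. N0 i) + j" for j
  have N0N: "N0 j \<le> N j" for j unfolding N_def by (simp add: trans_le_add1 member_le_sum)
  have N_mono: "N j \<le> N (Suc j)" for j by (simp add: N_def)
  have N_ge: "j \<le> N j" for j by (simp add: N_def)
  define d where "d j x = f (N (Suc j)) x - f (N j) x" for j x
  have d: "d j \<in> L2 M" for j unfolding d_def by (intro L2_diff f)
  have dn: "L2_norm M (d j) \<le> (1/2)^j" for j
    unfolding d_def using N0[of j "N (Suc j)" "N j"] N0N[of j] N_mono[of j] by simp
  have [measurable]: "d j \<in> borel_measurable M" for j using d by (simp add: L2_real_iff)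
  have fm [measurable]: "f j \<in> borel_measurable M" for j using f by (simp add: L2_real_iff)
  have "AE x in M. summable (\<lambda>j. \<bar>d j x\<bar>)"
  proof -
    define B where "B = sqrt (measure M (space M))"
    have le: "(\<integral>x. \<bar>d j x\<bar> \<partial>M) \<le> B * (1/2)^j" for j
    proof -
      have "(\<integral>x. \<bar>d j x\<bar> \<partial>M) \<le> L2_norm M (d j) * B"
        using integral_abs_le_L2_norm[OF d] by (simp add: B_def)
      also have "\<dots> \<le> (1/2)^j * B" by (intro mult_right_mono dn) (simp add: B_def)
      finally show ?thesis by (simp add: mult.commute)
    qed
    have "(\<integral>\<^sup>+x. (\<Sum>j. ennreal \<bar>d j x\<bar>) \<partial>M) = (\<Sum>j. \<integral>\<^sup>+x. ennreal \<bar>d j x\<bar> \<partial>M)"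
      by (intro nn_integral_suminf) simp
    also have "\<dots> = (\<Sum>j. ennreal (\<integral>x. \<bar>d j x\<bar> \<partial>M))"
      by (intro suminf_cong nn_integral_eq_integral integrable_abs L2_integrable d) simp
    also have "\<dots> \<le> (\<Sum>j. ennreal (B * (1/2)^j))"
      by (intro suminf_le ennreal_leI le) auto
    also have "\<dots> = ennreal (\<Sum>j. B * (1/2)^j)"
      by (intro suminf_ennreal2) (auto simp: B_def intro!: summable_mult summable_geometric)
    also have "\<dots> < \<infinity>" by simp
    finally have "AE x in M. (\<Sum>j. ennreal \<bar>d j x\<bar>) \<noteq> \<infinity>"
      by (intro nn_integral_noteq_infinite) auto
    then show ?thesis by eventually_elim (auto intro: summable_suminf_not_top)
  qed
  then have lim: "AE x in M. convergent (\<lambda>j. f (N j) x)"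
  proof eventually_elim
    fix x assume "summable (\<lambda>j. \<bar>d j x\<bar>)"
    then have "summable (\<lambda>j. d j x)" by (rule summable_rabs_cancel)
    then have "convergent (\<lambda>n. \<Sum>j<n. d j x)" by (simp add: summable_iff_convergent)
    moreover have "(\<Sum>j<n. d j x) = f (N n) x - f (N 0) x" for n
      unfolding d_def by (rule sum_lessThan_telescope)
    ultimately have "convergent (\<lambda>n. f (N n) x - f (N 0) x)" by simp
    from convergent_add[OF this convergent_const[of "f (N 0) x"]] show "convergent (\<lambda>n. f (N n) x)" by simp
  qed
  define g where "g x = lim (\<lambda>j. f (N j) x)" for x
  have [measurable]: "g \<in> borel_measurable M" unfolding g_def by measurable
  have gl: "AE x in M. (\<lambda>j. f (N j) x) \<longlonglongrightarrow> g x"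
    using lim by eventually_elim (simp add: g_def convergent_LIMSEQ_iff)
  have key: "integrable M (\<lambda>x. (f n x - g x)\<^sup>2) \<and> L2_norm M (\<lambda>x. f n x - g x) \<le> e"
    if e: "e > 0" and n: "\<forall>m\<ge>n. \<forall>n'\<ge>n. L2_norm M (\<lambda>x. f m x - f n' x) < e" for e n
  proof -
    have "(\<integral>\<^sup>+x. ennreal ((f n x - g x)\<^sup>2) \<partial>M) = (\<integral>\<^sup>+x. liminf (\<lambda>j. ennreal ((f n x - f (N j) x)\<^sup>2)) \<partial>M)"
    proof (intro nn_integral_cong_AE)
      show "AE x in M. ennreal ((f n x - g x)\<^sup>2) = liminf (\<lambda>j. ennreal ((f n x - f (N j) x)\<^sup>2))"
        using gl
      proof eventually_elim
        fix x assume *: "(\<lambda>j. f (N j) x) \<longlonglongrightarrow> g x"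
        have "(\<lambda>j. ennreal ((f n x - f (N j) x)\<^sup>2)) \<longlonglongrightarrow> ennreal ((f n x - g x)\<^sup>2)"
          by (intro tendsto_ennrealI tendsto_intros *)
        then show "ennreal ((f n x - g x)\<^sup>2) = liminf (\<lambda>j. ennreal ((f n x - f (N j) x)\<^sup>2))"
          by (rule lim_imp_Liminf[symmetric, rotated]) simp
      qed
    qed
    also have "\<dots> \<le> liminf (\<lambda>j. \<integral>\<^sup>+x. ennreal ((f n x - f (N j) x)\<^sup>2) \<partial>M)"
      by (intro nn_integral_liminf) simp
    also have "\<dots> \<le> ennreal (e\<^sup>2)"
    proof -
      have "\<forall>\<^sub>F j in sequentially. (\<integral>\<^sup>+x. ennreal ((f n x - f (N j) x)\<^sup>2) \<partial>M) \<le> ennreal (e\<^sup>2)"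
        unfolding eventually_sequentially
      proof (intro exI[of _ n] allI impI)
        fix j assume "n \<le> j"
        then have "N j \<ge> n" using N_ge[of j] by simp
        then have *: "L2_norm M (\<lambda>x. f n x - f (N j) x) < e" using n by simp
        have "(\<integral>\<^sup>+x. ennreal ((f n x - f (N j) x)\<^sup>2) \<partial>M) = ennreal (\<integral>x. (f n x - f (N j) x)\<^sup>2 \<partial>M)"
          using L2_diff[OF f[of n] f[of "N j"]] by (intro nn_integral_eq_integral) (auto simp: L2_real_iff)
        also have "\<dots> = ennreal ((L2_norm M (\<lambda>x. f n x - f (N j) x))\<^sup>2)" by (simp add: L2_norm_real_sq)
        also have "\<dots> \<le> ennreal (e\<^sup>2)" using * by (intro ennreal_leI power_mono) auto
        finally show "(\<integral>\<^sup>+x. ennreal ((f n x - f (N j) x)\<^sup>2) \<partial>M) \<le> ennreal (e\<^sup>2)" .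
      qed
      then show ?thesis
        by (rule order_trans[OF Liminf_le_Limsup[OF trivial_limit_sequentially] Limsup_bounded])
    qed
    finally have *: "(\<integral>\<^sup>+x. ennreal ((f n x - g x)\<^sup>2) \<partial>M) \<le> ennreal (e\<^sup>2)" .
    then have int: "integrable M (\<lambda>x. (f n x - g x)\<^sup>2)"
      by (intro integrableI_bounded) (auto simp: top.extremum_strict less_top[symmetric] top_unique)
    then have "ennreal (\<integral>x. (f n x - g x)\<^sup>2 \<partial>M) \<le> ennreal (e\<^sup>2)"
      using * by (simp add: nn_integral_eq_integral)
    then have "(L2_norm M (\<lambda>x. f n x - g x))\<^sup>2 \<le> e\<^sup>2" by (simp add: L2_norm_real_sq)
    then show ?thesis using int e by (auto intro: power2_le_imp_le)
  qed
  obtain n1 where "\<forall>m\<ge>n1. \<forall>n\<ge>n1. L2_norm M (\<lambda>x. f m x - f n x) < 1"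
    using Cauchy[of 1] by auto
  then have "integrable M (\<lambda>x. (f n1 x - g x)\<^sup>2)" using key[of 1 n1] by simp
  then have "(\<lambda>x. f n1 x - g x) \<in> L2 M" by (simp add: L2_real_iff)
  from L2_diff[OF f[of n1] this] have g: "g \<in> L2 M" by simp
  have "(\<lambda>n. L2_norm M (\<lambda>x. f n x - g x)) \<longlonglongrightarrow> 0"
  proof (rule LIMSEQ_I)
    fix r :: real assume "r > 0"
    then obtain k where k: "\<forall>m\<ge>k. \<forall>n\<ge>k. L2_norm M (\<lambda>x. f m x - f n x) < r/2"
      using Cauchy[of "r/2"] by auto
    have "L2_norm M (\<lambda>x. f n x - g x) \<le> r/2" if "n \<ge> k" for n
      using key[of "r/2" n] that k \<open>r > 0\<close> by simp
    then show "\<exists>no. \<forall>n\<ge>no. norm (L2_norm M (\<lambda>x. f n x - g x) - 0) < r"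
      using \<open>r > 0\<close> by (intro exI[of _ k]) fastforce
  qed
  with g show ?thesis by blast
qed

lemma L2_inner_tendsto:
  fixes f :: "nat \<Rightarrow> 'a \<Rightarrow> real"
  assumes f: "\<And>n. f n \<in> L2 M" and g: "g \<in> L2 M" and h: "h \<in> L2 M"
    and lim: "(\<lambda>n. L2_norm M (\<lambda>x. f n x - g x)) \<longlonglongrightarrow> 0"
  shows "(\<lambda>n. \<integral>x. f n x * h x \<partial>M) \<longlonglongrightarrow> (\<integral>x. g x * h x \<partial>M)"
proof (rule LIM_zero_cancel, rule Lim_null_comparison)
  show "(\<lambda>n. L2_norm M (\<lambda>x. f n x - g x) * L2_norm M h) \<longlonglongrightarrow> 0"
    using tendsto_mult_right[OF lim] by simp
  show "\<forall>\<^sub>F n in sequentially. norm ((\<integral>x. f n x * h x \<partial>M) - (\<integral>x. g x * h x \<partial>M)) \<le> L2_norm M (\<lambda>x. f n x - g x) * L2_norm M h"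
  proof (intro always_eventually allI)
    fix n
    have "(\<integral>x. f n x * h x \<partial>M) - (\<integral>x. g x * h x \<partial>M) = (\<integral>x. (f n x - g x) * h x \<partial>M)"
      using L2_mult_integrable[OF f h] L2_mult_integrable[OF g h]
      by (subst Bochner_Integration.integral_diff[symmetric]) (auto simp: left_diff_distrib)
    then show "norm ((\<integral>x. f n x * h x \<partial>M) - (\<integral>x. g x * h x \<partial>M)) \<le> L2_norm M (\<lambda>x. f n x - g x) * L2_norm M h"
      using L2_Cauchy_Schwarz[OF L2_diff[OF f g] h, of n] by simp
  qed
qed

text \<open>By the parallelogram identity, a minimising sequence of \<open>\<parallel>f\<parallel>\<^sup>2 - 2 L f\<close> in \<open>V\<close> is Cauchy; the first
  variation at its limit \<open>g\<close> is the representation formula. That \<open>g\<close> is a limit of elements of \<open>V\<close> makes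
  the lemma serve as orthogonal projection: for \<open>L f = \<integral> a f\<close> it gives the projection of \<open>a\<close> onto the
  closure of \<open>V\<close>.\<close>

lemma (in finite_measure) L2_Riesz:
  fixes V :: "('a \<Rightarrow> real) set" and L :: "('a \<Rightarrow> real) \<Rightarrow> real"
  assumes V: "V \<subseteq> L2 M" and zero: "(\<lambda>x. 0) \<in> V"
    and add: "\<And>f g. f \<in> V \<Longrightarrow> g \<in> V \<Longrightarrow> (\<lambda>x. f x + g x) \<in> V"
    and scale: "\<And>c f. f \<in> V \<Longrightarrow> (\<lambda>x. c * f x) \<in> V"
    and L_add: "\<And>f g. f \<in> V \<Longrightarrow> g \<in> V \<Longrightarrow> L (\<lambda>x. f x + g x) = L f + L g"
    and L_scale: "\<And>c f. f \<in> V \<Longrightarrow> L (\<lambda>x. c * f x) = c * L f"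
    and L_bound: "\<And>f. f \<in> V \<Longrightarrow> \<bar>L f\<bar> \<le> C * L2_norm M f"
  obtains g \<phi> where "g \<in> L2 M" "\<And>n::nat. \<phi> n \<in> V" "(\<lambda>n. L2_norm M (\<lambda>x. \<phi> n x - g x)) \<longlonglongrightarrow> 0"
    "\<And>f. f \<in> V \<Longrightarrow> (\<integral>x. g x * f x \<partial>M) = L f"
proof -
  define J where "J f = (\<integral>x. (f x)\<^sup>2 \<partial>M) - 2 * L f" for f
  have J_lower: "- C\<^sup>2 \<le> J f" if "f \<in> V" for f
  proof -
    have "0 \<le> (L2_norm M f - C)\<^sup>2" by simp
    then have "- C\<^sup>2 \<le> (L2_norm M f)\<^sup>2 - 2 * (C * L2_norm M f)" by (simp add: power2_diff mult.commute)
    also have "\<dots> \<le> J f" using L_bound[OF that] by (simp add: J_def L2_norm_real_sq)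
    finally show ?thesis .
  qed
  define I where "I = Inf (J ` V)"
  have bdd: "bdd_below (J ` V)" using J_lower by (intro bdd_belowI[of _ "- C\<^sup>2"]) auto
  have I_le: "I \<le> J f" if "f \<in> V" for f
    unfolding I_def by (rule cInf_lower[OF imageI[OF that] bdd])
  have "\<exists>f\<in>V. J f < I + inverse (Suc n)" for n :: nat
  proof -
    have "Inf (J ` V) < I + inverse (Suc n)" by (simp add: I_def)
    moreover have "J ` V \<noteq> {}" using zero by auto
    ultimately show ?thesis by (subst (asm) cInf_less_iff) (auto simp: bdd)
  qed
  then obtain \<phi> where \<phi>: "\<And>n. \<phi> n \<in> V" "\<And>n. J (\<phi> n) < I + inverse (Suc n)" by metis
  have \<phi>L: "\<phi> n \<in> L2 M" for n using \<phi>(1) V by blast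
  \<comment> \<open>The parallelogram identity applied to two nearly minimal elements and their midpoint.\<close>
  have para: "(L2_norm M (\<lambda>x. \<phi> m x - \<phi> n x))\<^sup>2 \<le> 2 * inverse (Suc m) + 2 * inverse (Suc n)" for m n
  proof -
    have mid: "(\<lambda>x. (1/2) * (\<phi> m x + \<phi> n x)) \<in> V" by (rule scale[OF add[OF \<phi>(1) \<phi>(1)]])
    have e1: "(\<integral>x. (\<phi> m x + \<phi> n x)\<^sup>2 \<partial>M) = (\<integral>x. (\<phi> m x)\<^sup>2 \<partial>M) + 2 * (\<integral>x. \<phi> m x * \<phi> n x \<partial>M) + (\<integral>x. (\<phi> n x)\<^sup>2 \<partial>M)"
      using L2_expand_sq[OF \<phi>L[of m] \<phi>L[of n], of 1] by simp
    have e2: "(\<integral>x. (\<phi> m x - \<phi> n x)\<^sup>2 \<partial>M) = (\<integral>x. (\<phi> m x)\<^sup>2 \<partial>M) - 2 * (\<integral>x. \<phi> m x * \<phi> n x \<partial>M) + (\<integral>x. (\<phi> n x)\<^sup>2 \<partial>M)"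
      using L2_expand_sq[OF \<phi>L[of m] \<phi>L[of n], of "-1"] by simp
    have "J (\<lambda>x. (1/2) * (\<phi> m x + \<phi> n x)) = (1/4) * (\<integral>x. (\<phi> m x + \<phi> n x)\<^sup>2 \<partial>M) - (L (\<phi> m) + L (\<phi> n))"
      unfolding J_def L_scale[OF add[OF \<phi>(1) \<phi>(1)]] L_add[OF \<phi>(1) \<phi>(1)]
      by (simp only: power_mult_distrib Bochner_Integration.integral_mult_right_zero) (simp add: power2_eq_square field_simps)
    then have "I \<le> (1/4) * (\<integral>x. (\<phi> m x + \<phi> n x)\<^sup>2 \<partial>M) - (L (\<phi> m) + L (\<phi> n))"
      using I_le[OF mid] by simp
    then show ?thesis using \<phi>(2)[of m] \<phi>(2)[of n] e1 e2
      unfolding J_def L2_norm_real_sq by linarith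
  qed
  have "\<exists>g\<in>L2 M. (\<lambda>n. L2_norm M (\<lambda>x. \<phi> n x - g x)) \<longlonglongrightarrow> 0"
  proof (rule L2_complete[OF \<phi>L])
    fix e :: real assume e: "e > 0"
    obtain N where N: "inverse (Suc N) < e\<^sup>2 / 4" using e reals_Archimedean[of "e\<^sup>2/4"] by auto
    show "\<exists>N. \<forall>m\<ge>N. \<forall>n\<ge>N. L2_norm M (\<lambda>x. \<phi> m x - \<phi> n x) < e"
    proof (intro exI[of _ N] allI impI)
      fix m n assume "N \<le> m" "N \<le> n"
      then have "inverse (real (Suc m)) \<le> inverse (real (Suc N))" "inverse (real (Suc n)) \<le> inverse (real (Suc N))"
        by (auto intro!: le_imp_inverse_le)
      then have "(L2_norm M (\<lambda>x. \<phi> m x - \<phi> n x))\<^sup>2 < e\<^sup>2" using para[of m n] N by linarith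
      then show "L2_norm M (\<lambda>x. \<phi> m x - \<phi> n x) < e" using e by (auto intro: power2_less_imp_less)
    qed
  qed
  then obtain g where g: "g \<in> L2 M" and lim: "(\<lambda>n. L2_norm M (\<lambda>x. \<phi> n x - g x)) \<longlonglongrightarrow> 0" by blast
  have "(\<integral>x. g x * f x \<partial>M) = L f" if f: "f \<in> V" for f
  proof -
    have fL: "f \<in> L2 M" using f V by blast
    have "0 \<le> 0 + 2 * t * ((\<integral>x. g x * f x \<partial>M) - L f) + t\<^sup>2 * (\<integral>x. (f x)\<^sup>2 \<partial>M)" for t
    proof (rule LIMSEQ_le)
      show "(\<lambda>n. - inverse (real (Suc n))) \<longlonglongrightarrow> 0" using tendsto_minus[OF LIMSEQ_inverse_real_of_nat] by simp
      have "(\<lambda>n. 0 + 2 * t * ((\<integral>x. \<phi> n x * f x \<partial>M) - L f) + t\<^sup>2 * (\<integral>x. (f x)\<^sup>2 \<partial>M)) \<longlonglongrightarrow> 0 + 2 * t * ((\<integral>x. g x * f x \<partial>M) - L f) + t\<^sup>2 * (\<integral>x. (f x)\<^sup>2 \<partial>M)"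
        by (intro tendsto_intros L2_inner_tendsto[OF \<phi>L g fL lim])
      then show "(\<lambda>n. 0 + 2 * t * ((\<integral>x. \<phi> n x * f x \<partial>M) - L f) + t\<^sup>2 * (\<integral>x. (f x)\<^sup>2 \<partial>M)) \<longlonglongrightarrow> 0 + 2 * t * ((\<integral>x. g x * f x \<partial>M) - L f) + t\<^sup>2 * (\<integral>x. (f x)\<^sup>2 \<partial>M)" .
      have "- inverse (real (Suc n)) \<le> 0 + 2 * t * ((\<integral>x. \<phi> n x * f x \<partial>M) - L f) + t\<^sup>2 * (\<integral>x. (f x)\<^sup>2 \<partial>M)" for n
      proof -
        have "I \<le> J (\<lambda>x. \<phi> n x + t * f x)" by (intro I_le add \<phi> scale f)
        also have "\<dots> = J (\<phi> n) + 2 * t * ((\<integral>x. \<phi> n x * f x \<partial>M) - L f) + t\<^sup>2 * (\<integral>x. (f x)\<^sup>2 \<partial>M)"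
          unfolding J_def L2_expand_sq[OF \<phi>L fL] L_add[OF \<phi>(1) scale[OF f]] L_scale[OF f] by (simp add: algebra_simps)
        finally show ?thesis using \<phi>(2)[of n] by simp
      qed
      then show "\<exists>N. \<forall>n\<ge>N. - inverse (real (Suc n)) \<le> 0 + 2 * t * ((\<integral>x. \<phi> n x * f x \<partial>M) - L f) + t\<^sup>2 * (\<integral>x. (f x)\<^sup>2 \<partial>M)"
        by blast
    qed
    from nonneg_quadratic_discriminant[OF this] show ?thesis by simp
  qed
  then show thesis using that[OF g \<phi>(1) lim] by blast
qed

definition weakly_tendsto :: "'a measure \<Rightarrow> (nat \<Rightarrow> 'a \<Rightarrow> real) \<Rightarrow> ('a \<Rightarrow> real) \<Rightarrow> bool" where
  "weakly_tendsto M f g \<longleftrightarrow> g \<in> L2 M \<and>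
     (\<forall>a\<in>L2 M. (\<lambda>n. \<integral>x. f n x * a x \<partial>M) \<longlonglongrightarrow> (\<integral>x. g x * a x \<partial>M))"

text \<open>The functions against which the sequence converges form a closed subspace \<open>V\<close> that contains
  every \<open>f m\<close>. A function and its projection onto \<open>V\<close> have the same products with all \<open>f m\<close>, so \<open>V\<close> is
  the whole space, and the limit functional is represented by some \<open>g\<close>.\<close>

lemma (in finite_measure) L2_weak_limit:
  fixes f :: "nat \<Rightarrow> 'a \<Rightarrow> real"
  assumes f: "\<And>n. f n \<in> L2 M" and bound: "\<And>n. L2_norm M (f n) \<le> C"
    and conv: "\<And>m. convergent (\<lambda>n. \<integral>x. f n x * f m x \<partial>M)"
  shows "\<exists>g. weakly_tendsto M f g"
proof -
  define V where "V = {a \<in> L2 M. convergent (\<lambda>n. \<integral>x. f n x * a x \<partial>M)}"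
  define L where "L a = lim (\<lambda>n. \<integral>x. f n x * a x \<partial>M)" for a
  have Llim: "(\<lambda>n. \<integral>x. f n x * a x \<partial>M) \<longlonglongrightarrow> L a" if "a \<in> V" for a
    using that by (simp add: V_def L_def convergent_LIMSEQ_iff)
  have VI: "a \<in> V" "L a = l" if "a \<in> L2 M" "(\<lambda>n. \<integral>x. f n x * a x \<partial>M) \<longlonglongrightarrow> l" for a l
    using that by (auto simp: V_def L_def convergent_def limI)
  have C: "0 \<le> C" using bound[of 0] L2_norm_nonneg[of M "f 0"] by linarith
  have VL: "V \<subseteq> L2 M" by (auto simp: V_def)
  have f0: "(\<lambda>n. \<integral>x. f n x * 0 \<partial>M) \<longlonglongrightarrow> 0" by simp
  have addlim: "(\<lambda>n. \<integral>x. f n x * (a x + b x) \<partial>M) \<longlonglongrightarrow> L a + L b" if "a \<in> V" "b \<in> V" for a b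
  proof -
    have "a \<in> L2 M" "b \<in> L2 M" using that VL by auto
    then have "(\<integral>x. f n x * (a x + b x) \<partial>M) = (\<integral>x. f n x * a x \<partial>M) + (\<integral>x. f n x * b x \<partial>M)" for n
      using L2_mult_integrable[OF f] by (simp add: distrib_left)
    then show ?thesis using tendsto_add[OF Llim[OF that(1)] Llim[OF that(2)]] by simp
  qed
  have scalelim: "(\<lambda>n. \<integral>x. f n x * (c * a x) \<partial>M) \<longlonglongrightarrow> c * L a" if "a \<in> V" for a c
  proof -
    have "(\<integral>x. f n x * (c * a x) \<partial>M) = c * (\<integral>x. f n x * a x \<partial>M)" for n
      by (subst Bochner_Integration.integral_mult_right_zero[symmetric]) (simp add: mult.left_commute)
    then show ?thesis using tendsto_mult_left[OF Llim[OF that]] by simp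
  qed
  have pair_le: "\<bar>\<integral>x. f n x * a x \<partial>M\<bar> \<le> C * L2_norm M a" if "a \<in> L2 M" for a n
    using L2_Cauchy_Schwarz[OF f that, of n] mult_right_mono[OF bound[of n] L2_norm_nonneg[of M a]] by linarith
  have Lb: "\<bar>L a\<bar> \<le> C * L2_norm M a" if "a \<in> V" for a
    using tendsto_rabs[OF Llim[OF that]] pair_le[of a] that VL
    by (intro LIMSEQ_le_const2[of "\<lambda>n. \<bar>\<integral>x. f n x * a x \<partial>M\<bar>"]) auto
  have zeroV: "(\<lambda>x. 0) \<in> V" by (rule VI(1)[OF L2_zero f0])
  have addV: "(\<lambda>x. a x + b x) \<in> V" if "a \<in> V" "b \<in> V" for a b
    using that VL by (intro VI(1)[OF L2_add addlim]) auto
  have scaleV: "(\<lambda>x. c * a x) \<in> V" if "a \<in> V" for a c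
    using that VL by (intro VI(1)[OF L2_scale scalelim]) auto
  obtain g where g: "g \<in> L2 M" and gL: "\<And>a. a \<in> V \<Longrightarrow> (\<integral>x. g x * a x \<partial>M) = L a"
  proof (rule L2_Riesz[of V L C])
    show "\<And>a b. a \<in> V \<Longrightarrow> b \<in> V \<Longrightarrow> L (\<lambda>x. a x + b x) = L a + L b"
      using VL by (intro VI(2) addlim L2_add) auto
    show "\<And>c a. a \<in> V \<Longrightarrow> L (\<lambda>x. c * a x) = c * L a"
      using VL by (intro VI(2) scalelim L2_scale) auto
  qed (use VL zeroV addV scaleV Lb in auto)
  have fV: "f m \<in> V" for m using f conv by (simp add: V_def)
  have closed: "a \<in> V" if a: "a \<in> L2 M" and b: "\<And>j. b j \<in> V" and
    ba: "(\<lambda>j. L2_norm M (\<lambda>x. b j x - a x)) \<longlonglongrightarrow> 0" for a and b :: "nat \<Rightarrow> 'a \<Rightarrow> real"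
  proof -
    have bL: "b j \<in> L2 M" for j using b VL by blast
    have "Cauchy (\<lambda>n. \<integral>x. f n x * a x \<partial>M)"
    proof (rule CauchyI)
      fix e :: real assume e: "0 < e"
      have "0 < e / (3 * (C + 1))" using e C by simp
      then obtain j where "L2_norm M (\<lambda>x. b j x - a x) < e / (3 * (C + 1))"
        using LIMSEQ_D[OF ba] by fastforce
      then have "(C + 1) * L2_norm M (\<lambda>x. b j x - a x) < e / 3" using C by (simp add: field_simps)
      then have j: "C * L2_norm M (\<lambda>x. b j x - a x) < e / 3"
        using L2_norm_nonneg[of M "\<lambda>x. b j x - a x"] unfolding distrib_right by linarith
      have diff: "\<bar>(\<integral>x. f n x * b j x \<partial>M) - (\<integral>x. f n x * a x \<partial>M)\<bar> < e / 3" for n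
      proof -
        have "(\<integral>x. f n x * b j x \<partial>M) - (\<integral>x. f n x * a x \<partial>M) = (\<integral>x. f n x * (b j x - a x) \<partial>M)"
          using L2_mult_integrable[OF f bL] L2_mult_integrable[OF f a]
          by (simp add: right_diff_distrib)
        then show ?thesis using pair_le[OF L2_diff[OF bL[of j] a], of n] j by simp
      qed
      have "Cauchy (\<lambda>n. \<integral>x. f n x * b j x \<partial>M)" using Llim[OF b] by (rule LIMSEQ_imp_Cauchy)
      then obtain N where N: "\<And>m n. m \<ge> N \<Longrightarrow> n \<ge> N \<Longrightarrow> \<bar>(\<integral>x. f m x * b j x \<partial>M) - (\<integral>x. f n x * b j x \<partial>M)\<bar> < e / 3"
        using CauchyD[of "\<lambda>n. \<integral>x. f n x * b j x \<partial>M" "e/3"] e unfolding real_norm_def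
        by (metis divide_pos_pos zero_less_numeral)
      show "\<exists>N. \<forall>m\<ge>N. \<forall>n\<ge>N. norm ((\<integral>x. f m x * a x \<partial>M) - (\<integral>x. f n x * a x \<partial>M)) < e"
      proof (intro exI[of _ N] allI impI)
        fix m n assume "N \<le> m" "N \<le> n"
        then show "norm ((\<integral>x. f m x * a x \<partial>M) - (\<integral>x. f n x * a x \<partial>M)) < e"
          using N[of m n] diff[of m] diff[of n] by (simp add: abs_if split: if_splits)
      qed
    qed
    then show ?thesis using a by (simp add: V_def Cauchy_convergent_iff)
  qed
  \<comment> \<open>The projection of \<open>a\<close> onto \<open>V\<close> has the same products with all \<open>f m\<close>, hence \<open>V\<close> is everything.\<close>
  have all: "a \<in> V" if a: "a \<in> L2 M" for a
  proof -
    obtain h b where h: "h \<in> L2 M" and b: "\<And>n::nat. b n \<in> V"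
      and bh: "(\<lambda>n. L2_norm M (\<lambda>x. b n x - h x)) \<longlonglongrightarrow> 0"
      and ha: "\<And>c. c \<in> V \<Longrightarrow> (\<integral>x. h x * c x \<partial>M) = (\<integral>x. a x * c x \<partial>M)"
    proof (rule L2_Riesz[of V "\<lambda>c. \<integral>x. a x * c x \<partial>M" "L2_norm M a"])
      show "(\<integral>x. a x * (c x + d x) \<partial>M) = (\<integral>x. a x * c x \<partial>M) + (\<integral>x. a x * d x \<partial>M)" if "c \<in> V" "d \<in> V" for c d
        using that VL L2_mult_integrable[OF a] by (subst Bochner_Integration.integral_add[symmetric]) (auto simp: distrib_left)
      show "(\<integral>x. a x * (k * c x) \<partial>M) = k * (\<integral>x. a x * c x \<partial>M)" for k c
        by (subst Bochner_Integration.integral_mult_right_zero[symmetric]) (simp add: mult.left_commute)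
      show "\<bar>\<integral>x. a x * c x \<partial>M\<bar> \<le> L2_norm M a * L2_norm M c" if "c \<in> V" for c
        using that VL by (intro L2_Cauchy_Schwarz a) auto
    qed (use VL zeroV addV scaleV in auto)
    have "h \<in> V" by (rule closed[OF h b bh])
    moreover have "(\<integral>x. f m x * h x \<partial>M) = (\<integral>x. f m x * a x \<partial>M)" for m
      using ha[OF fV[of m]] by (simp add: mult.commute)
    ultimately show ?thesis using a by (simp add: V_def)
  qed
  have "weakly_tendsto M f g"
    unfolding weakly_tendsto_def using g gL Llim[OF all] all by simp
  then show ?thesis by blast
qed

lemma countable_family_convergent_subsequence:
  fixes a :: "'i::countable \<Rightarrow> nat \<Rightarrow> real"
  assumes "\<And>i. Bseq (a i)"
  obtains s :: "nat \<Rightarrow> nat" where "strict_mono s" "\<And>i. convergent (a i \<circ> s)"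
proof -
  interpret subseqs "\<lambda>j s. convergent (a (from_nat j) \<circ> s)"
  proof
    fix j and s :: "nat \<Rightarrow> nat" assume "strict_mono s"
    have "bounded (range (a (from_nat j) \<circ> s))"
      using assms[of "from_nat j"] unfolding Bseq_eq_bounded by (rule bounded_subset) auto
    from bounded_imp_convergent_subsequence[OF this] obtain l r where "strict_mono r" "((a (from_nat j) \<circ> s) \<circ> r) \<longlonglongrightarrow> l"
      by blast
    then show "\<exists>r. strict_mono r \<and> convergent (a (from_nat j) \<circ> (s \<circ> r))"
      by (auto simp: convergent_def comp_assoc)
  qed
  \<comment> \<open>The diagonal sequence is, from the index \<open>Suc j\<close> on, a subsequence of the \<open>j\<close>-th extraction.\<close>
  have *: "convergent (a (from_nat j) \<circ> (diagseq \<circ> ((+) (Suc j))))" for j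
  proof (rule diagseq_holds)
    fix x and r s :: "nat \<Rightarrow> nat" assume "strict_mono r" "convergent (a (from_nat x) \<circ> s)"
    then show "convergent (a (from_nat x) \<circ> (s \<circ> r))"
      using convergent_subseq_convergent[of "a (from_nat x) \<circ> s" r] by (simp add: comp_assoc)
  qed
  have "convergent (a i \<circ> diagseq)" for i
  proof -
    have "convergent (\<lambda>n. (a i \<circ> diagseq) (n + Suc (to_nat i)))"
      using *[of "to_nat i"] by (simp add: o_def add.commute)
    then show ?thesis by (simp only: convergent_ignore_initial_segment)
  qed
  with subseq_diagseq show thesis by (rule that)
qed

text \<open>The sequences to be diagonalised are the numbers \<open>\<integral> (f i n) (f i m)\<close> in \<open>n\<close>, one for each
  pair \<open>(i, m)\<close>.\<close>

lemma (in finite_measure) L2_bounded_family_weak_subsequence: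
  fixes f :: "'i::countable \<Rightarrow> nat \<Rightarrow> 'a \<Rightarrow> real"
  assumes f: "\<And>i n. f i n \<in> L2 M" and bound: "\<And>i n. L2_norm M (f i n) \<le> C i"
  obtains s :: "nat \<Rightarrow> nat" and g where "strict_mono s" "\<And>i. weakly_tendsto M (\<lambda>n. f i (s n)) (g i)"
proof -
  define a where "a = (\<lambda>(i, m) n. \<integral>x. f i n x * f i m x \<partial>M)"
  have "Bseq (a im)" for im
  proof (cases im)
    case (Pair i m)
    show ?thesis
    proof (rule BseqI')
      show "norm (a im n) \<le> C i * C i" for n
        using L2_Cauchy_Schwarz[OF f f, of i n i m] mult_mono[OF bound[of i n] bound[of i m]]
          L2_norm_nonneg[of M "f i n"] bound[of i n] by (simp add: a_def Pair)
    qed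
  qed
  then obtain s where s: "strict_mono s" "\<And>im. convergent (a im \<circ> s)"
    using countable_family_convergent_subsequence by blast
  have "\<exists>g. weakly_tendsto M (\<lambda>n. f i (s n)) g" for i
  proof (rule L2_weak_limit)
    show "convergent (\<lambda>n. \<integral>x. f i (s n) x * f i (s m) x \<partial>M)" for m
      using s(2)[of "(i, s m)"] by (simp add: a_def o_def)
  qed (use f bound in auto)
  then obtain g where "\<And>i. weakly_tendsto M (\<lambda>n. f i (s n)) (g i)" by metis
  with s(1) show thesis by (rule that)
qed


section \<open>Vector-valued square-integrable functions\<close>

lemma L2_component:
  fixes g :: "'a \<Rightarrow> 'b::euclidean_space"
  assumes g: "g \<in> L2 M"
  shows "(\<lambda>x. g x \<bullet> z) \<in> L2 M" and "L2_norm M (\<lambda>x. g x \<bullet> z) \<le> norm z * L2_norm M g"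
proof -
  have n: "(\<lambda>x. norm (g x)) \<in> L2 M" using g by (auto simp: L2_def)
  have m: "(\<lambda>x. g x \<bullet> z) \<in> borel_measurable M" using g by (auto simp: L2_def)
  have le: "AE x in M. \<bar>g x \<bullet> z\<bar> \<le> \<bar>norm z * norm (g x)\<bar>"
  proof (intro AE_I2)
    fix x
    have "\<bar>g x \<bullet> z\<bar> \<le> norm (g x) * norm z" by (rule Cauchy_Schwarz_ineq2)
    then show "\<bar>g x \<bullet> z\<bar> \<le> \<bar>norm z * norm (g x)\<bar>" by (simp add: mult.commute)
  qed
  show "(\<lambda>x. g x \<bullet> z) \<in> L2 M" by (rule L2_bound(1)[OF L2_scale[OF n] m le])
  have "L2_norm M (\<lambda>x. norm z * norm (g x)) = norm z * L2_norm M g"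
    by (simp add: L2_norm_def power_mult_distrib real_sqrt_mult)
  then show "L2_norm M (\<lambda>x. g x \<bullet> z) \<le> norm z * L2_norm M g"
    using L2_bound(2)[OF L2_scale[OF n] m le] by simp
qed

lemma L2_norm_norm:
  assumes "f \<in> L2 M"
  shows "(\<lambda>x. norm (f x)) \<in> L2 M" "L2_norm M (\<lambda>x. norm (f x)) = L2_norm M f"
  using assms by (auto simp: L2_def L2_norm_def)

lemma L2_vec_diff:
  fixes f g :: "'a \<Rightarrow> 'b::euclidean_space"
  assumes f: "f \<in> L2 M" and g: "g \<in> L2 M"
  shows "(\<lambda>x. f x - g x) \<in> L2 M" "L2_norm M (\<lambda>x. f x - g x) \<le> L2_norm M f + L2_norm M g"
proof -
  note fn = L2_norm_norm[OF f] and gn = L2_norm_norm[OF g]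
  have "f \<in> borel_measurable M" "g \<in> borel_measurable M" using f g by (simp_all add: L2_def)
  then have m: "(\<lambda>x. f x - g x) \<in> borel_measurable M" by (rule borel_measurable_diff)
  have m': "(\<lambda>x. norm (f x - g x)) \<in> borel_measurable M" using m by measurable
  have le: "AE x in M. \<bar>norm (f x - g x)\<bar> \<le> \<bar>norm (f x) + norm (g x)\<bar>"
    using norm_triangle_ineq4 by (intro AE_I2) auto
  note b = L2_bound[OF L2_add[OF fn(1) gn(1)] m' le]
  show "(\<lambda>x. f x - g x) \<in> L2 M" using b(1) m by (simp add: L2_def)
  have "L2_norm M (\<lambda>x. f x - g x) = L2_norm M (\<lambda>x. norm (f x - g x))" by (simp add: L2_norm_def)
  also have "\<dots> \<le> L2_norm M f + L2_norm M g"
    using b(2) L2_norm_triangle[OF fn(1) gn(1)] unfolding fn(2) gn(2) by linarith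
  finally show "L2_norm M (\<lambda>x. f x - g x) \<le> L2_norm M f + L2_norm M g" .
qed

lemma L2_cong:
  assumes "\<And>x. x \<in> space M \<Longrightarrow> f x = g x"
  shows "f \<in> L2 M \<longleftrightarrow> g \<in> L2 M"
proof -
  have "f \<in> borel_measurable M \<longleftrightarrow> g \<in> borel_measurable M" using assms by (rule measurable_cong)
  moreover have "integrable M (\<lambda>x. (norm (f x))\<^sup>2) \<longleftrightarrow> integrable M (\<lambda>x. (norm (g x))\<^sup>2)"
    using assms by (intro Bochner_Integration.integrable_cong) auto
  ultimately show ?thesis by (simp add: L2_def)
qed

lemma L2_vecI:
  fixes f :: "'a \<Rightarrow> real^'n"
  assumes "\<And>j. (\<lambda>x. f x $ j) \<in> L2 M"
  shows "f \<in> L2 M"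
proof -
  have "(\<lambda>x. f x \<bullet> b) \<in> borel_measurable M" if "b \<in> Basis" for b
    using that L2_measurable[OF assms] by (auto simp: Basis_vec_def inner_axis)
  then have m: "f \<in> borel_measurable M" by (subst borel_measurable_euclidean_space) auto
  have "(norm (f x))\<^sup>2 = (\<Sum>j\<in>UNIV. (f x $ j)\<^sup>2)" for x
    by (simp add: norm_vec_def L2_set_def sum_nonneg)
  then show ?thesis using m assms by (auto simp: L2_def)
qed


section \<open>Smooth functions and test functions\<close>

lemma C_k_SucI:
  fixes f :: "'a::euclidean_space \<Rightarrow> real"
  assumes D: "\<And>x. (f has_derivative D x) (at x)" and C: "\<And>b. b \<in> Basis \<Longrightarrow> C_k k (\<lambda>x. D x b)"
  shows "C_k (Suc k) f"
proof -
  have "frechet_derivative f (at x) = D x" for x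
    using frechet_derivative_at[OF D] by simp
  moreover have "f differentiable_on UNIV"
    using D by (auto simp: differentiable_on_def differentiable_def)
  ultimately show ?thesis using C by simp
qed

lemma C_k_Suc_has_derivative:
  assumes "C_k (Suc k) f"
  shows "(f has_derivative frechet_derivative f (at x)) (at x)"
proof -
  have "f differentiable (at x)" using assms by (simp add: differentiable_on_def)
  then show ?thesis by (simp add: frechet_derivative_works)
qed

lemma C_k_SucD: "C_k (Suc k) f \<Longrightarrow> C_k k f"
proof (induction k arbitrary: f)
  case 0
  then show ?case by (auto intro: differentiable_imp_continuous_on)
qed simp

lemma C_k_const: "C_k k (\<lambda>x::'a::euclidean_space. c)"
proof (induction k arbitrary: c)
  case (Suc k)
  show ?case by (rule C_k_SucI[where D = "\<lambda>x h. 0"]) (auto intro: Suc)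
qed simp

lemma C_k_add: "C_k k f \<Longrightarrow> C_k k g \<Longrightarrow> C_k k (\<lambda>x. f x + g x)"
proof (induction k arbitrary: f g)
  case 0
  then show ?case by (auto intro: continuous_intros)
next
  case (Suc k)
  show ?case
    by (rule C_k_SucI[OF has_derivative_add[OF Suc.prems[THEN C_k_Suc_has_derivative]]])
      (use Suc in auto)
qed

lemma C_k_mult: "C_k k f \<Longrightarrow> C_k k g \<Longrightarrow> C_k k (\<lambda>x. f x * g x)"
proof (induction k arbitrary: f g)
  case 0
  then show ?case by (auto intro: continuous_intros)
next
  case (Suc k)
  show ?case
    by (rule C_k_SucI[OF has_derivative_mult[OF Suc.prems[THEN C_k_Suc_has_derivative]]])
      (intro C_k_add Suc.IH C_k_SucD[OF Suc.prems(1)] C_k_SucD[OF Suc.prems(2)]; use Suc.prems in auto)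
qed

lemma C_k_power: "C_k k f \<Longrightarrow> C_k k (\<lambda>x. f x ^ n)"
  by (induction n) (auto intro: C_k_const C_k_mult)

lemma C_k_prod: "(\<And>i. i \<in> I \<Longrightarrow> C_k k (f i)) \<Longrightarrow> C_k k (\<lambda>x. \<Prod>i\<in>I. f i x)"
  by (induction I rule: infinite_finite_induct) (auto intro: C_k_const C_k_mult)

lemma has_derivative_shift:
  fixes f :: "'a::euclidean_space \<Rightarrow> real"
  assumes "C_k (Suc k) f"
  shows "((\<lambda>x. f (x - z)) has_derivative frechet_derivative f (at (x - z))) (at x)"
proof -
  have "((\<lambda>x. x - z) has_derivative (\<lambda>h. h)) (at x)" by (auto intro!: derivative_eq_intros)
  from has_derivative_compose[OF this C_k_Suc_has_derivative[OF assms]] show ?thesis .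
qed

lemma C_k_shift: "C_k k f \<Longrightarrow> C_k k (\<lambda>x. f (x - z))"
proof (induction k arbitrary: f)
  case 0
  then have "continuous_on UNIV f" by simp
  then show ?case by (auto intro!: continuous_on_compose2[of UNIV f] continuous_intros)
next
  case (Suc k)
  show ?case
    by (rule C_k_SucI[OF has_derivative_shift[OF Suc.prems]])
      (intro Suc.IH; use Suc.prems in auto)
qed

text \<open>Differentiation shifts the phase \<open>c\<close> by \<open>\<pi>/2\<close>, so that this family contains its derivatives.\<close>

lemma C_k_cos: "C_k k (\<lambda>x::'a::euclidean_space. A * cos (a \<bullet> x + c))"
proof (induction k arbitrary: A c)
  case 0
  show ?case by (auto intro!: continuous_intros)
next
  case (Suc k)
  have D: "((\<lambda>x. A * cos (a \<bullet> x + c)) has_derivative (\<lambda>h. (A * (a \<bullet> h)) * cos (a \<bullet> x + (c + pi / 2)))) (at x)" for x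
    by (auto intro!: derivative_eq_intros simp: add.assoc[symmetric] cos_add[of _ "pi/2"])
  show ?case by (rule C_k_SucI[OF D]) (rule Suc)
qed

text \<open>The classical flat function is the case \<open>j = 0\<close>; the powers make the family closed under
  differentiation.\<close>

definition flat_exp :: "nat \<Rightarrow> real \<Rightarrow> real" where
  "flat_exp j t = (if 0 < t then inverse t ^ j * exp (- inverse t) else 0)"

lemma flat_exp_tendsto_0: "((\<lambda>t. flat_exp j t) \<longlongrightarrow> 0) (at 0)"
proof -
  have "((\<lambda>t. flat_exp j t) \<longlongrightarrow> 0) (at_right 0)"
    unfolding filterlim_at_right_to_top
  proof (rule Lim_transform_eventually)
    show "((\<lambda>x::real. x ^ j / exp x) \<longlongrightarrow> 0) at_top" by (rule tendsto_power_div_exp_0)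
    show "\<forall>\<^sub>F x in at_top. x ^ j / exp x = flat_exp j (inverse x)"
      using eventually_gt_at_top[of 0] by eventually_elim (simp add: flat_exp_def exp_minus field_simps)
  qed
  moreover have "((\<lambda>t. flat_exp j t) \<longlongrightarrow> 0) (at_left 0)"
    by (rule Lim_transform_eventually[OF tendsto_const])
      (auto simp: eventually_at_filter flat_exp_def)
  ultimately show ?thesis by (simp add: filterlim_split_at)
qed

lemma flat_exp_deriv:
  "(flat_exp j has_real_derivative (- real j * flat_exp (Suc j) t + flat_exp (Suc (Suc j)) t)) (at t)"
proof -
  consider "t > 0" | "t < 0" | "t = 0" by linarith
  then show ?thesis
  proof cases
    case 1
    have "((\<lambda>t. inverse t ^ j * exp (- inverse t)) has_real_derivative
        (- real j * flat_exp (Suc j) t + flat_exp (Suc (Suc j)) t)) (at t)"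
    proof -
      have "((\<lambda>t. inverse t ^ j) has_real_derivative (- real j * inverse t ^ Suc j)) (at t)"
      proof -
        have t: "t \<noteq> 0" using 1 by simp
        have "real j * (- (inverse t ^ Suc (Suc 0)) * inverse t ^ (j - Suc 0)) = - real j * inverse t ^ Suc j"
          by (cases j) (simp_all add: algebra_simps)
        then show ?thesis using DERIV_power[OF DERIV_inverse[OF t], of j] by (simp only:)
      qed
      moreover have "((\<lambda>t. exp (- inverse t)) has_real_derivative (inverse t ^ 2 * exp (- inverse t))) (at t)"
        using 1 by (auto intro!: derivative_eq_intros simp: power2_eq_square)
      ultimately have "((\<lambda>t. inverse t ^ j * exp (- inverse t)) has_real_derivative
          (- real j * inverse t ^ Suc j) * exp (- inverse t) + (inverse t ^ 2 * exp (- inverse t)) * inverse t ^ j) (at t)"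
        by (rule DERIV_mult)
      then show ?thesis using 1 by (simp add: flat_exp_def power2_eq_square algebra_simps)
    qed
    moreover have "\<forall>\<^sub>F s in nhds t. flat_exp j s = inverse s ^ j * exp (- inverse s)"
      using eventually_nhds_in_open[of "{0<..}" t] 1 by (auto elim!: eventually_mono simp: flat_exp_def)
    ultimately show ?thesis by (subst DERIV_cong_ev) (auto simp: 1)
  next
    case 2
    have "\<forall>\<^sub>F s in nhds t. flat_exp j s = 0"
      using eventually_nhds_in_open[of "{..<0}" t] 2 by (auto elim!: eventually_mono simp: flat_exp_def)
    then show ?thesis using 2 by (subst DERIV_cong_ev) (auto simp: flat_exp_def)
  next
    case 3
    \<comment> \<open>The difference quotient at \<open>0\<close> is the next member of the family.\<close>
    have "((\<lambda>h. (flat_exp j (0 + h) - flat_exp j 0) / h) \<longlongrightarrow> 0) (at 0)"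
    proof (rule Lim_transform_eventually[OF flat_exp_tendsto_0[of "Suc j"]])
      show "\<forall>\<^sub>F h in at 0. flat_exp (Suc j) h = (flat_exp j (0 + h) - flat_exp j 0) / h"
        by (rule always_eventually) (simp add: flat_exp_def field_simps)
    qed
    then show ?thesis by (simp add: 3 DERIV_def flat_exp_def)
  qed
qed

lemma C_k_flat_exp: "C_k k (\<lambda>x::'a::euclidean_space. A * flat_exp j (a \<bullet> x + c))"
proof (induction k arbitrary: A j)
  case 0
  have "continuous_on UNIV (flat_exp j)"
    using flat_exp_deriv by (intro continuous_at_imp_continuous_on ballI DERIV_isCont)
  then show ?case by (auto intro!: continuous_intros continuous_on_compose2[of UNIV "flat_exp j"])
next
  case (Suc k)
  let ?D = "\<lambda>x h. (A * (a \<bullet> h) * (- real j)) * flat_exp (Suc j) (a \<bullet> x + c) + (A * (a \<bullet> h)) * flat_exp (Suc (Suc j)) (a \<bullet> x + c)"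
  have D: "((\<lambda>x. A * flat_exp j (a \<bullet> x + c)) has_derivative ?D x) (at x)" for x
    by (auto intro!: derivative_eq_intros DERIV_compose_FDERIV[OF flat_exp_deriv] simp: algebra_simps)
  show ?case by (rule C_k_SucI[OF D]) (intro C_k_add Suc)
qed

lemma flat_exp_0_bounds: "0 \<le> flat_exp 0 t" "flat_exp 0 t < 1" "0 < flat_exp 0 t \<longleftrightarrow> 0 < t"
  by (auto simp: flat_exp_def)


lemma test_functionsD:
  assumes "\<psi> \<in> test_functions \<Omega>"
  shows "C_k k \<psi>" "compact (closure {x. \<psi> x \<noteq> 0})" "closure {x. \<psi> x \<noteq> 0} \<subseteq> \<Omega>"
  using assms by (auto simp: test_functions_def)

lemma test_functionsI:
  assumes "\<And>k. C_k k \<psi>" and "compact K" "{x. \<psi> x \<noteq> 0} \<subseteq> K" "K \<subseteq> \<Omega>"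
  shows "\<psi> \<in> test_functions \<Omega>"
proof -
  have "closure {x. \<psi> x \<noteq> 0} \<subseteq> K" using assms by (intro closure_minimal compact_imp_closed)
  then show ?thesis using assms unfolding test_functions_def
    by (auto intro: compact_closure[THEN iffD2] bounded_subset[OF compact_imp_bounded])
qed

lemma test_functions_support:
  assumes "\<psi> \<in> test_functions \<Omega>"
  obtains K where "compact K" "K \<subseteq> \<Omega>" "{x. \<psi> x \<noteq> 0} \<subseteq> K"
  by (rule that[OF test_functionsD(2,3)[OF assms] closure_subset])

lemma test_function_zero: "(\<lambda>x. 0) \<in> test_functions \<Omega>"
  by (rule test_functionsI[where K = "{}"]) (auto intro: C_k_const)

lemma test_function_add:
  assumes "f \<in> test_functions \<Omega>" "g \<in> test_functions \<Omega>"
  shows "(\<lambda>x. f x + g x) \<in> test_functions \<Omega>"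
proof -
  obtain K where K: "compact K" "K \<subseteq> \<Omega>" "{x. f x \<noteq> 0} \<subseteq> K"
    using assms(1) by (rule test_functions_support)
  obtain L where L: "compact L" "L \<subseteq> \<Omega>" "{x. g x \<noteq> 0} \<subseteq> L"
    using assms(2) by (rule test_functions_support)
  show ?thesis
    by (intro test_functionsI[where K = "K \<union> L"] C_k_add assms[THEN test_functionsD(1)]) (use K L in \<open>auto, force\<close>)
qed

lemma test_function_mult_smooth:
  assumes "f \<in> test_functions \<Omega>" "\<And>k. C_k k g"
  shows "(\<lambda>x. f x * g x) \<in> test_functions \<Omega>"
proof -
  obtain K where "compact K" "K \<subseteq> \<Omega>" "{x. f x \<noteq> 0} \<subseteq> K"
    using assms(1) by (rule test_functions_support)
  then show ?thesis
    by (intro test_functionsI[where K = K] C_k_mult assms test_functionsD(1)[OF assms(1)]) auto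
qed

lemma test_function_scale:
  assumes "f \<in> test_functions \<Omega>"
  shows "(\<lambda>x. c * f x) \<in> test_functions \<Omega>"
  using test_function_mult_smooth[OF assms C_k_const[of _ c]] by (simp add: mult.commute)

lemma test_function_shift:
  assumes f: "f \<in> test_functions D" and sub: "\<And>x. x \<in> D \<Longrightarrow> x + z \<in> \<Omega>"
  shows "(\<lambda>x. f (x - z)) \<in> test_functions \<Omega>"
proof -
  obtain K where K: "compact K" "K \<subseteq> D" "{x. f x \<noteq> 0} \<subseteq> K"
    using f by (rule test_functions_support)
  have "{x. f (x - z) \<noteq> 0} \<subseteq> (+) z ` K"
  proof
    fix x assume "x \<in> {x. f (x - z) \<noteq> 0}"
    then have "x - z \<in> K" using K by auto
    then show "x \<in> (+) z ` K" by (intro image_eqI[where x = "x - z"]) auto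
  qed
  then show ?thesis
    using K sub by (intro test_functionsI[where K = "(+) z ` K"] C_k_shift test_functionsD(1)[OF f] compact_translation)
      (auto simp: add.commute)
qed

lemma test_function_has_derivative:
  "\<psi> \<in> test_functions \<Omega> \<Longrightarrow> (\<psi> has_derivative frechet_derivative \<psi> (at x)) (at x)"
  by (rule C_k_Suc_has_derivative) (rule test_functionsD(1))

lemma test_function_continuous:
  assumes "\<psi> \<in> test_functions \<Omega>"
  shows "continuous_on UNIV \<psi>" "b \<in> Basis \<Longrightarrow> continuous_on UNIV (\<lambda>x. frechet_derivative \<psi> (at x) b)"
  using test_functionsD(1)[OF assms, of 0] test_functionsD(1)[OF assms, of "Suc 0"] by auto

lemma test_function_measurable:
  assumes "\<psi> \<in> test_functions \<Omega>"
  shows "\<psi> \<in> borel_measurable borel" "b \<in> Basis \<Longrightarrow> (\<lambda>x. frechet_derivative \<psi> (at x) b) \<in> borel_measurable borel"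
  using test_function_continuous[OF assms] by (auto intro: borel_measurable_continuous_onI)

lemma test_function_derivative_outside:
  assumes "\<psi> \<in> test_functions \<Omega>" "x \<notin> closure {x. \<psi> x \<noteq> 0}"
  shows "frechet_derivative \<psi> (at x) b = 0"
proof -
  have "open (- closure {x. \<psi> x \<noteq> 0})" by auto
  then have "\<forall>\<^sub>F y in nhds x. y \<in> - closure {x. \<psi> x \<noteq> 0}"
    using assms(2) by (intro eventually_nhds_in_open) auto
  then have ev: "\<forall>\<^sub>F y in at x. \<psi> y = 0"
    using closure_subset[of "{x. \<psi> x \<noteq> 0}"] unfolding eventually_at_filter by (auto elim!: eventually_mono)
  have x0: "\<psi> x = 0" using assms(2) closure_subset[of "{x. \<psi> x \<noteq> 0}"] by auto
  have "((\<lambda>y. 0) has_derivative frechet_derivative \<psi> (at x)) (at x)"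
    using has_derivative_transform_eventually[OF test_function_has_derivative[OF assms(1)] ev x0] by simp
  from has_derivative_unique[OF this, of "\<lambda>h. 0"] show ?thesis by simp
qed

lemma continuous_compact_support_bounded:
  fixes g :: "'a::euclidean_space \<Rightarrow> real"
  assumes "continuous_on UNIV g" "compact K" "\<And>x. x \<notin> K \<Longrightarrow> g x = 0"
  obtains B where "0 < B" "\<And>x. \<bar>g x\<bar> \<le> B"
proof -
  have "bounded (g ` K)" using assms by (intro compact_imp_bounded compact_continuous_image) (auto intro: continuous_on_subset)
  then obtain B where B: "B > 0" "\<And>x. x \<in> K \<Longrightarrow> \<bar>g x\<bar> \<le> B" unfolding bounded_pos by auto
  have "\<bar>g x\<bar> \<le> B" for x using B assms(3)[of x] by (cases "x \<in> K") auto
  with B(1) that show thesis by blast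
qed

lemma test_function_bounded:
  assumes "\<psi> \<in> test_functions \<Omega>"
  obtains B where "0 < B" "\<And>x. \<bar>\<psi> x\<bar> \<le> B"
proof (rule continuous_compact_support_bounded[OF test_function_continuous(1)[OF assms] test_functionsD(2)[OF assms]])
  show "\<psi> x = 0" if "x \<notin> closure {x. \<psi> x \<noteq> 0}" for x
    using closure_subset[of "{x. \<psi> x \<noteq> 0}"] that by auto
qed (rule that)

text \<open>A product of flat functions gives a smooth \<open>P\<close> with \<open>0 \<le> P < 1\<close> that is positive exactly on
  the open box. The polynomials \<open>1 - (1 - P)^n\<close> of \<open>P\<close> vanish outside the box and increase to \<open>1\<close> on it.\<close>

lemma box_indicator_test_functions:
  fixes a b :: "'a::euclidean_space"
  assumes "cbox a b \<subseteq> \<Omega>"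
  obtains \<psi> where "\<And>n::nat. \<psi> n \<in> test_functions \<Omega>" "\<And>n x. \<bar>\<psi> n x\<bar> \<le> 1"
    "\<And>x. (\<lambda>n. \<psi> n x) \<longlonglongrightarrow> indicator (box a b) x"
proof -
  define P where "P x = (\<Prod>i\<in>Basis. flat_exp 0 (x \<bullet> i - a \<bullet> i) * flat_exp 0 (b \<bullet> i - x \<bullet> i))" for x
  have smooth: "C_k k P" for k
  proof -
    have "C_k k (\<lambda>x. \<Prod>i\<in>Basis. flat_exp 0 (x \<bullet> i - a \<bullet> i) * flat_exp 0 (b \<bullet> i - x \<bullet> i))"
    proof (intro C_k_prod C_k_mult)
      fix i :: 'a
      show "C_k k (\<lambda>x. flat_exp 0 (x \<bullet> i - a \<bullet> i))"
        using C_k_flat_exp[of k 1 0 i "- (a \<bullet> i)"] by (simp add: inner_commute)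
      show "C_k k (\<lambda>x. flat_exp 0 (b \<bullet> i - x \<bullet> i))"
        using C_k_flat_exp[of k 1 0 "- i" "b \<bullet> i"] by (simp add: inner_commute)
    qed
    then show ?thesis by (simp add: P_def[abs_def])
  qed
  have P0: "0 \<le> P x" for x unfolding P_def by (intro prod_nonneg mult_nonneg_nonneg ballI flat_exp_0_bounds)
  have lt: "flat_exp 0 s * flat_exp 0 t < 1" for s t
    using mult_strict_mono'[OF flat_exp_0_bounds(2) flat_exp_0_bounds(2) flat_exp_0_bounds(1) flat_exp_0_bounds(1)] by simp
  have P1: "P x < 1" for x
  proof -
    obtain j :: 'a where j: "j \<in> Basis" using nonempty_Basis by blast
    have "P x = flat_exp 0 (x \<bullet> j - a \<bullet> j) * flat_exp 0 (b \<bullet> j - x \<bullet> j) *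
        (\<Prod>i\<in>Basis - {j}. flat_exp 0 (x \<bullet> i - a \<bullet> i) * flat_exp 0 (b \<bullet> i - x \<bullet> i))"
      unfolding P_def using j by (simp add: prod.remove)
    also have "\<dots> \<le> flat_exp 0 (x \<bullet> j - a \<bullet> j) * flat_exp 0 (b \<bullet> j - x \<bullet> j) * 1"
      using lt by (intro mult_left_mono prod_le_1) (auto intro!: mult_nonneg_nonneg flat_exp_0_bounds simp: less_imp_le)
    also have "\<dots> < 1" using lt by simp
    finally show ?thesis .
  qed
  have P_pos: "0 < P x \<longleftrightarrow> x \<in> box a b" for x
  proof
    assume "0 < P x"
    show "x \<in> box a b" unfolding mem_box
    proof
      fix i :: 'a assume i: "i \<in> Basis"
      have "P x \<noteq> 0" using \<open>0 < P x\<close> by simp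
      then have "flat_exp 0 (x \<bullet> i - a \<bullet> i) * flat_exp 0 (b \<bullet> i - x \<bullet> i) \<noteq> 0"
        using i unfolding P_def by (simp only: prod_zero_iff[OF finite_Basis]) blast
      then show "a \<bullet> i < x \<bullet> i \<and> x \<bullet> i < b \<bullet> i" by (auto simp: flat_exp_def split: if_splits)
    qed
  next
    assume "x \<in> box a b"
    then show "0 < P x" unfolding P_def mem_box
      by (intro prod_pos mult_pos_pos ballI) (simp_all add: flat_exp_0_bounds(3))
  qed
  \<comment> \<open>Written with sums and products only, for the closure properties of smooth functions.\<close>
  define \<psi> where "\<psi> n x = 1 + (-1) * (1 + (-1) * P x) ^ n" for n x
  have pw: "0 \<le> (1 + (-1) * P x) ^ n" "(1 + (-1) * P x) ^ n \<le> 1" for n x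
    using P0[of x] P1[of x] by (auto intro: power_le_one)
  show thesis
  proof
    show "\<psi> n \<in> test_functions \<Omega>" for n
    proof (rule test_functionsI[where K = "cbox a b"])
      show "C_k k (\<psi> n)" for k unfolding \<psi>_def
        by (intro C_k_add C_k_mult C_k_power C_k_const smooth)
      have "P x = 0" if "x \<notin> box a b" for x using P_pos[of x] P0[of x] that by simp
      then have "{x. \<psi> n x \<noteq> 0} \<subseteq> box a b" unfolding \<psi>_def
        by (intro subsetI CollectI, elim CollectE) (rule ccontr, simp)
      then show "{x. \<psi> n x \<noteq> 0} \<subseteq> cbox a b" using box_subset_cbox by blast
    qed (use assms in auto)
    show "\<bar>\<psi> n x\<bar> \<le> 1" for n x using pw[of x n] by (simp add: \<psi>_def)
    show "(\<lambda>n. \<psi> n x) \<longlonglongrightarrow> indicator (box a b) x" for x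
    proof (cases "x \<in> box a b")
      case True
      then have "0 < P x" using P_pos by simp
      then have "norm (1 + (-1) * P x) < 1" using P1[of x] by (simp only: real_norm_def abs_less_iff) linarith
      then have "(\<lambda>n. (1 + (-1) * P x) ^ n) \<longlonglongrightarrow> 0" by (rule LIMSEQ_power_zero)
      then have "(\<lambda>n. \<psi> n x) \<longlonglongrightarrow> 1 + (-1) * 0" unfolding \<psi>_def
        by (rule tendsto_add[OF tendsto_const tendsto_mult[OF tendsto_const]])
      then show ?thesis using True by simp
    next
      case False
      then have "P x = 0" using P_pos[of x] P0[of x] by simp
      then show ?thesis using False by (simp add: \<psi>_def)
    qed
  qed
qed


section \<open>The fundamental lemma of the calculus of variations\<close>

text \<open>Translations and Fubini's theorem are applied to Borel functions on the whole space; this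
  lemma provides them for classes modulo null sets on \<open>\<Omega>\<close>.\<close>

lemma borel_representative:
  fixes f :: "'a::euclidean_space \<Rightarrow> real"
  assumes f: "f \<in> borel_measurable (lebesgue_on \<Omega>)" and \<Omega>: "\<Omega> \<in> sets borel"
  obtains f' where "f' \<in> borel_measurable borel" "\<And>x. x \<notin> \<Omega> \<Longrightarrow> f' x = 0" "AE x in lebesgue_on \<Omega>. f x = f' x"
proof -
  have \<Omega>L: "\<Omega> \<in> sets lebesgue" using \<Omega> by simp
  have "(\<lambda>x. if x \<in> \<Omega> then f x else 0) \<in> borel_measurable lebesgue"
    using f \<Omega>L by (simp add: borel_measurable_if)
  from completion_ex_borel_measurable_real[OF this] obtain g where g: "g \<in> borel_measurable lborel"
    "AE x in lborel. (if x \<in> \<Omega> then f x else 0) = g x" by blast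
  show thesis
  proof
    show "(\<lambda>x. indicator \<Omega> x * g x) \<in> borel_measurable borel" using g \<Omega> by simp
    have "AE x in lebesgue. (if x \<in> \<Omega> then f x else 0) = g x" using AE_completion[OF g(2)] by simp
    then show "AE x in lebesgue_on \<Omega>. f x = indicator \<Omega> x * g x"
      using \<Omega>L by (subst AE_restrict_space_iff) (auto elim!: eventually_mono)
  qed auto
qed

lemma lebesgue_on_integral_borel:
  fixes f :: "'a::euclidean_space \<Rightarrow> real"
  assumes f: "f \<in> borel_measurable borel" and \<Omega>: "\<Omega> \<in> sets borel"
  shows "(\<integral>x. f x \<partial>lebesgue_on \<Omega>) = (\<integral>x. indicator \<Omega> x * f x \<partial>lborel)"
    and "integrable (lebesgue_on \<Omega>) f \<longleftrightarrow> integrable lborel (\<lambda>x. indicator \<Omega> x * f x)"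
proof -
  have m: "(\<lambda>x. indicator \<Omega> x * f x) \<in> borel_measurable lborel" using f \<Omega> by simp
  show "(\<integral>x. f x \<partial>lebesgue_on \<Omega>) = (\<integral>x. indicator \<Omega> x * f x \<partial>lborel)"
    using \<Omega> by (subst integral_restrict_space) (auto simp: integral_completion[OF m])
  show "integrable (lebesgue_on \<Omega>) f \<longleftrightarrow> integrable lborel (\<lambda>x. indicator \<Omega> x * f x)"
    using \<Omega> by (subst integrable_restrict_space) (auto simp: integrable_completion[OF m])
qed

lemma borel_measurable_lebesgue_on:
  assumes "f \<in> borel_measurable borel"
  shows "f \<in> borel_measurable (lebesgue_on \<Omega>)"
proof -
  have "f \<in> borel_measurable lebesgue" using assms by (intro measurable_completion) simp
  then show ?thesis by (rule measurable_restrict_space1)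
qed

text \<open>Boxes form an intersection-stable generator of the Borel sets, so the integral of \<open>h\<close> vanishes
  over every Borel set, in particular over \<open>{h > 0}\<close> and \<open>{h < 0}\<close>.\<close>

lemma AE_zero_of_box_integrals:
  fixes h :: "'a::euclidean_space \<Rightarrow> real"
  assumes h: "integrable lborel h"
    and zero: "\<And>a b. (\<integral>x. indicator (box a b) x * h x \<partial>lborel) = 0"
    and whole: "(\<integral>x. h x \<partial>lborel) = 0"
  shows "AE x in lborel. h x = 0"
proof -
  have hm [measurable]: "h \<in> borel_measurable borel" using borel_measurable_integrable[OF h] by simp
  have ind: "integrable lborel (\<lambda>x. indicator A x * h x)" if "A \<in> sets borel" for A
    using integrable_mult_indicator[OF _ h, of A] that by simp
  have all: "(\<integral>x. indicator A x * h x \<partial>lborel) = 0" if "A \<in> sets borel" for A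
  proof -
    let ?G = "range (\<lambda>(a, b). box a b :: 'a set)"
    have "Int_stable ?G"
      unfolding Int_stable_def by (auto simp: box_Int_box)
    moreover have "?G \<subseteq> Pow UNIV" by simp
    moreover have "A \<in> sigma_sets UNIV ?G" using that by (simp add: borel_eq_box)
    ultimately show ?thesis
    proof (induction rule: sigma_sets_induct_disjoint)
      case (basic A)
      then show ?case using zero by auto
    next
      case empty
      show ?case by simp
    next
      case (compl A)
      have A: "A \<in> sets borel" using compl by (simp add: borel_eq_box)
      have "indicator (UNIV - A) x * h x = h x - indicator A x * h x" for x
        by (auto simp: indicator_def)
      then show ?case using ind[OF A] h whole compl by simp
    next
      case (union A)
      have A: "A i \<in> sets borel" for i using union(2) by (auto simp: borel_eq_box)
      have "(\<lambda>n. \<integral>x. indicator (\<Union>i<n. A i) x * h x \<partial>lborel) \<longlonglongrightarrow> (\<integral>x. indicator (\<Union>i. A i) x * h x \<partial>lborel)"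
      proof (rule integral_dominated_convergence)
        show "integrable lborel (\<lambda>x. \<bar>h x\<bar>)" using h by simp
        show "AE x in lborel. (\<lambda>n. indicator (\<Union>i<n. A i) x * h x) \<longlonglongrightarrow> indicator (\<Union>i. A i) x * h x"
          by (intro AE_I2 tendsto_intros LIMSEQ_indicator_UN)
        show "AE x in lborel. norm (indicator (\<Union>i<n. A i) x * h x) \<le> \<bar>h x\<bar>" for n
          by (intro AE_I2) (auto simp: indicator_def)
      qed (use A in measurable)
      moreover have "(\<integral>x. indicator (\<Union>i<n. A i) x * h x \<partial>lborel) = 0" for n
      proof -
        have "indicator (\<Union>i<n. A i) x * h x = (\<Sum>i<n. indicator (A i) x * h x)" for x
        proof -
          have "indicator (\<Union>i<n. A i) x = (\<Sum>i<n. indicator (A i) x :: real)"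
            using union(1) by (intro indicator_UN_disjoint) (auto intro: disjoint_family_on_mono)
          then show ?thesis by (simp only: sum_distrib_right)
        qed
        then have "(\<integral>x. indicator (\<Union>i<n. A i) x * h x \<partial>lborel) = (\<integral>x. (\<Sum>i<n. indicator (A i) x * h x) \<partial>lborel)"
          by presburger
        also have "\<dots> = 0" using ind[OF A] union(3) by (subst Bochner_Integration.integral_sum) auto
        finally show ?thesis .
      qed
      ultimately show ?case by (simp add: LIMSEQ_const_iff)
    qed
  qed
  have "AE x in lborel. indicator {x. 0 < h x} x * h x = 0"
    using all[of "{x. 0 < h x}"] ind[of "{x. 0 < h x}"]
    by (subst integral_nonneg_eq_0_iff_AE[symmetric]) (auto simp: indicator_def)
  moreover have "AE x in lborel. - (indicator {x. h x < 0} x * h x) = 0"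
    using all[of "{x. h x < 0}"] ind[of "{x. h x < 0}"]
    by (subst integral_nonneg_eq_0_iff_AE[symmetric]) (auto simp: indicator_def)
  ultimately show ?thesis by eventually_elim (auto simp: indicator_def split: if_splits)
qed

text \<open>Test functions approximate the indicators of the boxes with closure in \<open>\<Omega>\<close>. All boxes inside
  one of these are of the same kind, so \<open>h\<close> vanishes on each of them, and countably many cover \<open>\<Omega>\<close>.\<close>

lemma fundamental_lemma:
  fixes h :: "'a::euclidean_space \<Rightarrow> real"
  assumes \<Omega>: "open \<Omega>" and h: "integrable (lebesgue_on \<Omega>) h"
    and zero: "\<And>\<psi>. \<psi> \<in> test_functions \<Omega> \<Longrightarrow> (\<integral>x. h x * \<psi> x \<partial>lebesgue_on \<Omega>) = 0"
  shows "AE x in lebesgue_on \<Omega>. h x = 0"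
proof -
  have \<Omega>B: "\<Omega> \<in> sets borel" using \<Omega> by simp
  obtain h' where h' [measurable]: "h' \<in> borel_measurable borel" and h'0: "\<And>x. x \<notin> \<Omega> \<Longrightarrow> h' x = 0"
    and ae: "AE x in lebesgue_on \<Omega>. h x = h' x"
    using borel_representative[OF borel_measurable_integrable[OF h] \<Omega>B] by blast
  have ind: "indicator \<Omega> x * h' x = h' x" for x using h'0[of x] by (auto simp: indicator_def)
  have hL: "integrable (lebesgue_on \<Omega>) h'"
    by (rule integrable_cong_AE_imp[OF h borel_measurable_lebesgue_on[OF h']]) (use ae in auto)
  then have h'int: "integrable lborel h'"
    using lebesgue_on_integral_borel(2)[OF h' \<Omega>B] by (simp add: ind)
  have z: "(\<integral>x. \<psi> x * h' x \<partial>lborel) = 0" if \<psi>: "\<psi> \<in> test_functions \<Omega>" for \<psi>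
  proof -
    have [measurable]: "\<psi> \<in> borel_measurable borel" using test_function_measurable(1)[OF \<psi>] .
    have "0 = (\<integral>x. h x * \<psi> x \<partial>lebesgue_on \<Omega>)" using zero[OF \<psi>] by simp
    also have "\<dots> = (\<integral>x. \<psi> x * h' x \<partial>lebesgue_on \<Omega>)"
    proof (rule integral_cong_AE)
      show "(\<lambda>x. h x * \<psi> x) \<in> borel_measurable (lebesgue_on \<Omega>)"
        using borel_measurable_integrable[OF h] borel_measurable_lebesgue_on[OF test_function_measurable(1)[OF \<psi>]] by simp
      show "(\<lambda>x. \<psi> x * h' x) \<in> borel_measurable (lebesgue_on \<Omega>)"
        by (rule borel_measurable_lebesgue_on) measurable
    qed (use ae in \<open>auto simp: mult.commute\<close>)
    also have "\<dots> = (\<integral>x. \<psi> x * h' x \<partial>lborel)"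
      by (subst lebesgue_on_integral_borel(1)[OF _ \<Omega>B]) (auto simp: mult.left_commute ind)
    finally show ?thesis by simp
  qed
  have zbox: "(\<integral>x. indicator (box a b) x * h' x \<partial>lborel) = 0" if ab: "cbox a b \<subseteq> \<Omega>" for a b
  proof -
    obtain \<psi> where \<psi>: "\<And>n::nat. \<psi> n \<in> test_functions \<Omega>" "\<And>n x. \<bar>\<psi> n x\<bar> \<le> 1"
      "\<And>x. (\<lambda>n. \<psi> n x) \<longlonglongrightarrow> indicator (box a b) x"
      using box_indicator_test_functions[OF ab] by blast
    have [measurable]: "\<psi> n \<in> borel_measurable borel" for n using test_function_measurable(1)[OF \<psi>(1)] .
    have "(\<lambda>n. \<integral>x. \<psi> n x * h' x \<partial>lborel) \<longlonglongrightarrow> (\<integral>x. indicator (box a b) x * h' x \<partial>lborel)"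
    proof (rule integral_dominated_convergence)
      show "integrable lborel (\<lambda>x. \<bar>h' x\<bar>)" using h'int by simp
      show "AE x in lborel. (\<lambda>n. \<psi> n x * h' x) \<longlonglongrightarrow> indicator (box a b) x * h' x"
        by (intro AE_I2 tendsto_intros \<psi>(3))
      show "AE x in lborel. norm (\<psi> n x * h' x) \<le> \<bar>h' x\<bar>" for n
        using \<psi>(2) by (intro AE_I2) (auto simp: abs_mult intro: mult_left_le_one_le)
    qed auto
    then show ?thesis using z[OF \<psi>(1)] by (simp add: LIMSEQ_const_iff)
  qed
  have inbox: "AE x in lborel. indicator (box c d) x * h' x = 0" if cd: "cbox c d \<subseteq> \<Omega>" for c d
  proof (rule AE_zero_of_box_integrals)
    show "integrable lborel (\<lambda>x. indicator (box c d) x * h' x)"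
      using integrable_mult_indicator[OF _ h'int, of "box c d"] by simp
    show "(\<integral>x. indicator (box c d) x * h' x \<partial>lborel) = 0" by (rule zbox[OF cd])
    fix a b
    obtain p q where pq: "box a b \<inter> box c d = box p q" using box_Int_box by blast
    have "(\<integral>x. indicator (box p q) x * h' x \<partial>lborel) = 0"
    proof (cases "box p q = {}")
      case False
      then have "cbox p q = closure (box p q)" by simp
      also have "\<dots> \<subseteq> cbox c d" using pq box_subset_cbox by (intro closure_minimal) auto
      finally show ?thesis using cd by (intro zbox) auto
    qed simp
    moreover have "indicator (box a b) x * (indicator (box c d) x * h' x) = indicator (box p q) x * h' x" for x
      unfolding pq[symmetric] by (auto simp: indicator_def)
    ultimately show "(\<integral>x. indicator (box a b) x * (indicator (box c d) x * h' x) \<partial>lborel) = 0" by presburger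
  qed
  obtain \<D> where \<D>: "countable \<D>" "\<D> \<subseteq> {box a b |a b. cbox a b \<subseteq> \<Omega>}" "\<Union>\<D> = \<Omega>"
  proof -
    have "\<exists>\<D>. countable \<D> \<and> \<D> \<subseteq> {box a b |a b. cbox a b \<subseteq> \<Omega>} \<and> \<Union>\<D> = \<Omega>"
    proof -
      have op: "\<And>S. S \<in> {box a b |a b. cbox a b \<subseteq> \<Omega>} \<Longrightarrow> open S" by (auto simp: open_box)
      obtain \<D> where \<D>: "\<D> \<subseteq> {box a b |a b. cbox a b \<subseteq> \<Omega>}" "countable \<D>" "\<Union>\<D> = \<Union>{box a b |a b. cbox a b \<subseteq> \<Omega>}"
        using Lindelof[of "{box a b |a b. cbox a b \<subseteq> \<Omega>}"] op by blast
      have "\<Omega> \<subseteq> \<Union>{box a b |a b. cbox a b \<subseteq> \<Omega>}"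
      proof
        fix x assume "x \<in> \<Omega>"
        then obtain a b where "x \<in> box a b" "cbox a b \<subseteq> \<Omega>" using open_contains_cbox[OF \<Omega>] by blast
        then show "x \<in> \<Union>{box a b |a b. cbox a b \<subseteq> \<Omega>}" by blast
      qed
      moreover have "\<Union>{box a b |a b. cbox a b \<subseteq> \<Omega>} \<subseteq> \<Omega>"
        by (intro Union_least) (use box_subset_cbox in \<open>auto dest!: subsetD\<close>)
      ultimately have "\<Union>\<D> = \<Omega>" using \<D>(3) by simp
      then show ?thesis using \<D>(1,2) by (intro exI[of _ \<D>] conjI)
    qed
    then show thesis using that by blast
  qed
  have "AE x in lborel. \<forall>B\<in>\<D>. indicator B x * h' x = 0"
    using \<D> inbox by (subst AE_ball_countable) auto
  then have "AE x in lborel. h' x = 0"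
  proof eventually_elim
    fix x assume *: "\<forall>B\<in>\<D>. indicator B x * h' x = 0"
    show "h' x = 0"
    proof (cases "x \<in> \<Omega>")
      case True
      then obtain B where "B \<in> \<D>" "x \<in> B" using \<D>(3) by blast
      with * show ?thesis by force
    qed (use h'0 in auto)
  qed
  from AE_completion[OF this] have "AE x in lebesgue_on \<Omega>. h' x = 0"
    using \<Omega>B by (subst AE_restrict_space_iff) (auto elim!: eventually_mono)
  with ae show ?thesis by eventually_elim simp
qed

lemma finite_measure_bounded_open:
  fixes \<Omega> :: "'a::euclidean_space set"
  assumes "open \<Omega>" "bounded \<Omega>"
  shows "finite_measure (lebesgue_on \<Omega>)"
  using assms by (intro finite_measure_lebesgue_on bounded_set_imp_lmeasurable) auto

lemma test_function_L2:
  assumes "open \<Omega>" "bounded \<Omega>" "\<psi> \<in> test_functions D"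
  shows "\<psi> \<in> L2 (lebesgue_on \<Omega>)"
proof -
  interpret finite_measure "lebesgue_on \<Omega>" using assms by (intro finite_measure_bounded_open)
  obtain B where "\<And>x. \<bar>\<psi> x\<bar> \<le> B" using test_function_bounded[OF assms(3)] by blast
  then show ?thesis
    using borel_measurable_lebesgue_on[OF test_function_measurable(1)[OF assms(3)]] by (intro L2_bounded) auto
qed

text \<open>The difference of \<open>f\<close> and its projection onto the closure of the test functions is orthogonal
  to all test functions, hence zero by the fundamental lemma.\<close>

lemma test_functions_dense:
  fixes f :: "'a::euclidean_space \<Rightarrow> real"
  assumes \<Omega>: "open \<Omega>" "bounded \<Omega>" and f: "f \<in> L2 (lebesgue_on \<Omega>)"
  obtains \<psi> where "\<And>n::nat. \<psi> n \<in> test_functions \<Omega>" "(\<lambda>n. L2_norm (lebesgue_on \<Omega>) (\<lambda>x. \<psi> n x - f x)) \<longlonglongrightarrow> 0"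
proof -
  interpret finite_measure "lebesgue_on \<Omega>" using \<Omega> by (rule finite_measure_bounded_open)
  let ?M = "lebesgue_on \<Omega>"
  have VL: "test_functions \<Omega> \<subseteq> L2 ?M" using test_function_L2[OF \<Omega>] by blast
  obtain g \<psi> where g: "g \<in> L2 ?M" and \<psi>: "\<And>n::nat. \<psi> n \<in> test_functions \<Omega>"
    and lim: "(\<lambda>n. L2_norm ?M (\<lambda>x. \<psi> n x - g x)) \<longlonglongrightarrow> 0"
    and eq: "\<And>c. c \<in> test_functions \<Omega> \<Longrightarrow> (\<integral>x. g x * c x \<partial>?M) = (\<integral>x. f x * c x \<partial>?M)"
  proof (rule L2_Riesz[of "test_functions \<Omega>" "\<lambda>c. \<integral>x. f x * c x \<partial>?M" "L2_norm ?M f"])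
    show "(\<integral>x. f x * (c x + d x) \<partial>?M) = (\<integral>x. f x * c x \<partial>?M) + (\<integral>x. f x * d x \<partial>?M)"
      if "c \<in> test_functions \<Omega>" "d \<in> test_functions \<Omega>" for c d
      using that VL L2_mult_integrable[OF f] by (subst Bochner_Integration.integral_add[symmetric]) (auto simp: distrib_left)
    show "(\<integral>x. f x * (k * c x) \<partial>?M) = k * (\<integral>x. f x * c x \<partial>?M)" for k c
      by (subst Bochner_Integration.integral_mult_right_zero[symmetric]) (simp add: mult.left_commute)
    show "\<bar>\<integral>x. f x * c x \<partial>?M\<bar> \<le> L2_norm ?M f * L2_norm ?M c" if "c \<in> test_functions \<Omega>" for c
      using that VL by (intro L2_Cauchy_Schwarz f) auto
  qed (use VL test_function_zero test_function_add test_function_scale in auto)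
  have "AE x in ?M. g x - f x = 0"
  proof (rule fundamental_lemma[OF \<Omega>(1)])
    show "integrable ?M (\<lambda>x. g x - f x)" using f g by (intro L2_integrable L2_diff)
    fix c assume c: "c \<in> test_functions \<Omega>"
    show "(\<integral>x. (g x - f x) * c x \<partial>?M) = 0"
      using eq[OF c] c VL L2_mult_integrable[OF f] L2_mult_integrable[OF g] by (auto simp: left_diff_distrib)
  qed
  then have eq': "L2_norm ?M (\<lambda>x. \<psi> n x - f x) = L2_norm ?M (\<lambda>x. \<psi> n x - g x)" for n
  proof -
    have [measurable]: "f \<in> borel_measurable ?M" "g \<in> borel_measurable ?M" "\<psi> n \<in> borel_measurable ?M"
      using f g \<psi> VL by (auto intro: L2_measurable)
    have "(\<integral>x. (\<psi> n x - f x)\<^sup>2 \<partial>?M) = (\<integral>x. (\<psi> n x - g x)\<^sup>2 \<partial>?M)"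
      using \<open>AE x in ?M. g x - f x = 0\<close> by (intro integral_cong_AE) auto
    then show ?thesis by (simp add: L2_norm_def)
  qed
  from lim have "(\<lambda>n. L2_norm ?M (\<lambda>x. \<psi> n x - f x)) \<longlonglongrightarrow> 0" unfolding eq' .
  with \<psi> show thesis by (rule that)
qed


section \<open>Translation and oscillation of test functions\<close>

lemma frechet_derivative_basis_sum:
  assumes "\<psi> \<in> test_functions D"
  shows "frechet_derivative \<psi> (at x) z = (\<Sum>b\<in>Basis. (z \<bullet> b) * frechet_derivative \<psi> (at x) b)"
proof -
  interpret linear "frechet_derivative \<psi> (at x)"
    using test_function_has_derivative[OF assms] by (rule has_derivative_linear)
  have "frechet_derivative \<psi> (at x) (\<Sum>b\<in>Basis. (z \<bullet> b) *\<^sub>R b) = (\<Sum>b\<in>Basis. (z \<bullet> b) * frechet_derivative \<psi> (at x) b)"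
    by (simp add: sum scaleR)
  then show ?thesis by (simp add: euclidean_representation)
qed

lemma test_function_directional:
  assumes "\<psi> \<in> test_functions D"
  shows "(\<lambda>x. frechet_derivative \<psi> (at x) z) \<in> borel_measurable borel"
    and "\<exists>B>0. \<forall>x. \<bar>frechet_derivative \<psi> (at x) z\<bar> \<le> B"
proof -
  have cont: "continuous_on UNIV (\<lambda>x. frechet_derivative \<psi> (at x) z)"
    unfolding frechet_derivative_basis_sum[OF assms, of _ z]
    by (intro continuous_intros test_function_continuous(2)[OF assms])
  show "(\<lambda>x. frechet_derivative \<psi> (at x) z) \<in> borel_measurable borel"
    using cont by (rule borel_measurable_continuous_onI)
  obtain B where "0 < B" "\<And>x. \<bar>frechet_derivative \<psi> (at x) z\<bar> \<le> B"
    using continuous_compact_support_bounded[OF cont test_functionsD(2)[OF assms]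
      test_function_derivative_outside[OF assms]] by blast
  then show "\<exists>B>0. \<forall>x. \<bar>frechet_derivative \<psi> (at x) z\<bar> \<le> B" by blast
qed

lemma test_function_line_derivative:
  assumes "\<psi> \<in> test_functions D"
  shows "((\<lambda>s. \<psi> (x - s *\<^sub>R z)) has_real_derivative - frechet_derivative \<psi> (at (x - s *\<^sub>R z)) z) (at s)"
proof -
  interpret linear "frechet_derivative \<psi> (at (x - s *\<^sub>R z))"
    using test_function_has_derivative[OF assms] by (rule has_derivative_linear)
  have "((\<lambda>s. x - s *\<^sub>R z) has_derivative (\<lambda>h. - h *\<^sub>R z)) (at s)"
    by (auto intro!: derivative_eq_intros)
  from has_derivative_compose[OF this test_function_has_derivative[OF assms]]
  have "((\<lambda>s. \<psi> (x - s *\<^sub>R z)) has_derivative (\<lambda>h. frechet_derivative \<psi> (at (x - s *\<^sub>R z)) (- h *\<^sub>R z))) (at s)" .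
  then show ?thesis unfolding has_field_derivative_def
    by (rule has_derivative_eq_rhs) (auto simp: fun_eq_iff scaleR neg)
qed

text \<open>Dominated convergence applies because the difference quotients of \<open>\<psi>\<close> along \<open>z\<close> are bounded by
  the supremum of its directional derivative.\<close>

lemma shifted_pairing_has_derivative:
  fixes w :: "'a::euclidean_space \<Rightarrow> real"
  assumes w: "integrable (lebesgue_on \<Omega>) w" and \<psi>: "\<psi> \<in> test_functions D"
  shows "((\<lambda>s. \<integral>x. w x * \<psi> (x - s *\<^sub>R z) \<partial>lebesgue_on \<Omega>) has_real_derivative
      - (\<integral>x. w x * frechet_derivative \<psi> (at (x - s *\<^sub>R z)) z \<partial>lebesgue_on \<Omega>)) (at s)"
proof -
  let ?M = "lebesgue_on \<Omega>"
  have wm [measurable]: "w \<in> borel_measurable ?M" using w by auto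
  obtain B where B: "0 < B" "\<And>x. \<bar>frechet_derivative \<psi> (at x) z\<bar> \<le> B"
    using test_function_directional(2)[OF \<psi>] by metis
  obtain C where C: "0 < C" "\<And>x. \<bar>\<psi> x\<bar> \<le> C" using test_function_bounded[OF \<psi>] by blast
  note [measurable] = test_function_measurable(1)[OF \<psi>]
  have \<psi>m: "(\<lambda>x. \<psi> (x - y)) \<in> borel_measurable ?M" for y
    by (rule borel_measurable_lebesgue_on) measurable
  have int: "integrable ?M (\<lambda>x. w x * \<psi> (x - y))" for y
  proof (rule Bochner_Integration.integrable_bound)
    show "integrable ?M (\<lambda>x. C * w x)" using w by simp
    show "(\<lambda>x. w x * \<psi> (x - y)) \<in> borel_measurable ?M" using \<psi>m by measurable
    show "AE x in ?M. norm (w x * \<psi> (x - y)) \<le> norm (C * w x)"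
    proof (intro AE_I2)
      fix x
      have "\<bar>w x\<bar> * \<bar>\<psi> (x - y)\<bar> \<le> \<bar>w x\<bar> * C" using C(2) by (intro mult_left_mono) auto
      then show "norm (w x * \<psi> (x - y)) \<le> norm (C * w x)" using C(1) by (simp add: abs_mult mult.commute)
    qed
  qed
  have lip: "\<bar>\<psi> (x - (s + h) *\<^sub>R z) - \<psi> (x - s *\<^sub>R z)\<bar> \<le> B * \<bar>h\<bar>" for x h
  proof -
    have "norm (\<psi> (x - (s + h) *\<^sub>R z) - \<psi> (x - s *\<^sub>R z)) \<le> B * norm ((s + h) - s)"
      using B(2) by (intro field_differentiable_bound[where S = UNIV and f' = "\<lambda>s. - frechet_derivative \<psi> (at (x - s *\<^sub>R z)) z"])
        (auto intro: test_function_line_derivative[OF \<psi>])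
    then show ?thesis by simp
  qed
  show ?thesis unfolding DERIV_def
  proof (subst tendsto_at_iff_sequentially, intro allI impI)
    fix X :: "nat \<Rightarrow> real" assume X0: "\<forall>i. X i \<in> UNIV - {0}" and X: "X \<longlonglongrightarrow> 0"
    have "(\<lambda>n. \<integral>x. w x * ((\<psi> (x - (s + X n) *\<^sub>R z) - \<psi> (x - s *\<^sub>R z)) / X n) \<partial>?M)
        \<longlonglongrightarrow> (\<integral>x. w x * (- frechet_derivative \<psi> (at (x - s *\<^sub>R z)) z) \<partial>?M)"
    proof (rule integral_dominated_convergence)
      show "integrable ?M (\<lambda>x. B * \<bar>w x\<bar>)" using w by simp
      show "AE x in ?M. norm (w x * ((\<psi> (x - (s + X n) *\<^sub>R z) - \<psi> (x - s *\<^sub>R z)) / X n)) \<le> B * \<bar>w x\<bar>" for n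
      proof (intro AE_I2)
        fix x
        have "X n \<noteq> 0" using X0 by auto
        then have "\<bar>(\<psi> (x - (s + X n) *\<^sub>R z) - \<psi> (x - s *\<^sub>R z)) / X n\<bar> \<le> B"
          using lip[of x "X n"] by (simp add: abs_divide divide_le_eq)
        then show "norm (w x * ((\<psi> (x - (s + X n) *\<^sub>R z) - \<psi> (x - s *\<^sub>R z)) / X n)) \<le> B * \<bar>w x\<bar>"
          unfolding real_norm_def abs_mult[of "w x"] by (subst mult.commute) (intro mult_right_mono; simp)
      qed
      show "AE x in ?M. (\<lambda>n. w x * ((\<psi> (x - (s + X n) *\<^sub>R z) - \<psi> (x - s *\<^sub>R z)) / X n)) \<longlonglongrightarrow> w x * (- frechet_derivative \<psi> (at (x - s *\<^sub>R z)) z)"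
      proof (intro AE_I2 tendsto_mult tendsto_const)
        fix x
        have "((\<lambda>h. (\<psi> (x - (s + h) *\<^sub>R z) - \<psi> (x - s *\<^sub>R z)) / h) \<longlongrightarrow> - frechet_derivative \<psi> (at (x - s *\<^sub>R z)) z) (at 0)"
          using test_function_line_derivative[OF \<psi>, of x z s] by (simp add: DERIV_def)
        then show "(\<lambda>n. (\<psi> (x - (s + X n) *\<^sub>R z) - \<psi> (x - s *\<^sub>R z)) / X n) \<longlonglongrightarrow> - frechet_derivative \<psi> (at (x - s *\<^sub>R z)) z"
          using X0 X by (auto simp: tendsto_at_iff_sequentially o_def)
      qed
      show "(\<lambda>x. w x * ((\<psi> (x - (s + X n) *\<^sub>R z) - \<psi> (x - s *\<^sub>R z)) / X n)) \<in> borel_measurable ?M" for n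
        using \<psi>m by measurable
      have "(\<lambda>x. frechet_derivative \<psi> (at (x - s *\<^sub>R z)) z) \<in> borel_measurable ?M"
        by (intro borel_measurable_lebesgue_on measurable_compose[OF _ test_function_directional(1)[OF \<psi>]]) measurable
      then show "(\<lambda>x. w x * (- frechet_derivative \<psi> (at (x - s *\<^sub>R z)) z)) \<in> borel_measurable ?M" by measurable
    qed
    moreover have quot: "(\<integral>x. w x * ((\<psi> (x - (s + X n) *\<^sub>R z) - \<psi> (x - s *\<^sub>R z)) / X n) \<partial>?M) =
       ((\<integral>x. w x * \<psi> (x - (s + X n) *\<^sub>R z) \<partial>?M) - (\<integral>x. w x * \<psi> (x - s *\<^sub>R z) \<partial>?M)) / X n" for n
      using int[of "(s + X n) *\<^sub>R z"] int[of "s *\<^sub>R z"]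
      by (subst Bochner_Integration.integral_diff[symmetric]) (auto simp: right_diff_distrib simp flip: Bochner_Integration.integral_divide_zero)
    ultimately have "(\<lambda>n. ((\<integral>x. w x * \<psi> (x - (s + X n) *\<^sub>R z) \<partial>?M) - (\<integral>x. w x * \<psi> (x - s *\<^sub>R z) \<partial>?M)) / X n)
        \<longlonglongrightarrow> (\<integral>x. w x * (- frechet_derivative \<psi> (at (x - s *\<^sub>R z)) z) \<partial>?M)" by (simp only: quot)
    then show "((\<lambda>h. ((\<integral>x. w x * \<psi> (x - (s + h) *\<^sub>R z) \<partial>?M) - (\<integral>x. w x * \<psi> (x - s *\<^sub>R z) \<partial>?M)) / h) \<circ> X)
        \<longlonglongrightarrow> - (\<integral>x. w x * frechet_derivative \<psi> (at (x - s *\<^sub>R z)) z \<partial>?M)"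
      by (simp add: o_def)
  qed
qed

lemma lborel_integral_shift:
  fixes f :: "'a::euclidean_space \<Rightarrow> real"
  assumes "f \<in> borel_measurable borel"
  shows "(\<integral>x. f (x - y) \<partial>lborel) = (\<integral>x. f x \<partial>lborel)"
proof -
  have "(\<integral>x. f x \<partial>lborel) = (\<integral>x. f x \<partial>distr lborel borel ((+) (- y)))" by (simp add: lborel_distr_plus)
  also have "\<dots> = (\<integral>x. f (- y + x) \<partial>lborel)" using assms by (intro integral_distr) auto
  finally show ?thesis by simp
qed

lemma lborel_integrable_shift:
  fixes f :: "'a::euclidean_space \<Rightarrow> real"
  assumes "f \<in> borel_measurable borel"
  shows "integrable lborel (\<lambda>x. f (x - y)) \<longleftrightarrow> integrable lborel f"
proof -
  have "integrable lborel f \<longleftrightarrow> integrable (distr lborel borel ((+) (- y))) f" by (simp add: lborel_distr_plus)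
  also have "\<dots> \<longleftrightarrow> integrable lborel (\<lambda>x. f (- y + x))" using assms by (intro integrable_distr_eq) auto
  finally show ?thesis by simp
qed

lemma lebesgue_on_integral_support:
  fixes f :: "'a::euclidean_space \<Rightarrow> real"
  assumes f: "f \<in> borel_measurable borel" and \<Omega>: "\<Omega> \<in> sets borel" and "\<And>x. x \<notin> \<Omega> \<Longrightarrow> f x = 0"
  shows "(\<integral>x. f x \<partial>lebesgue_on \<Omega>) = (\<integral>x. f x \<partial>lborel)"
proof -
  have "indicator \<Omega> x * f x = f x" for x using assms(3)[of x] by (auto simp: indicator_def)
  then have "(\<integral>x. indicator \<Omega> x * f x \<partial>lborel) = (\<integral>x. f x \<partial>lborel)" by presburger
  then show ?thesis using lebesgue_on_integral_borel(1)[OF f \<Omega>] by (rule trans[rotated])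
qed

text \<open>The integral of \<open>\<psi> (x - s z)\<close> does not depend on \<open>s\<close>, and its derivative at \<open>s = 0\<close> is the integral in
  question.\<close>

lemma test_function_derivative_integral_zero:
  fixes \<psi> :: "'a::euclidean_space \<Rightarrow> real"
  assumes \<psi>: "\<psi> \<in> test_functions \<Omega>" and \<Omega>: "\<Omega> \<in> sets borel"
  shows "(\<integral>x. frechet_derivative \<psi> (at x) z \<partial>lebesgue_on \<Omega>) = 0"
proof -
  note [measurable] = test_function_measurable(1)[OF \<psi>] test_function_directional(1)[OF \<psi>]
  obtain K where K: "compact K" "K \<subseteq> \<Omega>" "{x. \<psi> x \<noteq> 0} \<subseteq> K"
    using \<psi> by (rule test_functions_support)
  obtain r where r: "0 < r" "\<And>x. x \<in> K \<Longrightarrow> norm x \<le> r" using compact_imp_bounded[OF K(1)] by (auto simp: bounded_pos)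
  let ?B = "ball (0::'a) (r + norm z + 1)"
  have fin: "integrable (lebesgue_on ?B) (\<lambda>x. 1::real)"
  proof -
    interpret finite_measure "lebesgue_on ?B" by (intro finite_measure_bounded_open) auto
    show ?thesis by simp
  qed
  have F: "(\<integral>x. 1 * \<psi> (x - s *\<^sub>R z) \<partial>lebesgue_on ?B) = (\<integral>x. \<psi> x \<partial>lborel)" if s: "\<bar>s\<bar> < 1" for s
  proof -
    have "(\<integral>x. 1 * \<psi> (x - s *\<^sub>R z) \<partial>lebesgue_on ?B) = (\<integral>x. \<psi> (x - s *\<^sub>R z) \<partial>lborel)"
    proof (simp, rule lebesgue_on_integral_support)
      fix x assume x: "x \<notin> ?B"
      have "x - s *\<^sub>R z \<notin> K"
      proof
        assume "x - s *\<^sub>R z \<in> K"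
        then have "norm (x - s *\<^sub>R z) \<le> r" by (rule r(2))
        moreover have "norm x \<le> norm (x - s *\<^sub>R z) + norm (s *\<^sub>R z)" by (metis diff_add_cancel norm_triangle_ineq)
        moreover have "norm (s *\<^sub>R z) \<le> norm z" using s by (simp add: mult_left_le_one_le)
        ultimately show False using x by simp
      qed
      then show "\<psi> (x - s *\<^sub>R z) = 0" using K(3) by blast
    qed auto
    then show ?thesis by (simp add: lborel_integral_shift)
  qed
  have "((\<lambda>s. \<integral>x. 1 * \<psi> (x - s *\<^sub>R z) \<partial>lebesgue_on ?B) has_real_derivative
      - (\<integral>x. 1 * frechet_derivative \<psi> (at (x - 0 *\<^sub>R z)) z \<partial>lebesgue_on ?B)) (at 0)"
    by (rule shifted_pairing_has_derivative[OF fin \<psi>])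
  moreover have "((\<lambda>s. \<integral>x. 1 * \<psi> (x - s *\<^sub>R z) \<partial>lebesgue_on ?B) has_real_derivative 0) (at 0)"
  proof (rule has_field_derivative_transform_within_open[where S = "{-1<..<1}"])
    show "((\<lambda>s. \<integral>x. \<psi> x \<partial>lborel) has_real_derivative 0) (at 0)" by simp
    show "(\<integral>x. \<psi> x \<partial>lborel) = (\<integral>x. 1 * \<psi> (x - s *\<^sub>R z) \<partial>lebesgue_on ?B)" if "s \<in> {-1<..<1}" for s
      using F[of s] that by auto
  qed auto
  ultimately have "(\<integral>x. frechet_derivative \<psi> (at x) z \<partial>lebesgue_on ?B) = 0"
    using DERIV_unique by fastforce
  moreover have "(\<integral>x. frechet_derivative \<psi> (at x) z \<partial>lebesgue_on ?B) = (\<integral>x. frechet_derivative \<psi> (at x) z \<partial>lborel)"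
  proof (rule lebesgue_on_integral_support)
    fix x assume "x \<notin> ?B"
    then have "r + norm z + 1 \<le> norm x" by simp
    then have "\<not> norm x \<le> r" using norm_ge_zero[of z] by linarith
    then have "x \<notin> K" using r(2) by blast
    moreover have "closure {x. \<psi> x \<noteq> 0} \<subseteq> K" using K by (intro closure_minimal compact_imp_closed)
    ultimately show "frechet_derivative \<psi> (at x) z = 0" by (intro test_function_derivative_outside[OF \<psi>]) blast
  qed auto
  moreover have "(\<integral>x. frechet_derivative \<psi> (at x) z \<partial>lebesgue_on \<Omega>) = (\<integral>x. frechet_derivative \<psi> (at x) z \<partial>lborel)"
    using test_functionsD(3)[OF \<psi>]
    by (intro lebesgue_on_integral_support \<Omega> test_function_derivative_outside[OF \<psi>]) auto
  ultimately show ?thesis by simp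
qed

text \<open>In the derivative of a modulated test function, the second term carries the large frequency \<open>a\<close>;
  it vanishes in directions orthogonal to \<open>a\<close>.\<close>

lemma modulated_test_function:
  fixes \<psi> :: "'a::euclidean_space \<Rightarrow> real"
  assumes \<psi>: "\<psi> \<in> test_functions \<Omega>"
  shows "(\<lambda>x. \<psi> x * cos (a \<bullet> x + c)) \<in> test_functions \<Omega>"
    and "frechet_derivative (\<lambda>x. \<psi> x * cos (a \<bullet> x + c)) (at x) z =
       frechet_derivative \<psi> (at x) z * cos (a \<bullet> x + c) - (a \<bullet> z) * (\<psi> x * sin (a \<bullet> x + c))"
proof -
  show "(\<lambda>x. \<psi> x * cos (a \<bullet> x + c)) \<in> test_functions \<Omega>"
    using test_function_mult_smooth[OF \<psi>, of "\<lambda>x. cos (a \<bullet> x + c)"] C_k_cos[of _ 1 a c] by simp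
  have "((\<lambda>x. \<psi> x * cos (a \<bullet> x + c)) has_derivative
     (\<lambda>z. frechet_derivative \<psi> (at x) z * cos (a \<bullet> x + c) - (a \<bullet> z) * (\<psi> x * sin (a \<bullet> x + c)))) (at x)"
    by (auto intro!: derivative_eq_intros test_function_has_derivative[OF \<psi>] simp: algebra_simps)
  from frechet_derivative_at[OF this] show "frechet_derivative (\<lambda>x. \<psi> x * cos (a \<bullet> x + c)) (at x) z =
       frechet_derivative \<psi> (at x) z * cos (a \<bullet> x + c) - (a \<bullet> z) * (\<psi> x * sin (a \<bullet> x + c))"
    by metis
qed

lemma borel_measurable_cos_affine [measurable]:
  "(\<lambda>x::'a::euclidean_space. cos (a \<bullet> x + c)) \<in> borel_measurable (lebesgue_on \<Omega>)"
  by (rule borel_measurable_lebesgue_on) measurable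

text \<open>Integration by parts in the direction \<open>\<xi>\<close> gains a factor \<open>\<eta> n\<close>.\<close>

lemma Riemann_Lebesgue_test_function:
  fixes \<psi> :: "'a::euclidean_space \<Rightarrow> real"
  assumes \<Omega>: "open \<Omega>" "bounded \<Omega>" and \<psi>: "\<psi> \<in> test_functions \<Omega>" and \<xi>: "\<xi> \<noteq> 0"
    and \<eta>: "\<And>n. \<eta> n > 0" "\<eta> \<longlonglongrightarrow> 0"
  shows "(\<lambda>n. \<integral>x. \<psi> x * cos ((\<xi> /\<^sub>R \<eta> n) \<bullet> x + c) \<partial>lebesgue_on \<Omega>) \<longlonglongrightarrow> 0"
proof -
  let ?M = "lebesgue_on \<Omega>"
  interpret finite_measure ?M using \<Omega> by (rule finite_measure_bounded_open)
  obtain B where B: "0 < B" "\<And>x. \<bar>frechet_derivative \<psi> (at x) \<xi>\<bar> \<le> B"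
    using test_function_directional(2)[OF \<psi>] by metis
  define C where "C = B * measure ?M (space ?M)"
  have bound: "\<bar>\<integral>x. \<psi> x * cos ((\<xi> /\<^sub>R \<eta> n) \<bullet> x + c) \<partial>?M\<bar> \<le> \<eta> n * (C / (\<xi> \<bullet> \<xi>))" for n
  proof -
    \<comment> \<open>The phase \<open>c - pi / 2\<close> turns the cosine into a sine, whose derivative along \<open>\<xi>\<close> is the given cosine.\<close>
    let ?a = "\<xi> /\<^sub>R \<eta> n" and ?c = "c - pi / 2"
    let ?P = "\<lambda>x. \<psi> x * cos (?a \<bullet> x + ?c)"
    let ?q = "\<lambda>x. frechet_derivative \<psi> (at x) \<xi> * cos (?a \<bullet> x + ?c)"
    let ?I = "\<integral>x. \<psi> x * cos (?a \<bullet> x + c) \<partial>?M"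
    have P: "?P \<in> test_functions \<Omega>" by (rule modulated_test_function(1)[OF \<psi>])
    have D: "frechet_derivative ?P (at x) \<xi> = ?q x + (?a \<bullet> \<xi>) * (\<psi> x * cos (?a \<bullet> x + c))" for x
    proof -
      have "sin (?a \<bullet> x + ?c) = - cos (?a \<bullet> x + c)"
        using sin_cos_eq[of "?a \<bullet> x + ?c"] cos_minus[of "?a \<bullet> x + c - pi"] cos_minus_pi[of "?a \<bullet> x + c"]
        by (simp add: algebra_simps)
      then show ?thesis using modulated_test_function(2)[OF \<psi>, of ?a ?c x \<xi>] by simp
    qed
    have qm: "?q \<in> borel_measurable ?M"
      by (intro borel_measurable_times borel_measurable_lebesgue_on[OF test_function_directional(1)[OF \<psi>]] borel_measurable_cos_affine)
    have qB: "\<bar>?q x\<bar> \<le> B" for x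
      using mult_mono[OF B(2)[of x] abs_cos_le_one[of "?a \<bullet> x + ?c"]] B(1) by (simp add: abs_mult)
    have iq: "integrable ?M ?q" by (rule integrable_const_bound[of _ B]) (use qB qm in auto)
    have ip: "integrable ?M (\<lambda>x. \<psi> x * cos (?a \<bullet> x + c))"
      by (rule L2_integrable[OF test_function_L2[OF \<Omega> modulated_test_function(1)[OF \<psi>]]])
    have "0 = (\<integral>x. ?q x \<partial>?M) + (?a \<bullet> \<xi>) * ?I"
      using test_function_derivative_integral_zero[OF P, of \<xi>] \<Omega>(1) iq ip unfolding D by simp
    then have "(?a \<bullet> \<xi>) * ?I = - (\<integral>x. ?q x \<partial>?M)" by simp
    moreover have "\<bar>\<integral>x. ?q x \<partial>?M\<bar> \<le> C"
    proof -
      have "\<bar>\<integral>x. ?q x \<partial>?M\<bar> \<le> (\<integral>x. \<bar>?q x\<bar> \<partial>?M)" by (rule integral_abs_bound)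
      also have "\<dots> \<le> (\<integral>x. B \<partial>?M)" using iq qB by (intro integral_mono integrable_abs) auto
      finally show ?thesis by (simp add: C_def mult.commute)
    qed
    ultimately have "\<bar>(?a \<bullet> \<xi>) * ?I\<bar> \<le> C" by simp
    then have "(\<xi> \<bullet> \<xi>) / \<eta> n * \<bar>?I\<bar> \<le> C" using \<eta>(1)[of n] by (simp add: abs_mult divide_inverse mult.commute)
    then show ?thesis using \<eta>(1)[of n] \<xi> by (simp add: field_simps)
  qed
  show ?thesis
  proof (rule Lim_null_comparison)
    show "\<forall>\<^sub>F n in sequentially. norm (\<integral>x. \<psi> x * cos ((\<xi> /\<^sub>R \<eta> n) \<bullet> x + c) \<partial>?M) \<le> \<eta> n * (C / (\<xi> \<bullet> \<xi>))"
      using bound by simp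
    show "(\<lambda>n. \<eta> n * (C / (\<xi> \<bullet> \<xi>))) \<longlonglongrightarrow> 0" using tendsto_mult_right[OF \<eta>(2), of "C / (\<xi> \<bullet> \<xi>)"] by simp
  qed
qed

lemma Riemann_Lebesgue:
  fixes f :: "'a::euclidean_space \<Rightarrow> real"
  assumes \<Omega>: "open \<Omega>" "bounded \<Omega>" and f: "f \<in> L2 (lebesgue_on \<Omega>)" and \<xi>: "\<xi> \<noteq> 0"
    and \<eta>: "\<And>n. \<eta> n > 0" "\<eta> \<longlonglongrightarrow> 0"
  shows "(\<lambda>n. \<integral>x. f x * cos ((\<xi> /\<^sub>R \<eta> n) \<bullet> x + c) \<partial>lebesgue_on \<Omega>) \<longlonglongrightarrow> 0"
proof (rule LIMSEQ_I)
  fix e :: real assume e: "0 < e"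
  let ?M = "lebesgue_on \<Omega>"
  interpret finite_measure ?M using \<Omega> by (rule finite_measure_bounded_open)
  define m where "m = sqrt (measure ?M (space ?M))"
  have m: "0 \<le> m" by (simp add: m_def)
  obtain \<psi> where \<psi>: "\<And>n::nat. \<psi> n \<in> test_functions \<Omega>" "(\<lambda>n. L2_norm ?M (\<lambda>x. \<psi> n x - f x)) \<longlonglongrightarrow> 0"
    using test_functions_dense[OF \<Omega> f] by blast
  have "0 < e / (2 * (m + 1))" using e m by simp
  then obtain j where "L2_norm ?M (\<lambda>x. \<psi> j x - f x) < e / (2 * (m + 1))"
    using LIMSEQ_D[OF \<psi>(2)] by fastforce
  then have "L2_norm ?M (\<lambda>x. \<psi> j x - f x) * (m + 1) < e / 2" using m by (simp add: field_simps)
  then have j: "L2_norm ?M (\<lambda>x. \<psi> j x - f x) * m < e / 2"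
    using L2_norm_nonneg[of ?M "\<lambda>x. \<psi> j x - f x"] unfolding distrib_left by linarith
  let ?I = "\<lambda>f n. \<integral>x. f x * cos ((\<xi> /\<^sub>R \<eta> n) \<bullet> x + c) \<partial>?M"
  have \<psi>L: "\<psi> j \<in> L2 ?M" by (rule test_function_L2[OF \<Omega> \<psi>(1)])
  have cosL: "(\<lambda>x. cos ((\<xi> /\<^sub>R \<eta> n) \<bullet> x + c)) \<in> L2 ?M" for n 
    by (rule L2_bounded[where C = 1, OF borel_measurable_cos_affine]) simp
  have close: "\<bar>?I (\<psi> j) n - ?I f n\<bar> < e / 2" for n
  proof -
    have "?I (\<psi> j) n - ?I f n = ?I (\<lambda>x. \<psi> j x - f x) n"
      using L2_mult_integrable[OF \<psi>L cosL] L2_mult_integrable[OF f cosL] by (simp add: left_diff_distrib)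
    also have "\<bar>\<dots>\<bar> \<le> L2_norm ?M (\<lambda>x. \<psi> j x - f x) * L2_norm ?M (\<lambda>x. cos ((\<xi> /\<^sub>R \<eta> n) \<bullet> x + c))"
      by (rule L2_Cauchy_Schwarz[OF L2_diff[OF \<psi>L f] cosL])
    also have "\<dots> \<le> L2_norm ?M (\<lambda>x. \<psi> j x - f x) * m"
    proof (rule mult_left_mono[OF _ L2_norm_nonneg])
      show "L2_norm ?M (\<lambda>x. cos ((\<xi> /\<^sub>R \<eta> n) \<bullet> x + c)) \<le> m"
        unfolding m_def L2_norm_one[symmetric] by (rule L2_bound(2)[OF _ borel_measurable_cos_affine]) (auto simp: L2_real_iff)
    qed
    finally show ?thesis using j by simp
  qed
  obtain N where N: "\<And>n. n \<ge> N \<Longrightarrow> \<bar>?I (\<psi> j) n\<bar> < e / 2"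
    using LIMSEQ_D[OF Riemann_Lebesgue_test_function[OF \<Omega> \<psi>(1) \<xi> \<eta>, of j c], of "e/2"] e by auto
  have "\<bar>?I f n\<bar> < e" if "n \<ge> N" for n
  proof -
    have "\<bar>?I (\<psi> j) n - ?I f n\<bar> < e / 2" "\<bar>?I (\<psi> j) n\<bar> < e / 2" using close N[OF that] by auto
    then show ?thesis unfolding abs_less_iff by linarith
  qed
  then show "\<exists>N. \<forall>n\<ge>N. norm (?I f n - 0) < e" by auto
qed


section \<open>Weak gradients\<close>

lemma test_function_derivative_L2:
  assumes \<Omega>: "open \<Omega>" "bounded \<Omega>" and \<psi>: "\<psi> \<in> test_functions D"
  shows "(\<lambda>x. frechet_derivative \<psi> (at x) z) \<in> L2 (lebesgue_on \<Omega>)"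
proof -
  interpret finite_measure "lebesgue_on \<Omega>" using \<Omega> by (rule finite_measure_bounded_open)
  obtain B where B: "0 < B" "\<And>x. \<bar>frechet_derivative \<psi> (at x) z\<bar> \<le> B"
    using test_function_directional(2)[OF \<psi>] by metis
  show ?thesis by (rule L2_bounded[OF borel_measurable_lebesgue_on[OF test_function_directional(1)[OF \<psi>]] B(2)])
qed

lemma weak_grad_directional:
  assumes \<Omega>: "open \<Omega>" "bounded \<Omega>" and u: "u \<in> L2 (lebesgue_on \<Omega>)" and g: "g \<in> L2 (lebesgue_on \<Omega>)"
    and ug: "has_weak_grad \<Omega> u g" and \<psi>: "\<psi> \<in> test_functions \<Omega>"
  shows "(\<integral>x. u x * frechet_derivative \<psi> (at x) z \<partial>lebesgue_on \<Omega>) = - (\<integral>x. (g x \<bullet> z) * \<psi> x \<partial>lebesgue_on \<Omega>)"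
proof -
  let ?M = "lebesgue_on \<Omega>"
  interpret finite_measure ?M using \<Omega> by (rule finite_measure_bounded_open)
  note dL = test_function_derivative_L2[OF \<Omega> \<psi>]
  have "(\<integral>x. u x * frechet_derivative \<psi> (at x) z \<partial>?M) = (\<integral>x. (\<Sum>b\<in>Basis. (z \<bullet> b) * (u x * frechet_derivative \<psi> (at x) b)) \<partial>?M)"
    unfolding frechet_derivative_basis_sum[OF \<psi>, of _ z] by (simp add: sum_distrib_left mult.left_commute)
  also have "\<dots> = (\<Sum>b\<in>Basis. (z \<bullet> b) * (\<integral>x. u x * frechet_derivative \<psi> (at x) b \<partial>?M))"
    using L2_mult_integrable[OF u dL] by simp
  also have "\<dots> = - (\<Sum>b\<in>Basis. (z \<bullet> b) * (\<integral>x. (g x \<bullet> b) * \<psi> x \<partial>?M))"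
    using ug \<psi> by (simp add: has_weak_grad_def sum_negf)
  also have "(\<Sum>b\<in>Basis. (z \<bullet> b) * (\<integral>x. (g x \<bullet> b) * \<psi> x \<partial>?M)) = (\<integral>x. (\<Sum>b\<in>Basis. (z \<bullet> b) * ((g x \<bullet> b) * \<psi> x)) \<partial>?M)"
    using L2_mult_integrable[OF L2_component(1)[OF g] test_function_L2[OF \<Omega> \<psi>]] by simp
  also have "\<dots> = (\<integral>x. (g x \<bullet> z) * \<psi> x \<partial>?M)"
    by (subst (2) euclidean_inner) (simp add: sum_distrib_right mult.assoc mult.left_commute)
  finally show ?thesis .
qed

lemma weak_grad_unique:
  assumes \<Omega>: "open \<Omega>" "bounded \<Omega>" and g: "g \<in> L2 (lebesgue_on \<Omega>)" "h \<in> L2 (lebesgue_on \<Omega>)"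
    and ug: "has_weak_grad \<Omega> u g" "has_weak_grad \<Omega> u h"
  shows "AE x in lebesgue_on \<Omega>. g x = h x"
proof -
  let ?M = "lebesgue_on \<Omega>"
  interpret finite_measure ?M using \<Omega> by (rule finite_measure_bounded_open)
  have "AE x in ?M. g x \<bullet> b - h x \<bullet> b = 0" if b: "b \<in> Basis" for b
  proof (rule fundamental_lemma[OF \<Omega>(1)])
    note gL = L2_component(1)[OF g(1), of b] and hL = L2_component(1)[OF g(2), of b]
    show "integrable ?M (\<lambda>x. g x \<bullet> b - h x \<bullet> b)" by (intro L2_integrable L2_diff gL hL)
    fix \<psi> assume \<psi>: "\<psi> \<in> test_functions \<Omega>"
    have "(\<integral>x. (g x \<bullet> b) * \<psi> x \<partial>?M) = (\<integral>x. (h x \<bullet> b) * \<psi> x \<partial>?M)"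
      using ug(1)[unfolded has_weak_grad_def, rule_format, OF \<psi> b] ug(2)[unfolded has_weak_grad_def, rule_format, OF \<psi> b]
      by simp
    then show "(\<integral>x. (g x \<bullet> b - h x \<bullet> b) * \<psi> x \<partial>?M) = 0"
      using L2_mult_integrable[OF gL test_function_L2[OF \<Omega> \<psi>]] L2_mult_integrable[OF hL test_function_L2[OF \<Omega> \<psi>]]
      by (simp add: left_diff_distrib)
  qed
  then have "AE x in ?M. \<forall>b\<in>Basis. g x \<bullet> b - h x \<bullet> b = 0" by (simp add: AE_finite_all)
  then show ?thesis by eventually_elim (auto intro: euclidean_eqI)
qed

lemma has_weak_grad_diff:
  assumes \<Omega>: "open \<Omega>" "bounded \<Omega>" and u: "u \<in> L2 (lebesgue_on \<Omega>)" "v \<in> L2 (lebesgue_on \<Omega>)"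
    and g: "g \<in> L2 (lebesgue_on \<Omega>)" "h \<in> L2 (lebesgue_on \<Omega>)"
    and ug: "has_weak_grad \<Omega> u g" and vh: "has_weak_grad \<Omega> v h"
  shows "has_weak_grad \<Omega> (\<lambda>x. u x - v x) (\<lambda>x. g x - h x)"
  unfolding has_weak_grad_def
proof (intro ballI)
  fix \<psi> and b :: 'a assume \<psi>: "\<psi> \<in> test_functions \<Omega>" and b: "b \<in> Basis"
  let ?M = "lebesgue_on \<Omega>"
  interpret finite_measure ?M using \<Omega> by (rule finite_measure_bounded_open)
  note dL = test_function_derivative_L2[OF \<Omega> \<psi>, of b]
  note \<psi>L = test_function_L2[OF \<Omega> \<psi>]
  have "(\<integral>x. (u x - v x) * frechet_derivative \<psi> (at x) b \<partial>?M) =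
     (\<integral>x. u x * frechet_derivative \<psi> (at x) b \<partial>?M) - (\<integral>x. v x * frechet_derivative \<psi> (at x) b \<partial>?M)"
    using L2_mult_integrable[OF u(1) dL] L2_mult_integrable[OF u(2) dL] by (simp add: left_diff_distrib)
  also have "\<dots> = - ((\<integral>x. (g x \<bullet> b) * \<psi> x \<partial>?M) - (\<integral>x. (h x \<bullet> b) * \<psi> x \<partial>?M))"
    using ug[unfolded has_weak_grad_def, rule_format, OF \<psi> b] vh[unfolded has_weak_grad_def, rule_format, OF \<psi> b] by simp
  also have "(\<integral>x. (g x \<bullet> b) * \<psi> x \<partial>?M) - (\<integral>x. (h x \<bullet> b) * \<psi> x \<partial>?M) = (\<integral>x. ((g x - h x) \<bullet> b) * \<psi> x \<partial>?M)"
    using L2_mult_integrable[OF L2_component(1)[OF g(1)] \<psi>L] L2_mult_integrable[OF L2_component(1)[OF g(2)] \<psi>L]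
    by (simp add: left_diff_distrib inner_diff_left)
  finally show "(\<integral>x. (u x - v x) * frechet_derivative \<psi> (at x) b \<partial>?M) = - (\<integral>x. ((g x - h x) \<bullet> b) * \<psi> x \<partial>?M)" .
qed

lemma W12_weak_grad:
  assumes "u \<in> W12 \<Omega>"
  shows "u \<in> L2 (lebesgue_on \<Omega>)" "weak_grad \<Omega> u \<in> L2 (lebesgue_on \<Omega>)" "has_weak_grad \<Omega> u (weak_grad \<Omega> u)"
proof -
  have "\<exists>g. g \<in> L2 (lebesgue_on \<Omega>) \<and> has_weak_grad \<Omega> u g" using assms by (auto simp: W12_def)
  from someI_ex[OF this] show "weak_grad \<Omega> u \<in> L2 (lebesgue_on \<Omega>)" "has_weak_grad \<Omega> u (weak_grad \<Omega> u)"
    by (auto simp: weak_grad_def)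
qed (use assms in \<open>auto simp: W12_def\<close>)

text \<open>This is the bound \<open>\<parallel>u(\<sqdot> + z) - u\<parallel> \<le> \<bar>z\<bar> \<parallel>g\<parallel>\<close> in dual form. Moving the test function along the
  segment, \<open>s \<mapsto> \<integral> u(x) \<psi>(x - s z) dx\<close> has the derivative \<open>\<integral> (g \<bullet> z) \<psi>(x - s z) dx\<close>. As the segments may start at
  any point of the set \<open>D\<close>, the estimate reaches the boundary of \<open>\<Omega>\<close> wherever \<open>z\<close> points inwards.\<close>

lemma translation_estimate:
  fixes u :: "'a::euclidean_space \<Rightarrow> real"
  assumes \<Omega>: "open \<Omega>" "bounded \<Omega>" and u: "u \<in> L2 (lebesgue_on \<Omega>)" and g: "g \<in> L2 (lebesgue_on \<Omega>)"
    and ug: "has_weak_grad \<Omega> u g" and \<psi>: "\<psi> \<in> test_functions D"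
    and D: "\<And>x s. x \<in> D \<Longrightarrow> 0 \<le> s \<Longrightarrow> s \<le> 1 \<Longrightarrow> x + s *\<^sub>R z \<in> \<Omega>"
  shows "\<bar>(\<integral>x. u x * \<psi> (x - z) \<partial>lebesgue_on \<Omega>) - (\<integral>x. u x * \<psi> x \<partial>lebesgue_on \<Omega>)\<bar>
    \<le> norm z * L2_norm (lebesgue_on \<Omega>) g * L2_norm lborel \<psi>"
proof -
  let ?M = "lebesgue_on \<Omega>"
  interpret finite_measure ?M using \<Omega> by (rule finite_measure_bounded_open)
  have \<Omega>B: "\<Omega> \<in> sets borel" using \<Omega> by simp
  note [measurable] = test_function_measurable(1)[OF \<psi>]
  define F where "F s = (\<integral>x. u x * \<psi> (x - s *\<^sub>R z) \<partial>?M)" for s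
  have norm\<psi>: "L2_norm ?M (\<lambda>x. \<psi> (x - y)) \<le> L2_norm lborel \<psi>" for y
  proof -
    have "integrable lborel (\<lambda>x. (\<psi> x)\<^sup>2)"
    proof -
      obtain B where B: "0 < B" "\<And>x. \<bar>\<psi> x\<bar> \<le> B" using test_function_bounded[OF \<psi>] by blast
      obtain K where K: "compact K" "K \<subseteq> D" "{x. \<psi> x \<noteq> 0} \<subseteq> K" using \<psi> by (rule test_functions_support)
      have "integrable lborel (\<lambda>x. indicator K x * B\<^sup>2)"
        using emeasure_compact_finite[OF K(1)] compact_imp_closed[OF K(1)]
        by (intro integrable_mult_left integrable_real_indicator) (auto simp: less_top)
      then show ?thesis
      proof (rule Bochner_Integration.integrable_bound)
        have "\<psi> x = 0" if "x \<notin> K" for x using K(3) that by blast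
        then show "AE x in lborel. norm ((\<psi> x)\<^sup>2) \<le> norm (indicator K x * B\<^sup>2)"
          using B by (intro AE_I2) (auto simp: indicator_def power2_le_iff_abs_le)
      qed simp
    qed
    then have int: "integrable lborel (\<lambda>x. (\<psi> (x - y))\<^sup>2)"
      using lborel_integrable_shift[of "\<lambda>x. (\<psi> x)\<^sup>2" y] by simp
    have "(\<integral>x. (\<psi> (x - y))\<^sup>2 \<partial>?M) = (\<integral>x. indicator \<Omega> x * (\<psi> (x - y))\<^sup>2 \<partial>lborel)"
      by (rule lebesgue_on_integral_borel(1)[OF _ \<Omega>B]) measurable
    also have "\<dots> \<le> (\<integral>x. (\<psi> (x - y))\<^sup>2 \<partial>lborel)"
    proof (rule integral_mono[OF _ int])
      show "integrable lborel (\<lambda>x. indicator \<Omega> x * (\<psi> (x - y))\<^sup>2)"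
        using integrable_mult_indicator[OF _ int, of \<Omega>] \<Omega>B by simp
    qed (simp add: indicator_def)
    also have "\<dots> = (\<integral>x. (\<psi> x)\<^sup>2 \<partial>lborel)" using lborel_integral_shift[of "\<lambda>x. (\<psi> x)\<^sup>2" y] by simp
    finally show ?thesis by (simp add: L2_norm_def)
  qed
  have deriv: "(F has_real_derivative - (\<integral>x. u x * frechet_derivative \<psi> (at (x - s *\<^sub>R z)) z \<partial>?M)) (at s)" for s
    unfolding F_def[abs_def] by (rule shifted_pairing_has_derivative[OF L2_integrable[OF u] \<psi>])
  have bound: "\<bar>- (\<integral>x. u x * frechet_derivative \<psi> (at (x - s *\<^sub>R z)) z \<partial>?M)\<bar> \<le> norm z * L2_norm ?M g * L2_norm lborel \<psi>"
    if s: "s \<in> {0..1}" for s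
  proof -
    let ?\<psi> = "\<lambda>x. \<psi> (x - s *\<^sub>R z)"
    have t: "?\<psi> \<in> test_functions \<Omega>" using D s by (intro test_function_shift[OF \<psi>]) auto
    have "frechet_derivative ?\<psi> (at x) z = frechet_derivative \<psi> (at (x - s *\<^sub>R z)) z" for x
      using frechet_derivative_at[OF has_derivative_shift[OF test_functionsD(1)[OF \<psi>, of "Suc 0"], of "s *\<^sub>R z" x]] by simp
    then have "- (\<integral>x. u x * frechet_derivative \<psi> (at (x - s *\<^sub>R z)) z \<partial>?M) = (\<integral>x. (g x \<bullet> z) * ?\<psi> x \<partial>?M)"
      using weak_grad_directional[OF \<Omega> u g ug t, of z] by simp
    also have "\<bar>\<dots>\<bar> \<le> L2_norm ?M (\<lambda>x. g x \<bullet> z) * L2_norm ?M ?\<psi>"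
      by (rule L2_Cauchy_Schwarz[OF L2_component(1)[OF g] test_function_L2[OF \<Omega> t]])
    also have "\<dots> \<le> (norm z * L2_norm ?M g) * L2_norm lborel \<psi>"
      by (rule mult_mono[OF L2_component(2)[OF g] norm\<psi>]) auto
    finally show ?thesis .
  qed
  have "norm (F 1 - F 0) \<le> norm z * L2_norm ?M g * L2_norm lborel \<psi> * norm (1 - 0 :: real)"
    using deriv bound by (intro field_differentiable_bound[of "{0..1}" F]) (auto intro: has_field_derivative_at_within)
  then show ?thesis by (simp add: F_def)
qed


section \<open>Rellich compactness up to a Lipschitz boundary\<close>

lemma norm_vector_2_le_norm:
  fixes v :: "real^3"
  shows "norm (vector [v $ 1, v $ 2] :: real^2) \<le> norm v"
  by (simp add: norm_vec_def L2_set_def sum_2 sum_3 vector_2)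

text \<open>At an interior point all small shifts will do. At a boundary point, let \<open>v\<close> be the direction in
  which \<open>\<Omega>\<close> lies above the graph of \<open>\<gamma>\<close>, and consider a shift \<open>z = t v + h\<close>. The height above the base
  grows by at least \<open>t - \<bar>h\<bar>\<close> and \<open>\<gamma>\<close> by at most \<open>L \<bar>h\<bar>\<close>, so \<open>z\<close> does not leave \<open>\<Omega>\<close> if \<open>(L + 1) \<bar>h\<bar> < t\<close>.
  This leaves a whole ball of shifts, over which functions can be averaged.\<close>

lemma lipschitz_boundary_inward_shifts:
  fixes \<Omega> :: "(real^3) set"
  assumes op: "open \<Omega>" and lip: "lipschitz_boundary \<Omega>" and p: "p \<in> closure \<Omega>"
  shows "\<exists>r>0. \<forall>e>0. \<exists>z0 \<rho>. \<rho> > 0 \<and> (\<forall>z\<in>ball z0 \<rho>. norm z \<le> e \<and>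
           (\<forall>x\<in>\<Omega> \<inter> ball p r. \<forall>s. 0 \<le> s \<longrightarrow> s \<le> 1 \<longrightarrow> x + s *\<^sub>R z \<in> \<Omega>))"
proof (cases "p \<in> \<Omega>")
  case True
  then obtain d where d: "d > 0" "ball p d \<subseteq> \<Omega>" using op open_contains_ball by blast
  show ?thesis
  proof (intro exI[of _ "d/2"] conjI allI impI)
    fix e :: real assume e: "e > 0"
    show "\<exists>z0 \<rho>. \<rho> > 0 \<and> (\<forall>z\<in>ball z0 \<rho>. norm z \<le> e \<and>
           (\<forall>x\<in>\<Omega> \<inter> ball p (d/2). \<forall>s. 0 \<le> s \<longrightarrow> s \<le> 1 \<longrightarrow> x + s *\<^sub>R z \<in> \<Omega>))"
    proof (rule exI[of _ 0], rule exI[of _ "min e (d/2)"], intro conjI ballI allI impI)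
      show "0 < min e (d/2)" using d e by simp
      fix z :: "real^3" assume z: "z \<in> ball 0 (min e (d/2))"
      then show "norm z \<le> e" by simp
      fix x and s :: real assume x: "x \<in> \<Omega> \<inter> ball p (d/2)" and s: "0 \<le> s" "s \<le> 1"
      have "norm (s *\<^sub>R z) \<le> norm z" using s by (simp add: mult_left_le_one_le)
      also have "\<dots> < d/2" using z by simp
      finally have "dist p (x + s *\<^sub>R z) < d"
        using x norm_triangle_ineq4[of "p - x" "s *\<^sub>R z"] by (simp add: dist_norm diff_diff_eq)
      then show "x + s *\<^sub>R z \<in> \<Omega>" using d(2) by auto
    qed
  qed (use d in auto)
next
  case False
  then have "p \<in> frontier \<Omega>" using p op by (simp add: frontier_def interior_open)
  then obtain r and T :: "real^3 \<Rightarrow> real^3" and \<gamma> :: "real^2 \<Rightarrow> real" and L where r: "r > 0"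
    and T: "orthogonal_transformation T" and \<gamma>: "L-lipschitz_on UNIV \<gamma>"
    and loc: "\<Omega> \<inter> ball p r = {x \<in> ball p r. \<gamma> (vector [T x $ 1, T x $ 2]) < T x $ 3}"
    using lip unfolding lipschitz_boundary_def by blast
  have L: "0 \<le> L" using \<gamma> by (rule lipschitz_on_nonneg)
  interpret T: linear T using T by (rule orthogonal_transformation_linear)
  obtain v where v: "T v = axis 3 1" using orthogonal_transformation_surj[OF T] by (metis surjD)
  have "norm v = norm (T v)" using orthogonal_transformation_norm[OF T, of v] by simp
  then have nv: "norm v = 1" using v by (simp add: norm_axis_1)
  show ?thesis
  proof (intro exI[of _ "r/2"] conjI allI impI)
    fix e :: real assume e: "e > 0"
    define t where "t = min (e/2) (r/4)"
    have t: "0 < t" "2 * t \<le> e" "2 * t \<le> r/2" using e r by (auto simp: t_def)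
    show "\<exists>z0 \<rho>. \<rho> > 0 \<and> (\<forall>z\<in>ball z0 \<rho>. norm z \<le> e \<and>
           (\<forall>x\<in>\<Omega> \<inter> ball p (r/2). \<forall>s. 0 \<le> s \<longrightarrow> s \<le> 1 \<longrightarrow> x + s *\<^sub>R z \<in> \<Omega>))"
    proof (rule exI[of _ "t *\<^sub>R v"], rule exI[of _ "t / (L + 1)"], intro conjI ballI allI impI)
      show "0 < t / (L + 1)" using t L by simp
      fix z assume "z \<in> ball (t *\<^sub>R v) (t / (L + 1))"
      moreover define h where "h = z - t *\<^sub>R v"
      ultimately have h: "norm h < t / (L + 1)" and z: "z = t *\<^sub>R v + h" by (auto simp: dist_norm norm_minus_commute)
      have Lh: "L * norm h + norm h < t" using h L by (simp add: field_simps)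
      have "0 \<le> L * norm h" using L by simp
      then have ht: "norm h < t" using Lh by linarith
      have "norm z \<le> norm (t *\<^sub>R v) + norm h" unfolding z by (rule norm_triangle_ineq)
      then have nz: "norm z < 2 * t" using ht nv t by simp
      then show "norm z \<le> e" using t by simp
      fix x and s :: real assume x: "x \<in> \<Omega> \<inter> ball p (r/2)" and s: "0 \<le> s" "s \<le> 1"
      let ?y = "x + s *\<^sub>R z"
      have "norm (s *\<^sub>R z) \<le> norm z" using s by (simp add: mult_left_le_one_le)
      then have "norm (s *\<^sub>R z) < r/2" using nz t by linarith
      then have y: "?y \<in> ball p r"
        using x norm_triangle_ineq4[of "p - x" "s *\<^sub>R z"] by (simp add: dist_norm diff_diff_eq)
      have "x \<in> \<Omega> \<inter> ball p r" using x r by auto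
      then have gx: "\<gamma> (vector [T x $ 1, T x $ 2]) < T x $ 3" unfolding loc by simp
      have Ty: "T ?y = T x + s *\<^sub>R (t *\<^sub>R axis 3 1 + T h)"
        by (simp add: z T.add T.scale v)
      have d: "vector [T ?y $ 1, T ?y $ 2] - vector [T x $ 1, T x $ 2] = s *\<^sub>R (vector [T h $ 1, T h $ 2] :: real^2)"
        unfolding Ty by (simp add: vec_eq_iff forall_2 vector_2 axis_def)
      have nT: "norm (T h) = norm h" using orthogonal_transformation_norm[OF T] by simp
      have "\<bar>\<gamma> (vector [T ?y $ 1, T ?y $ 2]) - \<gamma> (vector [T x $ 1, T x $ 2])\<bar>
          \<le> L * norm (vector [T ?y $ 1, T ?y $ 2] - (vector [T x $ 1, T x $ 2] :: real^2))"
        using lipschitz_onD[OF \<gamma>] by (simp add: dist_norm)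
      also have "\<dots> \<le> L * (s * norm h)"
        unfolding d using norm_vector_2_le_norm[of "T h"] s L nT by (intro mult_left_mono) (auto intro: mult_left_mono)
      finally have g: "\<gamma> (vector [T ?y $ 1, T ?y $ 2]) \<le> \<gamma> (vector [T x $ 1, T x $ 2]) + s * (L * norm h)"
        by (simp add: algebra_simps)
      have "- norm h \<le> T h $ 3" using component_le_norm_cart[of "T h" 3] nT by simp
      then have "s * (L * norm h) \<le> s * (t + T h $ 3)" using Lh s by (intro mult_left_mono) auto
      moreover have "T ?y $ 3 = T x $ 3 + s * (t + T h $ 3)" unfolding Ty by (simp add: axis_def)
      ultimately have "\<gamma> (vector [T ?y $ 1, T ?y $ 2]) < T ?y $ 3" using g gx by linarith
      then have "?y \<in> \<Omega> \<inter> ball p r" unfolding loc using y by simp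
      then show "?y \<in> \<Omega>" by simp
    qed
  qed (use r in auto)
qed

lemma L2_restrict:
  fixes f :: "'a::euclidean_space \<Rightarrow> real"
  assumes f: "f \<in> L2 (lebesgue_on \<Omega>)" and D: "D \<subseteq> \<Omega>" "D \<in> sets borel" "\<Omega> \<in> sets borel"
  shows "f \<in> L2 (lebesgue_on D)"
    and "(\<integral>x. (f x)\<^sup>2 \<partial>lebesgue_on D) = (\<integral>x. indicator D x * (f x)\<^sup>2 \<partial>lebesgue_on \<Omega>)"
proof -
  have L: "D \<in> sets lebesgue" "\<Omega> \<in> sets lebesgue" using D by auto
  have ind: "indicator D x *\<^sub>R (indicator \<Omega> x *\<^sub>R y) = indicator D x *\<^sub>R (y::real)"
    "indicator \<Omega> x *\<^sub>R (indicator D x * y) = indicator D x *\<^sub>R y" for x y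
    using D(1) by (auto simp: indicator_def)
  have "integrable lebesgue (\<lambda>x. indicator \<Omega> x *\<^sub>R (f x)\<^sup>2)"
    using f L(2) by (subst integrable_restrict_space[symmetric]) (auto simp: L2_real_iff)
  from integrable_mult_indicator[OF L(1) this] have "integrable (lebesgue_on D) (\<lambda>x. (f x)\<^sup>2)"
    using L(1) unfolding ind by (subst integrable_restrict_space) auto
  moreover have "f \<in> borel_measurable (lebesgue_on D)"
    using L2_measurable[OF f] D(1) by (rule measurable_restrict_mono)
  ultimately show "f \<in> L2 (lebesgue_on D)" by (simp add: L2_real_iff)
  show "(\<integral>x. (f x)\<^sup>2 \<partial>lebesgue_on D) = (\<integral>x. indicator D x * (f x)\<^sup>2 \<partial>lebesgue_on \<Omega>)"
    using L by (subst (1 2) integral_restrict_space) (simp_all only: ind Int_UNIV_right space_completion space_lborel space_borel)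
qed

text \<open>\<open>A\<close> is the average of the translates of \<open>w\<close> by the shifts in the ball. By Fubini's theorem the
  pairing of \<open>w - A\<close> with a test function is the average of the differences in the translation
  estimate. Letting the test function tend to \<open>w\<close> in the norm of \<open>D\<close> turns the estimate for pairings
  into one for norms.\<close>

lemma L2_norm_le_average:
  fixes w :: "'a::euclidean_space \<Rightarrow> real"
  assumes \<Omega>: "open \<Omega>" "bounded \<Omega>" and w: "w \<in> L2 (lebesgue_on \<Omega>)" and g: "g \<in> L2 (lebesgue_on \<Omega>)"
    and wg: "has_weak_grad \<Omega> w g" and D: "open D"
    and \<rho>: "0 < \<rho>" and small: "\<And>z. z \<in> ball z0 \<rho> \<Longrightarrow> norm z \<le> e"
    and shift: "\<And>z x s. z \<in> ball z0 \<rho> \<Longrightarrow> x \<in> D \<Longrightarrow> 0 \<le> s \<Longrightarrow> s \<le> 1 \<Longrightarrow> x + s *\<^sub>R z \<in> \<Omega>"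
  defines "A \<equiv> \<lambda>x. (\<integral>y. w y * indicator (ball z0 \<rho>) (y - x) \<partial>lebesgue_on \<Omega>) / measure lborel (ball z0 \<rho>)"
  shows "A \<in> borel_measurable borel"
    and "L2_norm (lebesgue_on D) w \<le> e * L2_norm (lebesgue_on \<Omega>) g + L2_norm (lebesgue_on D) A"
proof -
  let ?H = "ball z0 \<rho>" and ?M = "lebesgue_on \<Omega>" and ?N = "lebesgue_on D"
  have [measurable]: "?H \<in> sets borel" by simp
  interpret finite_measure ?M using \<Omega> by (rule finite_measure_bounded_open)
  have \<Omega>B: "\<Omega> \<in> sets borel" and DB: "D \<in> sets borel" using \<Omega> D by auto
  have z0: "z0 \<in> ?H" using \<rho> by simp
  have D\<Omega>: "D \<subseteq> \<Omega>" using shift[OF z0, of _ 0] by auto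
  have bD: "bounded D" using \<Omega>(2) D\<Omega> by (rule bounded_subset)
  interpret N: finite_measure ?N using D bD by (rule finite_measure_bounded_open)
  have e: "0 \<le> e" using small[OF z0] norm_ge_zero[of z0] by linarith
  define \<mu> where "\<mu> = measure lborel ?H"
  have \<mu>: "0 < \<mu>" unfolding \<mu>_def using \<rho> content_ball_pos[of \<rho> z0] by simp
  have Hfin: "emeasure lborel ?H < \<infinity>" using emeasure_bounded_finite[of ?H] by simp
  have Hint: "integrable lborel (indicator ?H :: 'a \<Rightarrow> real)" using Hfin by (intro integrable_real_indicator) auto
  obtain w' where w' [measurable]: "w' \<in> borel_measurable borel" and w'0: "\<And>x. x \<notin> \<Omega> \<Longrightarrow> w' x = 0"
    and ae: "AE x in ?M. w x = w' x"
    using borel_representative[OF L2_measurable[OF w] \<Omega>B] by blast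
  have ind: "indicator \<Omega> x * w' x = w' x" for x using w'0[of x] by (auto simp: indicator_def)
  have pair: "(\<integral>y. w y * f y \<partial>?M) = (\<integral>y. w' y * f y \<partial>lborel)" if f: "f \<in> borel_measurable borel" for f
  proof -
    have "(\<integral>y. w y * f y \<partial>?M) = (\<integral>y. w' y * f y \<partial>?M)"
      using L2_measurable[OF w] borel_measurable_lebesgue_on[OF w'] borel_measurable_lebesgue_on[OF f] ae
      by (intro integral_cong_AE) auto
    also have "\<dots> = (\<integral>y. w' y * f y \<partial>lborel)" using f w'0 by (intro lebesgue_on_integral_support \<Omega>B) auto
    finally show ?thesis .
  qed
  have w'int: "integrable lborel w'"
  proof -
    have "integrable ?M w'"
      by (rule integrable_cong_AE_imp[OF L2_integrable[OF w] borel_measurable_lebesgue_on[OF w']]) (use ae in auto)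
    then show ?thesis using lebesgue_on_integral_borel(2)[OF w' \<Omega>B] by (simp add: ind)
  qed
  have A_eq: "A x = (\<integral>z. indicator ?H z * w' (x + z) \<partial>lborel) / \<mu>" for x
  proof -
    have "(\<integral>y. w' y * indicator ?H (y - x) \<partial>lborel) = (\<integral>y. (\<lambda>z. indicator ?H z * w' (x + z)) (y - x) \<partial>lborel)"
      by (simp add: mult.commute)
    also have "\<dots> = (\<integral>z. indicator ?H z * w' (x + z) \<partial>lborel)" by (rule lborel_integral_shift) measurable
    finally show ?thesis unfolding A_def \<mu>_def[symmetric] by (subst pair) auto
  qed
  show Am: "A \<in> borel_measurable borel" unfolding A_eq[abs_def] by measurable
  have AL: "A \<in> L2 ?N"
  proof (rule N.L2_bounded[OF borel_measurable_lebesgue_on[OF Am]])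
    fix x
    have "\<bar>\<integral>y. w y * indicator ?H (y - x) \<partial>?M\<bar> \<le> (\<integral>y. \<bar>w y * indicator ?H (y - x)\<bar> \<partial>?M)" by (rule integral_abs_bound)
    also have "\<dots> \<le> (\<integral>y. \<bar>w y\<bar> \<partial>?M)"
      using L2_integrable[OF w] by (intro integral_mono') (auto simp: indicator_def)
    finally show "\<bar>A x\<bar> \<le> (\<integral>y. \<bar>w y\<bar> \<partial>?M) / \<mu>"
      using \<mu> by (simp add: A_def \<mu>_def[symmetric] divide_right_mono abs_divide)
  qed
  note wN = L2_restrict(1)[OF w D\<Omega> DB \<Omega>B]
  \<comment> \<open>Averaging the translation estimate over the shifts in the ball.\<close>
  have key: "\<bar>\<integral>x. w x * \<psi> x \<partial>?N\<bar> \<le> (e * L2_norm ?M g + L2_norm ?N A) * L2_norm ?N \<psi>"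
    if \<psi>: "\<psi> \<in> test_functions D" for \<psi>
  proof -
    note [measurable] = test_function_measurable(1)[OF \<psi>]
    have \<psi>0: "\<psi> x = 0" if "x \<notin> D" for x using test_functionsD(3)[OF \<psi>] closure_subset[of "{x. \<psi> x \<noteq> 0}"] that by auto
    obtain B where B: "0 < B" "\<And>x. \<bar>\<psi> x\<bar> \<le> B" using test_function_bounded[OF \<psi>] by blast
    have n\<psi>: "L2_norm lborel \<psi> = L2_norm ?N \<psi>"
      unfolding L2_norm_def using lebesgue_on_integral_support[of "\<lambda>x. (\<psi> x)\<^sup>2" D] DB \<psi>0 by simp
    define S where "S z = (\<integral>x. w' (x + z) * \<psi> x \<partial>lborel)" for z
    have S_eq: "S z = (\<integral>x. w x * \<psi> (x - z) \<partial>?M)" for z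
    proof -
      have "(\<integral>x. w x * \<psi> (x - z) \<partial>?M) = (\<integral>x. (\<lambda>x. w' (x + z) * \<psi> x) (x - z) \<partial>lborel)"
        by (subst pair) auto
      also have "\<dots> = S z" unfolding S_def by (rule lborel_integral_shift) measurable
      finally show ?thesis by simp
    qed
    have S0: "S 0 = (\<integral>x. w x * \<psi> x \<partial>?N)"
    proof -
      have "(\<integral>x. w x * \<psi> x \<partial>?N) = (\<integral>x. w' x * \<psi> x \<partial>?N)"
      proof (rule integral_cong_AE)
        have "AE x in lebesgue. x \<in> \<Omega> \<longrightarrow> w x = w' x" using ae \<Omega>B by (subst (asm) AE_restrict_space_iff) auto
        then have "AE x in ?N. w x = w' x" using DB D\<Omega> by (subst AE_restrict_space_iff) auto
        then show "AE x in ?N. w x * \<psi> x = w' x * \<psi> x" by eventually_elim simp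
      qed (use L2_measurable[OF wN] borel_measurable_lebesgue_on[of w'] borel_measurable_lebesgue_on[of \<psi>] in auto)
      also have "\<dots> = (\<integral>x. w' x * \<psi> x \<partial>lborel)" using \<psi>0 by (intro lebesgue_on_integral_support DB) auto
      finally show ?thesis by (simp add: S_def)
    qed
    have Sz: "\<bar>S z - S 0\<bar> \<le> e * L2_norm ?M g * L2_norm ?N \<psi>" if z: "z \<in> ?H" for z
    proof -
      have "\<bar>S z - S 0\<bar> \<le> norm z * L2_norm ?M g * L2_norm lborel \<psi>"
        unfolding S_eq using translation_estimate[OF \<Omega> w g wg \<psi> shift[OF z]] by simp
      also have "\<dots> \<le> e * L2_norm ?M g * L2_norm lborel \<psi>"
        using small[OF z] by (intro mult_right_mono) auto
      finally show ?thesis by (simp add: n\<psi>)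
    qed
    define Q where "Q = (\<lambda>z x. indicator ?H z * w' (x + z) * \<psi> x)"
    have Qm: "case_prod Q \<in> borel_measurable (lborel \<Otimes>\<^sub>M lborel)" unfolding Q_def by measurable
    have shint: "integrable lborel (\<lambda>x. w' (x + z))" for z
      using lborel_integrable_shift[OF w', of "- z"] w'int by simp
    have wz: "integrable lborel (\<lambda>x. w' (x + z) * \<psi> x)" for z
    proof (rule Bochner_Integration.integrable_bound)
      show "integrable lborel (\<lambda>x. w' (x + z) * B)" using shint by simp
      show "AE x in lborel. norm (w' (x + z) * \<psi> x) \<le> norm (w' (x + z) * B)"
        using B by (intro AE_I2) (simp add: abs_mult mult_left_mono)
    qed measurable
    have Qint: "integrable (lborel \<Otimes>\<^sub>M lborel) (case_prod Q)"
    proof (rule lborel_pair.Fubini_integrable[OF Qm])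
      show "AE z in lborel. integrable lborel (\<lambda>x. case_prod Q (z, x))"
        unfolding Q_def using wz by (intro AE_I2) (simp add: mult.assoc)
      show "integrable lborel (\<lambda>z. \<integral>x. norm (case_prod Q (z, x)) \<partial>lborel)"
      proof (rule Bochner_Integration.integrable_bound)
        let ?c = "B * (\<integral>x. \<bar>w' x\<bar> \<partial>lborel)"
        show "integrable lborel (\<lambda>z. indicator ?H z * ?c)" using Hint by simp
        show "(\<lambda>z. \<integral>x. norm (case_prod Q (z, x)) \<partial>lborel) \<in> borel_measurable lborel"
          unfolding Q_def by measurable
        have le: "(\<integral>x. norm (case_prod Q (z, x)) \<partial>lborel) \<le> indicator ?H z * ?c" for z
        proof -
          have "(\<integral>x. norm (case_prod Q (z, x)) \<partial>lborel) = indicator ?H z * (\<integral>x. \<bar>w' (x + z) * \<psi> x\<bar> \<partial>lborel)"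
            by (simp add: Q_def abs_mult mult.assoc)
          also have "(\<integral>x. \<bar>w' (x + z) * \<psi> x\<bar> \<partial>lborel) \<le> (\<integral>x. B * \<bar>w' (x + z)\<bar> \<partial>lborel)"
            using B shint wz by (intro integral_mono integrable_abs integrable_mult_right) (auto simp: abs_mult mult.commute intro: mult_left_mono mult_right_mono)
          also have "\<dots> = ?c" using lborel_integral_shift[of "\<lambda>x. \<bar>w' x\<bar>" "- z"] by simp
          finally show ?thesis by (auto simp: indicator_def)
        qed
        show "AE z in lborel. norm (\<integral>x. norm (case_prod Q (z, x)) \<partial>lborel) \<le> norm (indicator ?H z * ?c)"
        proof (intro AE_I2)
          fix z
          have "norm (\<integral>x. norm (case_prod Q (z, x)) \<partial>lborel) = (\<integral>x. norm (case_prod Q (z, x)) \<partial>lborel)"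
            by (subst real_norm_def, rule abs_of_nonneg, rule Bochner_Integration.integral_nonneg) simp
          also note le[of z]
          also have "indicator ?H z * ?c \<le> norm (indicator ?H z * ?c)" by (subst real_norm_def) (rule abs_ge_self)
          finally show "norm (\<integral>x. norm (case_prod Q (z, x)) \<partial>lborel) \<le> norm (indicator ?H z * ?c)" .
        qed
      qed
    qed
    have QS: "(\<integral>x. Q z x \<partial>lborel) = indicator ?H z * S z" for z by (simp add: Q_def S_def mult.assoc)
    have QA: "(\<integral>z. Q z x \<partial>lborel) = \<mu> * (A x * \<psi> x)" for x
      using \<mu> by (simp add: Q_def A_eq)
    have Sint: "integrable lborel (\<lambda>z. indicator ?H z * S z)"
      using lborel_pair.integrable_fst[OF Qint] by (simp add: QS)
    have "\<mu> * (\<integral>x. A x * \<psi> x \<partial>lborel) = (\<integral>z. indicator ?H z * S z \<partial>lborel)"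
      using lborel_pair.Fubini_integral[OF Qint] by (simp add: QS QA)
    moreover have "(\<integral>x. A x * \<psi> x \<partial>lborel) = (\<integral>x. A x * \<psi> x \<partial>?N)"
      using Am \<psi>0 by (intro lebesgue_on_integral_support[symmetric] DB) auto
    moreover have "\<bar>(\<integral>z. indicator ?H z * S z \<partial>lborel) - \<mu> * S 0\<bar> \<le> \<mu> * (e * L2_norm ?M g * L2_norm ?N \<psi>)"
    proof -
      let ?k = "e * L2_norm ?M g * L2_norm ?N \<psi>"
      have "(\<integral>z. indicator ?H z * S z \<partial>lborel) - \<mu> * S 0 = (\<integral>z. indicator ?H z * S z - indicator ?H z * S 0 \<partial>lborel)"
        using Sint Hint by (subst Bochner_Integration.integral_diff) (auto simp: \<mu>_def)
      also have "\<bar>\<dots>\<bar> \<le> (\<integral>z. \<bar>indicator ?H z * S z - indicator ?H z * S 0\<bar> \<partial>lborel)" by (rule integral_abs_bound)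
      also have "\<dots> \<le> (\<integral>z. indicator ?H z * ?k \<partial>lborel)"
      proof (rule integral_mono)
        show "integrable lborel (\<lambda>z. \<bar>indicator ?H z * S z - indicator ?H z * S 0\<bar>)"
          using Sint Hint by (intro integrable_abs Bochner_Integration.integrable_diff integrable_mult_left)
        show "integrable lborel (\<lambda>z. indicator ?H z * ?k)" using Hint by (rule integrable_mult_left)
        show "\<bar>indicator ?H z * S z - indicator ?H z * S 0\<bar> \<le> indicator ?H z * ?k" for z
          using Sz[of z] by (cases "z \<in> ?H") (simp_all del: mem_ball)
      qed
      also have "\<dots> = \<mu> * ?k" by (simp add: \<mu>_def)
      finally show ?thesis .
    qed
    ultimately have "\<bar>\<mu> * ((\<integral>x. A x * \<psi> x \<partial>?N) - S 0)\<bar> \<le> \<mu> * (e * L2_norm ?M g * L2_norm ?N \<psi>)"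
      by (simp add: right_diff_distrib)
    then have "\<bar>(\<integral>x. A x * \<psi> x \<partial>?N) - S 0\<bar> \<le> e * L2_norm ?M g * L2_norm ?N \<psi>"
      using \<mu> by (simp add: abs_mult)
    moreover have "\<bar>\<integral>x. A x * \<psi> x \<partial>?N\<bar> \<le> L2_norm ?N A * L2_norm ?N \<psi>"
      by (rule L2_Cauchy_Schwarz[OF AL test_function_L2[OF D bD \<psi>]])
    ultimately show ?thesis unfolding S0[symmetric] distrib_right by linarith
  qed
  obtain \<psi> where \<psi>: "\<And>n::nat. \<psi> n \<in> test_functions D" and lim: "(\<lambda>n. L2_norm ?N (\<lambda>x. \<psi> n x - w x)) \<longlonglongrightarrow> 0"
    using test_functions_dense[OF D bD wN] by blast
  note \<psi>L = test_function_L2[OF D bD \<psi>]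
  have l1: "(\<lambda>n. \<bar>\<integral>x. w x * \<psi> n x \<partial>?N\<bar>) \<longlonglongrightarrow> \<bar>\<integral>x. w x * w x \<partial>?N\<bar>"
    using L2_inner_tendsto[OF \<psi>L wN wN lim] by (intro tendsto_rabs) (simp add: mult.commute)
  have l2: "(\<lambda>n. L2_norm ?N (\<psi> n)) \<longlonglongrightarrow> L2_norm ?N w"
  proof (rule LIM_zero_cancel, rule Lim_null_comparison[OF _ lim])
    show "\<forall>\<^sub>F n in sequentially. norm (L2_norm ?N (\<psi> n) - L2_norm ?N w) \<le> L2_norm ?N (\<lambda>x. \<psi> n x - w x)"
      using L2_norm_triangle_diff[OF \<psi>L wN] by (intro always_eventually) simp
  qed
  have "\<bar>\<integral>x. w x * w x \<partial>?N\<bar> \<le> (e * L2_norm ?M g + L2_norm ?N A) * L2_norm ?N w"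
    by (rule LIMSEQ_le[OF l1 tendsto_mult_left[OF l2]]) (use key[OF \<psi>] in blast)
  then have "L2_norm ?N w * L2_norm ?N w \<le> (e * L2_norm ?M g + L2_norm ?N A) * L2_norm ?N w"
    using L2_norm_real_sq[of ?N w] by (simp add: power2_eq_square)
  moreover have "0 \<le> e * L2_norm ?M g + L2_norm ?N A" using e by simp
  ultimately show "L2_norm ?N w \<le> e * L2_norm ?M g + L2_norm ?N A"
    using L2_norm_nonneg[of ?N w] by (cases "L2_norm ?N w = 0") auto
qed

text \<open>For a fixed ball of shifts, the averages of \<open>w n\<close> at \<open>x\<close> are integrals against a fixed function.
  They tend to \<open>0\<close> by weak convergence, and boundedly, hence also in the norm of \<open>D\<close>. The remaining
  error is at most \<open>e\<close> times the bound of the gradients, where \<open>e\<close> bounds the length of the shifts.\<close>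

lemma Rellich_local:
  fixes w :: "nat \<Rightarrow> 'a::euclidean_space \<Rightarrow> real"
  assumes \<Omega>: "open \<Omega>" "bounded \<Omega>" and w: "\<And>n. w n \<in> L2 (lebesgue_on \<Omega>)" and g: "\<And>n. g n \<in> L2 (lebesgue_on \<Omega>)"
    and wg: "\<And>n. has_weak_grad \<Omega> (w n) (g n)"
    and bw: "\<And>n. L2_norm (lebesgue_on \<Omega>) (w n) \<le> C" and bg: "\<And>n. L2_norm (lebesgue_on \<Omega>) (g n) \<le> C"
    and weak: "weakly_tendsto (lebesgue_on \<Omega>) w (\<lambda>x. 0)"
    and D: "open D" and shifts: "\<And>e. e > 0 \<Longrightarrow> \<exists>z0 \<rho>. \<rho> > 0 \<and> (\<forall>z\<in>ball z0 \<rho>. norm z \<le> e \<and>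
           (\<forall>x\<in>D. \<forall>s. 0 \<le> s \<longrightarrow> s \<le> 1 \<longrightarrow> x + s *\<^sub>R z \<in> \<Omega>))"
  shows "(\<lambda>n. L2_norm (lebesgue_on D) (w n)) \<longlonglongrightarrow> 0"
proof (rule LIMSEQ_I)
  fix \<epsilon> :: real assume \<epsilon>: "0 < \<epsilon>"
  let ?M = "lebesgue_on \<Omega>" and ?N = "lebesgue_on D"
  interpret finite_measure ?M using \<Omega> by (rule finite_measure_bounded_open)
  have C: "0 \<le> C" using bw[of 0] L2_norm_nonneg[of ?M "w 0"] by linarith
  \<comment> \<open>Shifts of length at most \<open>e\<close> cost at most \<open>e * C < \<epsilon> / 2\<close>; adding \<open>1\<close> covers the case \<open>C = 0\<close>.\<close>
  define e where "e = \<epsilon> / (2 * (C + 1))"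
  have e: "0 < e" using \<epsilon> C by (simp add: e_def)
  have "e * (C + 1) = \<epsilon> / 2" using C by (simp add: e_def field_simps)
  then have eC: "e * C < \<epsilon> / 2" using e unfolding distrib_left by linarith
  obtain z0 \<rho> where \<rho>: "\<rho> > 0" and z: "\<And>z. z \<in> ball z0 \<rho> \<Longrightarrow> norm z \<le> e"
    "\<And>z x s. z \<in> ball z0 \<rho> \<Longrightarrow> x \<in> D \<Longrightarrow> 0 \<le> s \<Longrightarrow> s \<le> 1 \<Longrightarrow> x + s *\<^sub>R z \<in> \<Omega>"
    using shifts[OF e] by blast
  let ?H = "ball z0 \<rho>"
  have [measurable]: "?H \<in> sets borel" by simp
  define \<mu> where "\<mu> = measure lborel ?H"
  have \<mu>: "0 < \<mu>" unfolding \<mu>_def using \<rho> content_ball_pos[of \<rho> z0] by simp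
  have D\<Omega>: "D \<subseteq> \<Omega>" using z(2)[of z0 _ 0] \<rho> by auto
  have bD: "bounded D" using \<Omega>(2) D\<Omega> by (rule bounded_subset)
  interpret N: finite_measure ?N using D bD by (rule finite_measure_bounded_open)
  define A where "A n x = (\<integral>y. w n y * indicator ?H (y - x) \<partial>?M) / \<mu>" for n x
  have Am: "A n \<in> borel_measurable borel" for n
    using L2_norm_le_average(1)[OF \<Omega> w g wg D \<rho> z] unfolding A_def[abs_def] \<mu>_def .
  have le: "L2_norm ?N (w n) \<le> e * L2_norm ?M (g n) + L2_norm ?N (A n)" for n
    using L2_norm_le_average(2)[OF \<Omega> w g wg D \<rho> z] unfolding A_def[abs_def] \<mu>_def .
  define K where "K = C * sqrt (measure ?M (space ?M)) / \<mu>"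
  have AB: "\<bar>A n x\<bar> \<le> K" for n x
  proof -
    have "\<bar>\<integral>y. w n y * indicator ?H (y - x) \<partial>?M\<bar> \<le> (\<integral>y. \<bar>w n y * indicator ?H (y - x)\<bar> \<partial>?M)" by (rule integral_abs_bound)
    also have "\<dots> \<le> (\<integral>y. \<bar>w n y\<bar> \<partial>?M)"
      using L2_integrable[OF w] by (intro integral_mono') (auto simp: indicator_def)
    also have "\<dots> \<le> L2_norm ?M (w n) * sqrt (measure ?M (space ?M))" by (rule integral_abs_le_L2_norm[OF w])
    also have "\<dots> \<le> C * sqrt (measure ?M (space ?M))" by (intro mult_right_mono bw) simp
    finally show ?thesis using \<mu> by (simp add: A_def K_def divide_right_mono abs_divide)
  qed
  have A0: "(\<lambda>n. A n x) \<longlonglongrightarrow> 0" for x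
  proof -
    have "(\<lambda>y. indicator ?H (y - x) :: real) \<in> borel_measurable ?M"
      by (rule borel_measurable_lebesgue_on) measurable
    then have "(\<lambda>y. indicator ?H (y - x) :: real) \<in> L2 ?M" by (rule L2_bounded[where C = 1]) (simp add: indicator_def)
    then have "(\<lambda>n. \<integral>y. w n y * indicator ?H (y - x) \<partial>?M) \<longlonglongrightarrow> (\<integral>y. 0 * indicator ?H (y - x) \<partial>?M)"
      using weak[unfolded weakly_tendsto_def, THEN conjunct2] by (rule bspec[rotated])
    then have "(\<lambda>n. (\<integral>y. w n y * indicator ?H (y - x) \<partial>?M) / \<mu>) \<longlonglongrightarrow> 0 / \<mu>" using \<mu> by (intro tendsto_divide) auto
    then show ?thesis by (simp add: A_def)
  qed
  have "(\<lambda>n. \<integral>x. (A n x)\<^sup>2 \<partial>?N) \<longlonglongrightarrow> (\<integral>x. 0 \<partial>?N)"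
  proof (rule integral_dominated_convergence)
    show "integrable ?N (\<lambda>x. K\<^sup>2)" by simp
    show "AE x in ?N. (\<lambda>n. (A n x)\<^sup>2) \<longlonglongrightarrow> 0"
      using tendsto_power[OF A0, where n = 2] by (intro AE_I2) simp
    show "AE x in ?N. norm ((A n x)\<^sup>2) \<le> K\<^sup>2" for n
    proof (intro AE_I2)
      fix x
      have "\<bar>A n x\<bar>\<^sup>2 \<le> K\<^sup>2" by (rule power_mono[OF AB abs_ge_zero])
      then show "norm ((A n x)\<^sup>2) \<le> K\<^sup>2" by simp
    qed
    show "(\<lambda>x. (A n x)\<^sup>2) \<in> borel_measurable ?N" for n
      using borel_measurable_lebesgue_on[OF Am[of n], of D] by measurable
  qed simp
  from tendsto_real_sqrt[OF this] have "(\<lambda>n. L2_norm ?N (A n)) \<longlonglongrightarrow> 0" by (simp add: L2_norm_def)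
  then obtain n0 where n0: "\<And>n. n \<ge> n0 \<Longrightarrow> L2_norm ?N (A n) < \<epsilon> / 2"
    using LIMSEQ_D[of _ 0 "\<epsilon>/2"] \<epsilon> by fastforce
  have "L2_norm ?N (w n) < \<epsilon>" if "n \<ge> n0" for n
  proof -
    have "e * L2_norm ?M (g n) \<le> e * C" using e by (intro mult_left_mono bg) auto
    then show ?thesis using le[of n] n0[OF that] eC by linarith
  qed
  then show "\<exists>n0. \<forall>n\<ge>n0. norm (L2_norm ?N (w n) - 0) < \<epsilon>" by auto
qed

lemma Rellich:
  fixes \<Omega> :: "(real^3) set"
  assumes \<Omega>: "open \<Omega>" "bounded \<Omega>" "lipschitz_boundary \<Omega>"
    and w: "\<And>n::nat. w n \<in> L2 (lebesgue_on \<Omega>)" and g: "\<And>n. g n \<in> L2 (lebesgue_on \<Omega>)"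
    and wg: "\<And>n. has_weak_grad \<Omega> (w n) (g n)"
    and bw: "\<And>n. L2_norm (lebesgue_on \<Omega>) (w n) \<le> C" and bg: "\<And>n. L2_norm (lebesgue_on \<Omega>) (g n) \<le> C"
    and weak: "weakly_tendsto (lebesgue_on \<Omega>) w (\<lambda>x. 0)"
  shows "(\<lambda>n. L2_norm (lebesgue_on \<Omega>) (w n)) \<longlonglongrightarrow> 0"
proof -
  let ?M = "lebesgue_on \<Omega>"
  have \<Omega>B: "\<Omega> \<in> sets borel" using \<Omega> by simp
  have "\<exists>r>0. \<forall>e>0. \<exists>z0 \<rho>. \<rho> > 0 \<and> (\<forall>z\<in>ball z0 \<rho>. norm z \<le> e \<and>
           (\<forall>x\<in>\<Omega> \<inter> ball p r. \<forall>s. 0 \<le> s \<longrightarrow> s \<le> 1 \<longrightarrow> x + s *\<^sub>R z \<in> \<Omega>))" if "p \<in> closure \<Omega>" for p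
    using lipschitz_boundary_inward_shifts[OF \<Omega>(1,3) that] .
  then obtain r where r: "\<And>p. p \<in> closure \<Omega> \<Longrightarrow> r p > 0" and
    sh: "\<And>p e. p \<in> closure \<Omega> \<Longrightarrow> e > 0 \<Longrightarrow> \<exists>z0 \<rho>. \<rho> > 0 \<and> (\<forall>z\<in>ball z0 \<rho>. norm z \<le> e \<and>
           (\<forall>x\<in>\<Omega> \<inter> ball p (r p). \<forall>s. 0 \<le> s \<longrightarrow> s \<le> 1 \<longrightarrow> x + s *\<^sub>R z \<in> \<Omega>))" by metis
  have "compact (closure \<Omega>)" using \<Omega>(2) by (simp add: compact_closure)
  then obtain P where P: "P \<subseteq> closure \<Omega>" "finite P" "closure \<Omega> \<subseteq> (\<Union>p\<in>P. ball p (r p))"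
  proof (rule compactE_image)
    show "closure \<Omega> \<subseteq> (\<Union>p\<in>closure \<Omega>. ball p (r p))" using r by auto
  qed auto
  define D where "D p = \<Omega> \<inter> ball p (r p)" for p
  have Dop: "open (D p)" and D\<Omega>: "D p \<subseteq> \<Omega>" for p using \<Omega> by (auto simp: D_def)
  have DB: "D p \<in> sets borel" for p using Dop by simp
  have Dlim: "(\<lambda>n. L2_norm (lebesgue_on (D p)) (w n)) \<longlonglongrightarrow> 0" if "p \<in> P" for p
    by (rule Rellich_local[OF \<Omega>(1,2) w g wg bw bg weak Dop]) (use sh[of p] that P(1) in \<open>auto simp: D_def\<close>)
  have indint: "integrable ?M (\<lambda>x. indicator (D p) x * (w n x)\<^sup>2)" for p n
  proof -
    have "D p \<in> sets ?M" using D\<Omega> DB \<Omega>B by (subst sets_restrict_space_iff) auto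
    then show ?thesis using integrable_mult_indicator[of "D p" ?M "\<lambda>x. (w n x)\<^sup>2"] w[of n] by (simp add: L2_real_iff)
  qed
  have "(L2_norm ?M (w n))\<^sup>2 \<le> (\<Sum>p\<in>P. (L2_norm (lebesgue_on (D p)) (w n))\<^sup>2)" for n
  proof -
    have "(\<integral>x. (w n x)\<^sup>2 \<partial>?M) \<le> (\<integral>x. (\<Sum>p\<in>P. indicator (D p) x * (w n x)\<^sup>2) \<partial>?M)"
    proof (rule integral_mono)
      show "integrable ?M (\<lambda>x. (w n x)\<^sup>2)" using w by (simp add: L2_real_iff)
      show "integrable ?M (\<lambda>x. \<Sum>p\<in>P. indicator (D p) x * (w n x)\<^sup>2)" using indint by simp
      fix x assume "x \<in> space ?M"
      then have x: "x \<in> \<Omega>" by simp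
      then obtain p where p: "p \<in> P" "x \<in> ball p (r p)" using P(3) closure_subset by blast
      then have "(w n x)\<^sup>2 = indicator (D p) x * (w n x)\<^sup>2" using x by (simp add: D_def)
      also have "\<dots> \<le> (\<Sum>p\<in>P. indicator (D p) x * (w n x)\<^sup>2)"
        using p P(2) by (intro member_le_sum) auto
      finally show "(w n x)\<^sup>2 \<le> (\<Sum>p\<in>P. indicator (D p) x * (w n x)\<^sup>2)" .
    qed
    also have "\<dots> = (\<Sum>p\<in>P. \<integral>x. (w n x)\<^sup>2 \<partial>lebesgue_on (D p))"
      using indint L2_restrict(2)[OF w D\<Omega> DB \<Omega>B] by simp
    finally show ?thesis by (simp only: L2_norm_real_sq)
  qed
  then have "\<forall>\<^sub>F n in sequentially. norm ((L2_norm ?M (w n))\<^sup>2) \<le> (\<Sum>p\<in>P. (L2_norm (lebesgue_on (D p)) (w n))\<^sup>2)"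
    by (intro always_eventually allI) (simp only: real_norm_def abs_power2)
  moreover have "(\<lambda>n. \<Sum>p\<in>P. (L2_norm (lebesgue_on (D p)) (w n))\<^sup>2) \<longlonglongrightarrow> 0"
    using tendsto_sum[where I = P, OF tendsto_power[OF Dlim, where n = 2]] by simp
  ultimately have "(\<lambda>n. (L2_norm ?M (w n))\<^sup>2) \<longlonglongrightarrow> 0" by (rule Lim_null_comparison)
  from tendsto_real_sqrt[OF this] show ?thesis by simp
qed


section \<open>Trigonometric approximation of periodic functions\<close>

definition freq :: "int^'m \<Rightarrow> real^'m" where
  "freq k = (\<chi> i. of_int (k $ i))"

text \<open>The phases \<open>0\<close> and \<open>- pi / 2\<close> give cosine and sine. Allowing all phases makes the product of two
  waves a sum of two waves.\<close>

definition wave :: "int^'m \<Rightarrow> real \<Rightarrow> real^'m \<Rightarrow> real" where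
  "wave k c y = cos ((2 * pi) *\<^sub>R freq k \<bullet> y + c)"

lemma freq_add: "freq (k + l) = freq k + freq l" and freq_diff: "freq (k - l) = freq k - freq l"
  and freq_0: "freq 0 = 0"
  by (auto simp: freq_def vec_eq_iff)

lemma freq_eq_0_iff: "freq k = 0 \<longleftrightarrow> k = 0"
  by (auto simp: freq_def vec_eq_iff)

lemma range_freq: "range freq = int_lattice"
proof
  show "range freq \<subseteq> int_lattice" by (auto simp: freq_def int_lattice_def)
  show "int_lattice \<subseteq> range (freq :: int^'m \<Rightarrow> real^'m)"
  proof
    fix y :: "real^'m" assume "y \<in> int_lattice"
    then have "y = freq (\<chi> i. \<lfloor>y $ i\<rfloor>)"
      by (auto simp: int_lattice_def freq_def vec_eq_iff elim!: Ints_cases)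
    then show "y \<in> range freq" by blast
  qed
qed

lemma freq_inner_int: "j \<in> int_lattice \<Longrightarrow> freq k \<bullet> j \<in> \<int>"
  unfolding inner_vec_def freq_def int_lattice_def by (intro Ints_sum) (auto intro!: Ints_mult)

lemma wave_le_1 [simp]: "\<bar>wave k c y\<bar> \<le> 1"
  by (simp add: wave_def)

lemma continuous_wave [continuous_intros]: "continuous_on S (wave k c)"
  unfolding wave_def[abs_def] by (intro continuous_intros)

lemma borel_measurable_wave [measurable]: "wave k c \<in> borel_measurable borel"
  by (intro borel_measurable_continuous_onI continuous_wave)

lemma wave_mult: "wave k c y * wave l d y = (1/2) * wave (k + l) (c + d) y + (1/2) * wave (k - l) (c - d) y"
  unfolding wave_def by (subst cos_times_cos) (simp add: freq_add freq_diff algebra_simps inner_add_left inner_diff_left add_divide_distrib)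

text \<open>Trigonometric polynomials are given by lists of coefficients, frequencies and phases because
  the lists with rational entries form a countable type.\<close>

definition trig_sum :: "(real \<times> (int^'m) \<times> real) list \<Rightarrow> real^'m \<Rightarrow> real" where
  "trig_sum l y = (\<Sum>(a, k, c)\<leftarrow>l. a * wave k c y)"

lemma trig_sum_simps [simp]:
  "trig_sum [] y = 0" "trig_sum ((a, k, c) # l) y = a * wave k c y + trig_sum l y"
  "trig_sum (l @ l') y = trig_sum l y + trig_sum l' y"
  by (simp_all add: trig_sum_def)

lemma trig_sum_mult: "\<exists>l''. \<forall>y. trig_sum l y * trig_sum l' y = trig_sum l'' y"
proof (induction l)
  case Nil
  show ?case by (intro exI[of _ "[]"]) simp
next
  case (Cons t l)
  obtain a k c where t: "t = (a, k, c)" by (cases t)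
  have "\<exists>l''. \<forall>y. a * wave k c y * trig_sum l' y = trig_sum l'' y"
  proof (induction l')
    case Nil
    show ?case by (intro exI[of _ "[]"]) simp
  next
    case (Cons t' l')
    obtain b j d where t': "t' = (b, j, d)" by (cases t')
    obtain m where "\<forall>y. a * wave k c y * trig_sum l' y = trig_sum m y" using Cons by blast
    moreover have "a * wave k c y * (b * wave j d y) = (a * b) * (wave k c y * wave j d y)" for y by simp
    ultimately have "\<forall>y. a * wave k c y * trig_sum (t' # l') y = trig_sum ((a*b/2, k + j, c + d) # (a*b/2, k - j, c - d) # m) y"
      unfolding t' trig_sum_simps by (simp only: distrib_left wave_mult) (simp add: algebra_simps)
    then show ?case by blast
  qed
  then obtain m where "\<forall>y. a * wave k c y * trig_sum l' y = trig_sum m y" by blast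
  moreover obtain m' where "\<forall>y. trig_sum l y * trig_sum l' y = trig_sum m' y" using Cons by blast
  ultimately have "\<forall>y. trig_sum (t # l) y * trig_sum l' y = trig_sum (m @ m') y"
    by (simp add: t distrib_right)
  then show ?case by blast
qed

text \<open>The torus as a compact subset of a Euclidean space: polynomials in the real and imaginary parts of
  the coordinates become trigonometric polynomials.\<close>

definition circle_map :: "real^'m \<Rightarrow> complex^'m" where
  "circle_map y = (\<chi> i. cis (2 * pi * y $ i))"

lemma circle_map_eq_iff: "circle_map y = circle_map z \<longleftrightarrow> y - z \<in> int_lattice"
proof -
  have "cis (2 * pi * a) = cis (2 * pi * b) \<longleftrightarrow> a - b \<in> \<int>" for a b :: real
  proof -
    have "cis (2 * pi * a) = cis (2 * pi * b) \<longleftrightarrow> cis (2 * pi * (a - b)) = 1"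
      by (simp add: right_diff_distrib cis_divide[symmetric] nonzero_divide_eq_eq)
    also have "\<dots> \<longleftrightarrow> cos (2 * pi * (a - b)) = 1"
    proof
      assume "cos (2 * pi * (a - b)) = 1"
      moreover from this have "sin (2 * pi * (a - b)) = 0" using cos_one_sin_zero by blast
      ultimately show "cis (2 * pi * (a - b)) = 1" by (simp add: complex_eq_iff)
    qed (simp add: complex_eq_iff)
    also have "\<dots> \<longleftrightarrow> (\<exists>n::int. a - b = of_int n)"
    proof -
      have "2 * pi * (a - b) = real_of_int n * 2 * pi \<longleftrightarrow> a - b = of_int n" for n
      proof -
        have "real_of_int n * 2 * pi = 2 * pi * of_int n" by simp
        then show ?thesis by (simp only: mult_cancel_left) simp
      qed
      then show ?thesis unfolding cos_one_2pi_int by simp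
    qed
    finally show ?thesis by (auto simp: Ints_def)
  qed
  then show ?thesis by (simp add: circle_map_def vec_eq_iff int_lattice_def)
qed

lemma continuous_circle_map: "continuous_on S circle_map"
  unfolding circle_map_def by (intro continuous_intros)

lemma polynomial_circle_map_trig_sum:
  assumes "real_polynomial_function (g :: complex^'m \<Rightarrow> real)"
  shows "\<exists>l. \<forall>y. g (circle_map y) = trig_sum l y"
  using assms
proof induction
  case (linear g)
  interpret g: bounded_linear g by (rule linear)
  have "\<exists>l. \<forall>y. (\<Sum>b\<in>B. (circle_map y \<bullet> b) * g b) = trig_sum l y" if "B \<subseteq> Basis" "finite B" for B
    using that(2,1)
  proof (induction B rule: finite_induct)
    case empty
    show ?case by (intro exI[of _ "[]"]) simp
  next
    case (insert b B)
    then obtain l where l: "\<forall>y. (\<Sum>b\<in>B. (circle_map y \<bullet> b) * g b) = trig_sum l y" by auto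
    have "b \<in> Basis" using insert by simp
    then obtain i u where b: "b = axis i u" and u: "u \<in> Basis" by (auto simp: Basis_vec_def)
    have w: "wave (axis i 1) 0 y = cos (2 * pi * y $ i)" "wave (axis i 1) (- pi / 2) y = sin (2 * pi * y $ i)" for y
    proof -
      have f: "freq (axis i 1) = axis i 1" by (auto simp: freq_def axis_def vec_eq_iff)
      then show "wave (axis i 1) 0 y = cos (2 * pi * y $ i)" by (simp add: wave_def inner_axis')
      show "wave (axis i 1) (- pi / 2) y = sin (2 * pi * y $ i)"
        using f by (simp add: wave_def inner_axis' cos_diff)
    qed
    have "\<exists>c. \<forall>y. circle_map y \<bullet> b = wave (axis i 1) c y"
    proof (cases "u = 1")
      case True
      then show ?thesis using w(1) by (intro exI[of _ 0]) (simp add: b circle_map_def inner_axis)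
    next
      case False
      then have "u = \<i>" using u by (auto simp: Basis_complex_def)
      then show ?thesis using w(2) by (intro exI[of _ "- pi / 2"]) (simp add: b circle_map_def inner_axis)
    qed
    then obtain c where c: "\<forall>y. circle_map y \<bullet> b = wave (axis i 1) c y" by blast
    have "\<forall>y. (\<Sum>b\<in>insert b B. (circle_map y \<bullet> b) * g b) = trig_sum ((g b, axis i 1, c) # l) y"
      using insert(1,2) l c by simp
    then show ?case by blast
  qed
  from this[of Basis] obtain l where "\<forall>y. (\<Sum>b\<in>Basis. (circle_map y \<bullet> b) * g b) = trig_sum l y" by auto
  moreover have "g (circle_map y) = (\<Sum>b\<in>Basis. (circle_map y \<bullet> b) * g b)" for y
  proof -
    have "g (circle_map y) = g (\<Sum>b\<in>Basis. (circle_map y \<bullet> b) *\<^sub>R b)" by (simp add: euclidean_representation)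
    also have "\<dots> = (\<Sum>b\<in>Basis. (circle_map y \<bullet> b) * g b)" by (simp only: g.sum g.scaleR real_scaleR_def)
    finally show ?thesis .
  qed
  ultimately show ?case by auto
next
  case (const c)
  show ?case by (intro exI[of _ "[(c, 0, 0)]"]) (simp add: wave_def freq_0)
next
  case (add f g)
  then obtain l l' where "\<forall>y. f (circle_map y) = trig_sum l y" "\<forall>y. g (circle_map y) = trig_sum l' y" by blast
  then show ?case by (intro exI[of _ "l @ l'"]) simp
next
  case (mult f g)
  then obtain l l' where "\<forall>y. f (circle_map y) = trig_sum l y" "\<forall>y. g (circle_map y) = trig_sum l' y" by blast
  then show ?case using trig_sum_mult[of l l'] by auto
qed

lemma exists_lattice_translate: "\<exists>k\<in>int_lattice. y + k \<in> cbox 0 (1::real^'m)"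
proof (intro bexI)
  show "y + (\<chi> i. - of_int \<lfloor>y $ i\<rfloor>) \<in> cbox 0 (1::real^'m)"
    unfolding mem_box_cart
  proof
    fix i
    have "of_int \<lfloor>y $ i\<rfloor> \<le> y $ i" "y $ i \<le> of_int \<lfloor>y $ i\<rfloor> + 1" by linarith+
    then show "0 $ i \<le> (y + (\<chi> i. - of_int \<lfloor>y $ i\<rfloor>)) $ i \<and> (y + (\<chi> i. - of_int \<lfloor>y $ i\<rfloor>)) $ i \<le> (1::real^'m) $ i"
      by (simp only: vector_add_component vec_lambda_beta zero_index one_index) linarith
  qed
  show "(\<chi> i. - of_int \<lfloor>y $ i\<rfloor>) \<in> (int_lattice :: (real^'m) set)" by (simp add: int_lattice_def)
qed

text \<open>A continuous periodic function factors through a continuous function on the torus, to which the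
  Stone--Weierstrass theorem applies.\<close>

lemma trig_sum_dense:
  fixes f :: "real^'m \<Rightarrow> real"
  assumes cont: "continuous_on UNIV f" and per: "cell_periodic f" and e: "0 < e"
  shows "\<exists>l. \<forall>y. \<bar>f y - trig_sum l y\<bar> < e"
proof -
  let ?Q = "cbox 0 (1::real^'m)"
  define T where "T = circle_map ` ?Q"
  have T: "compact T" unfolding T_def by (intro compact_continuous_image continuous_circle_map compact_cbox)
  have inT: "circle_map y \<in> T" for y :: "real^'m"
  proof -
    obtain k where k: "k \<in> int_lattice" "y + k \<in> ?Q" using exists_lattice_translate by blast
    have "circle_map y = circle_map (y + k)" using k(1) by (auto simp: circle_map_eq_iff int_lattice_def)
    then show ?thesis using k(2) by (auto simp: T_def)
  qed
  \<comment> \<open>By periodicity the value does not depend on the preimage that is chosen.\<close>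
  define F where "F t = f (SOME y. circle_map y = t)" for t
  have F: "F (circle_map y) = f y" for y
  proof -
    define z where "z = (SOME z. circle_map z = circle_map y)"
    have "circle_map z = circle_map y" unfolding z_def by (rule someI_ex) auto
    then have "z - y \<in> int_lattice" by (simp add: circle_map_eq_iff)
    then have "f (y + (z - y)) = f y" using per unfolding cell_periodic_def by blast
    then show ?thesis by (simp add: F_def z_def)
  qed
  have "continuous_on T F"
    unfolding continuous_on_closed_vimage[OF compact_imp_closed[OF T]]
  proof (intro allI impI)
    fix B :: "real set" assume B: "closed B"
    have "F -` B \<inter> T = circle_map ` (?Q \<inter> f -` B)" by (auto simp: T_def F)
    moreover have "closed (f -` B)" using cont B by (simp add: continuous_on_closed_vimage)
    then have "compact (circle_map ` (?Q \<inter> f -` B))"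
      by (intro compact_continuous_image continuous_circle_map compact_Int_closed compact_cbox)
    ultimately show "closed (F -` B \<inter> T)" by (simp add: compact_imp_closed)
  qed
  then obtain g where g: "real_polynomial_function g" "\<And>t. t \<in> T \<Longrightarrow> \<bar>F t - g t\<bar> < e"
    using Stone_Weierstrass_real_polynomial_function[OF T _ e] by blast
  obtain l where "\<forall>y. g (circle_map y) = trig_sum l y" using polynomial_circle_map_trig_sum[OF g(1)] by blast
  then show ?thesis using g(2)[OF inT] F by metis
qed

definition rational_trig_sum :: "nat \<Rightarrow> real^'m \<Rightarrow> real" where
  "rational_trig_sum n = trig_sum (map (\<lambda>(a, k, c). (of_rat a, k, of_rat c)) (from_nat n :: (rat \<times> (int^'m) \<times> rat) list))"

lemma rational_trig_sum_dense_in_trig_sums: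
  assumes "0 < e"
  shows "\<exists>n. \<forall>y::real^'m. \<bar>trig_sum l y - rational_trig_sum n y\<bar> < e"
proof -
  let ?r = "map (\<lambda>(a, k, c). (of_rat a, k, of_rat c)) :: (rat \<times> (int^'m) \<times> rat) list \<Rightarrow> (real \<times> (int^'m) \<times> real) list"
  have "\<exists>q. \<forall>y. \<bar>trig_sum l y - trig_sum (?r q) y\<bar> < e"
    using assms
  proof (induction l arbitrary: e)
    case Nil
    then show ?case by (intro exI[of _ "[]"]) simp
  next
    case (Cons t l)
    obtain a k c where t: "t = (a, k, c)" by (cases t)
    obtain q where q: "\<forall>y. \<bar>trig_sum l y - trig_sum (?r q) y\<bar> < e/2" using Cons.IH[of "e/2"] Cons.prems by auto
    obtain b where b: "\<bar>a - of_rat b\<bar> < e/4"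
    proof -
      obtain b where "a - e/4 < of_rat b" "of_rat b < a + e/4"
        using of_rat_dense[of "a - e/4" "a + e/4"] Cons.prems by auto
      then have "\<bar>a - of_rat b\<bar> < e/4" unfolding abs_less_iff by linarith
      then show thesis by (rule that)
    qed
    have "0 < e / (4 * (\<bar>a\<bar> + 1))" using Cons.prems by simp
    then obtain d where "c - e / (4 * (\<bar>a\<bar> + 1)) < of_rat d" "of_rat d < c + e / (4 * (\<bar>a\<bar> + 1))"
      using of_rat_dense[of "c - e / (4 * (\<bar>a\<bar> + 1))" "c + e / (4 * (\<bar>a\<bar> + 1))"] by auto
    then have "\<bar>c - of_rat d\<bar> < e / (4 * (\<bar>a\<bar> + 1))" unfolding abs_less_iff by linarith
    then have "\<bar>c - of_rat d\<bar> * (\<bar>a\<bar> + 1) < e/4" by (simp add: field_simps)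
    moreover have "\<bar>c - of_rat d\<bar> * (\<bar>a\<bar> + 1) = \<bar>a\<bar> * \<bar>c - of_rat d\<bar> + \<bar>c - of_rat d\<bar>" by (simp add: algebra_simps)
    ultimately have d: "\<bar>a\<bar> * \<bar>c - of_rat d\<bar> < e/4" using abs_ge_zero[of "c - of_rat d"] by linarith
    have "\<bar>a * wave k c y - of_rat b * wave k (of_rat d) y\<bar> < e/2" for y
    proof -
      have "a * wave k c y - of_rat b * wave k (of_rat d) y = a * (wave k c y - wave k (of_rat d) y) + (a - of_rat b) * wave k (of_rat d) y"
        by (simp add: algebra_simps)
      moreover have "\<bar>a * (wave k c y - wave k (of_rat d) y)\<bar> \<le> \<bar>a\<bar> * \<bar>c - of_rat d\<bar>"
      proof -
        have "norm (cos x - cos z) \<le> 1 * norm (x - z)" for x z :: real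
          by (rule field_differentiable_bound[of UNIV cos "\<lambda>x. - sin x"]) (auto intro!: derivative_eq_intros)
        then have "\<bar>wave k c y - wave k (of_rat d) y\<bar> \<le> \<bar>c - of_rat d\<bar>"
          unfolding wave_def by (smt (verit) real_norm_def)
        then show ?thesis by (simp add: abs_mult mult_left_mono)
      qed
      moreover have "\<bar>(a - of_rat b) * wave k (of_rat d) y\<bar> \<le> \<bar>a - of_rat b\<bar>"
        using mult_left_mono[OF wave_le_1[of k "of_rat d" y] abs_ge_zero[of "a - of_rat b"]] by (simp add: abs_mult)
      ultimately show ?thesis using b d by linarith
    qed
    then have "\<bar>trig_sum (t # l) y - trig_sum (?r ((b, k, d) # q)) y\<bar> < e" for y
      using q[rule_format, of y] by (simp add: t) (smt (verit) field_sum_of_halves)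
    then show ?case by blast
  qed
  then obtain q where q: "\<forall>y. \<bar>trig_sum l y - trig_sum (?r q) y\<bar> < e" by blast
  then show ?thesis by (intro exI[of _ "to_nat q"]) (simp add: rational_trig_sum_def)
qed

lemma continuous_trig_sum: "continuous_on S (trig_sum l)"
proof (induction l)
  case Nil
  show ?case by (simp add: trig_sum_def[abs_def])
next
  case (Cons t l)
  obtain a k c where t: "t = (a, k, c)" by (cases t)
  have "trig_sum (t # l) = (\<lambda>y. a * wave k c y + trig_sum l y)" by (simp add: t fun_eq_iff)
  then show ?case using Cons by (auto intro!: continuous_intros)
qed

lemma trig_sum_bounded: "\<exists>C. \<forall>y. \<bar>trig_sum l y\<bar> \<le> C"
proof (induction l)
  case (Cons t l)
  obtain a k c where t: "t = (a, k, c)" by (cases t)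
  obtain C where C: "\<And>y. \<bar>trig_sum l y\<bar> \<le> C" using Cons by blast
  have "\<bar>trig_sum (t # l) y\<bar> \<le> \<bar>a\<bar> + C" for y
  proof -
    have "\<bar>a * wave k c y\<bar> \<le> \<bar>a\<bar> * 1" unfolding abs_mult by (intro mult_left_mono) auto
    then show ?thesis using C[of y] by (simp add: t)
  qed
  then show ?case by blast
qed auto

lemma rational_trig_sum_bcontfun:
  "apply_bcontfun (Bcontfun (rational_trig_sum n)) = (rational_trig_sum n :: real^'m \<Rightarrow> real)"
proof (rule Bcontfun_inverse)
  obtain C where "\<And>y :: real^'m. \<bar>rational_trig_sum n y\<bar> \<le> C" unfolding rational_trig_sum_def using trig_sum_bounded by blast
  then have "bounded (range (rational_trig_sum n :: real^'m \<Rightarrow> real))" unfolding bounded_iff by (intro exI[of _ C]) auto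
  then show "(rational_trig_sum n :: real^'m \<Rightarrow> real) \<in> bcontfun"
    by (simp add: bcontfun_def rational_trig_sum_def continuous_trig_sum)
qed

lemma rational_trig_sum_measurable [measurable]: "rational_trig_sum n \<in> borel_measurable borel"
  unfolding rational_trig_sum_def by (intro borel_measurable_continuous_onI continuous_trig_sum)


section \<open>Oscillating test functions\<close>

text \<open>For these test functions two-scale limits can be computed term by term. They are closed under
  products, so that this also covers the square that appears in the norm.\<close>

inductive_set oscillating :: "'a::euclidean_space set \<Rightarrow> ('a \<Rightarrow> real^'m \<Rightarrow> real) set" for \<Omega> where
  zero: "(\<lambda>x y. 0) \<in> oscillating \<Omega>"
| wave: "a \<in> borel_measurable (lebesgue_on \<Omega>) \<Longrightarrow> (\<And>x. x \<in> \<Omega> \<Longrightarrow> \<bar>a x\<bar> \<le> C) \<Longrightarrow>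
     (\<lambda>x y. a x * wave k c y) \<in> oscillating \<Omega>"
| add: "\<phi> \<in> oscillating \<Omega> \<Longrightarrow> \<psi> \<in> oscillating \<Omega> \<Longrightarrow> (\<lambda>x y. \<phi> x y + \<psi> x y) \<in> oscillating \<Omega>"

lemma oscillating_scale: "\<phi> \<in> oscillating \<Omega> \<Longrightarrow> (\<lambda>x y. r * \<phi> x y) \<in> oscillating \<Omega>"
proof (induction rule: oscillating.induct)
  case zero
  show ?case using oscillating.zero by simp
next
  case (wave a C k c)
  have "(\<lambda>x y. (r * a x) * wave k c y) \<in> oscillating \<Omega>"
    using wave by (intro oscillating.wave[where C = "\<bar>r\<bar> * C"]) (auto simp: abs_mult intro: mult_left_mono)
  then show ?case by (simp add: mult.assoc)
next
  case (add \<phi> \<psi>)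
  then show ?case using oscillating.add by (simp add: distrib_left)
qed

lemma oscillating_mult:
  assumes "\<phi> \<in> oscillating \<Omega>" "\<psi> \<in> oscillating \<Omega>"
  shows "(\<lambda>x y. \<phi> x y * \<psi> x y) \<in> oscillating \<Omega>"
  using assms
proof (induction arbitrary: \<psi> rule: oscillating.induct)
  case zero
  show ?case using oscillating.zero by simp
next
  case (wave a C k c)
  note a = wave(1,2)
  from wave(3) show ?case
  proof (induction rule: oscillating.induct)
    case zero
    show ?case using oscillating.zero by simp
  next
    case (wave b D l d)
    have *: "(\<lambda>x. a x * b x / 2) \<in> borel_measurable (lebesgue_on \<Omega>)"
      using wave(1) a(1) by measurable
    have **: "\<bar>a x * b x / 2\<bar> \<le> \<bar>C\<bar> * \<bar>D\<bar> / 2" if "x \<in> \<Omega>" for x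
      using mult_mono[of "\<bar>a x\<bar>" "\<bar>C\<bar>" "\<bar>b x\<bar>" "\<bar>D\<bar>"] wave(2)[OF that] a(2)[OF that]
      by (auto simp: abs_mult)
    have "(\<lambda>x y. (a x * b x / 2) * wave (k + l) (c + d) y + (a x * b x / 2) * wave (k - l) (c - d) y) \<in> oscillating \<Omega>"
      by (intro oscillating.add oscillating.wave[OF * **])
    moreover have "a x * wave k c y * (b x * wave l d y) = (a x * b x / 2) * wave (k + l) (c + d) y + (a x * b x / 2) * wave (k - l) (c - d) y" for x y
    proof -
      have "a x * wave k c y * (b x * wave l d y) = (a x * b x) * (wave k c y * wave l d y)" by simp
      then show ?thesis unfolding wave_mult by (simp add: algebra_simps)
    qed
    ultimately show ?case by simp
  next
    case (add \<phi> \<psi>)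
    then show ?case using oscillating.add by (simp add: distrib_left)
  qed
next
  case (add \<phi> \<theta>)
  then show ?case using oscillating.add[of "\<lambda>x y. \<phi> x y * \<psi> x y" \<Omega> "\<lambda>x y. \<theta> x y * \<psi> x y"] by (simp add: distrib_right)
qed

lemma oscillating_trig_sum:
  assumes "A \<in> sets (lebesgue_on \<Omega>)"
  shows "(\<lambda>x y. indicator A x * trig_sum l y) \<in> oscillating \<Omega>"
proof (induction l)
  case Nil
  show ?case using oscillating.zero by simp
next
  case (Cons t l)
  obtain a k c where t: "t = (a, k, c)" by (cases t)
  have "(\<lambda>x y. (indicator A x * a) * wave k c y) \<in> oscillating \<Omega>"
    using assms by (intro oscillating.wave[where C = "\<bar>a\<bar>"]) (auto simp: indicator_def)
  from oscillating.add[OF this Cons] show ?case by (simp add: t distrib_left mult.assoc)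
qed

lemma oscillating_sum:
  "finite I \<Longrightarrow> (\<And>i. i \<in> I \<Longrightarrow> \<phi> i \<in> oscillating \<Omega>) \<Longrightarrow> (\<lambda>x y. \<Sum>i\<in>I. \<phi> i x y) \<in> oscillating \<Omega>"
  by (induction I rule: finite_induct) (auto intro: oscillating.zero oscillating.add)

lemma oscillating_bounded:
  assumes "\<phi> \<in> oscillating \<Omega>"
  shows "\<exists>C. \<forall>x\<in>\<Omega>. \<forall>y. \<bar>\<phi> x y\<bar> \<le> C"
  using assms
proof (induction rule: oscillating.induct)
  case (wave a C k c)
  have "\<bar>a x * wave k c y\<bar> \<le> C" if "x \<in> \<Omega>" for x y
  proof -
    have "\<bar>a x\<bar> * \<bar>wave k c y\<bar> \<le> \<bar>a x\<bar> * 1" by (intro mult_left_mono) auto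
    then show ?thesis using wave(2)[OF that] by (simp add: abs_mult)
  qed
  then show ?case by blast
next
  case (add \<phi> \<psi>)
  then obtain C D where "\<And>x y. x \<in> \<Omega> \<Longrightarrow> \<bar>\<phi> x y\<bar> \<le> C" "\<And>x y. x \<in> \<Omega> \<Longrightarrow> \<bar>\<psi> x y\<bar> \<le> D" by blast
  then have "\<bar>\<phi> x y + \<psi> x y\<bar> \<le> C + D" if "x \<in> \<Omega>" for x y
    using that by (intro order_trans[OF abs_triangle_ineq] add_mono)
  then show ?case by blast
qed auto

lemma oscillating_measurable:
  assumes "\<phi> \<in> oscillating \<Omega>"
  shows "case_prod \<phi> \<in> borel_measurable (lebesgue_on \<Omega> \<Otimes>\<^sub>M borel)"
  using assms
proof (induction rule: oscillating.induct)
  case (wave a C k c)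
  note [measurable] = wave(1)
  show ?case by measurable
next
  case (add \<phi> \<psi>)
  note [measurable] = add(3,4)
  have "(\<lambda>z. case_prod \<phi> z + case_prod \<psi> z) \<in> borel_measurable (lebesgue_on \<Omega> \<Otimes>\<^sub>M borel)" by measurable
  then show ?case by (simp add: case_prod_beta')
qed auto

text \<open>Taking the first admissible index makes the choice measurable in \<open>x\<close>, since balls are Borel sets in
  the space of bounded continuous functions.\<close>

definition approx_index :: "(real^3 \<Rightarrow> ((real^'m) \<Rightarrow>\<^sub>C real)) \<Rightarrow> real \<Rightarrow> real^3 \<Rightarrow> nat" where
  "approx_index \<phi> e x = (LEAST n. \<phi> x \<in> ball (Bcontfun (rational_trig_sum n)) e)"

lemma approx_index_measurable [measurable]:
  assumes "\<phi> \<in> L2_C_per \<Omega>"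
  shows "approx_index \<phi> e \<in> measurable (lebesgue_on \<Omega>) (count_space UNIV)"
proof -
  have [measurable]: "\<phi> \<in> borel_measurable (lebesgue_on \<Omega>)" using assms by (simp add: L2_C_per_def)
  have [measurable]: "ball (Bcontfun (rational_trig_sum n)) e \<in> sets borel" for n :: nat by simp
  show ?thesis unfolding approx_index_def[abs_def] by measurable
qed

lemma approx_index:
  assumes \<phi>: "\<phi> \<in> L2_C_per \<Omega>" and e: "0 < e" and x: "x \<in> \<Omega>"
  shows "\<bar>\<phi> x y - rational_trig_sum (approx_index \<phi> e x) y\<bar> < e"
proof -
  let ?d = "\<lambda>n. Bcontfun (rational_trig_sum n)"
  have per: "cell_periodic (\<phi> x)" using \<phi> x by (simp add: L2_C_per_def)
  obtain l where l: "\<And>y. \<bar>\<phi> x y - trig_sum l y\<bar> < e/4"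
    using trig_sum_dense[OF continuous_on_apply_bcontfun per, of "e/4"] e by auto
  obtain n where n: "\<And>y. \<bar>trig_sum l y - rational_trig_sum n y\<bar> < e/4"
    using rational_trig_sum_dense_in_trig_sums[of "e/4" l] e by auto
  have "dist (?d n) (\<phi> x) \<le> e/2"
  proof (rule dist_bound)
    fix y show "dist (?d n y) (\<phi> x y) \<le> e/2"
      using l[of y] n[of y] e unfolding rational_trig_sum_bcontfun dist_real_def by linarith
  qed
  then have "\<phi> x \<in> ball (?d n) e" using e by simp
  then have "\<phi> x \<in> ball (?d (approx_index \<phi> e x)) e" unfolding approx_index_def by (rule LeastI)
  then have "dist (?d (approx_index \<phi> e x) y) (\<phi> x y) < e"
    using dist_bounded[of "?d (approx_index \<phi> e x)" y "\<phi> x"] by simp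
  then show ?thesis by (simp add: rational_trig_sum_bcontfun dist_real_def abs_minus_commute)
qed

text \<open>Replacing \<open>\<phi> x\<close> by its first approximant gives a function that is jointly measurable, as it takes
  only countably many values in \<open>x\<close>; these functions converge uniformly.\<close>

lemma L2_C_per_measurable:
  fixes \<phi> :: "real^3 \<Rightarrow> ((real^'m) \<Rightarrow>\<^sub>C real)"
  assumes \<phi>: "\<phi> \<in> L2_C_per \<Omega>"
  shows "(\<lambda>(x, y). \<phi> x y) \<in> borel_measurable (lebesgue_on \<Omega> \<Otimes>\<^sub>M borel)"
proof (rule borel_measurable_LIMSEQ_real)
  let ?e = "\<lambda>j. inverse (real (Suc j))"
  note [measurable] = approx_index_measurable[OF \<phi>]
  show "(\<lambda>z. rational_trig_sum (approx_index \<phi> (?e j) (fst z)) (snd z)) \<in> borel_measurable (lebesgue_on \<Omega> \<Otimes>\<^sub>M borel)" for j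
    by (rule measurable_compose_countable[where f = "\<lambda>i z. rational_trig_sum i (snd z)"]) measurable
  fix z assume "z \<in> space (lebesgue_on \<Omega> \<Otimes>\<^sub>M (borel :: (real^'m) measure))"
  then obtain x y where z: "z = (x, y)" "x \<in> \<Omega>" by (auto simp: space_pair_measure)
  have "(\<lambda>j. \<phi> x y - rational_trig_sum (approx_index \<phi> (?e j) x) y) \<longlonglongrightarrow> 0"
  proof (rule Lim_null_comparison[OF _ LIMSEQ_inverse_real_of_nat])
    show "\<forall>\<^sub>F j in sequentially. norm (\<phi> x y - rational_trig_sum (approx_index \<phi> (?e j) x) y) \<le> ?e j"
      using approx_index[OF \<phi> _ z(2)] by (intro always_eventually allI) (simp add: less_imp_le)
  qed
  from tendsto_diff[OF tendsto_const[of "\<phi> x y"] this]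
  show "(\<lambda>j. rational_trig_sum (approx_index \<phi> (?e j) (fst z)) (snd z)) \<longlonglongrightarrow> (case z of (x, y) \<Rightarrow> \<phi> x y)"
    by (simp add: z)
qed

lemma L2_C_per_norm:
  assumes \<phi>: "\<phi> \<in> L2_C_per \<Omega>"
  shows "(\<lambda>x. norm (\<phi> x)) \<in> L2 (lebesgue_on \<Omega>)"
proof -
  have "\<phi> \<in> borel_measurable (lebesgue_on \<Omega>)" using \<phi> by (simp add: L2_C_per_def)
  moreover have "norm \<in> borel_measurable borel" by (intro borel_measurable_continuous_onI continuous_intros)
  ultimately have "(\<lambda>x. norm (\<phi> x)) \<in> borel_measurable (lebesgue_on \<Omega>)" by (rule measurable_compose)
  then show ?thesis using \<phi> by (simp add: L2_real_iff L2_C_per_def)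
qed

text \<open>\<open>\<phi> x\<close> is replaced by its first approximant within \<open>d\<close>, and by \<open>0\<close> where the index of this
  approximant exceeds \<open>N\<close>. The error is at most \<open>d\<close> plus the norm of \<open>\<phi> x\<close> on the set where the index
  is large, which shrinks to the empty set. The bound \<open>m\<close> does not involve \<open>y\<close> and hence persists when
  \<open>y\<close> is replaced by \<open>R x / \<eta>\<close>.\<close>

lemma oscillating_dense:
  fixes \<phi> :: "real^3 \<Rightarrow> ((real^'m) \<Rightarrow>\<^sub>C real)"
  assumes \<Omega>: "open \<Omega>" "bounded \<Omega>" and \<phi>: "\<phi> \<in> L2_C_per \<Omega>" and e: "0 < e"
  obtains \<psi> m where "\<psi> \<in> oscillating \<Omega>" "m \<in> L2 (lebesgue_on \<Omega>)" "L2_norm (lebesgue_on \<Omega>) m < e"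
    "\<And>x y. x \<in> \<Omega> \<Longrightarrow> \<bar>\<phi> x y - \<psi> x y\<bar> \<le> m x"
proof -
  let ?M = "lebesgue_on \<Omega>"
  interpret finite_measure ?M using \<Omega> by (rule finite_measure_bounded_open)
  define \<mu> where "\<mu> = sqrt (measure ?M (space ?M))"
  have \<mu>: "0 \<le> \<mu>" by (simp add: \<mu>_def)
  \<comment> \<open>The constant error \<open>d\<close> has the norm \<open>d * \<mu> < e / 2\<close>.\<close>
  define d where "d = e / (2 * (\<mu> + 1))"
  have d: "0 < d" using e \<mu> by (simp add: d_def)
  have "d * (\<mu> + 1) = e / 2" using \<mu> by (simp add: d_def field_simps)
  then have d\<mu>: "d * \<mu> < e / 2" using d unfolding distrib_left by linarith
  define I where "I = approx_index \<phi> d"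
  have [measurable]: "I \<in> measurable ?M (count_space UNIV)" unfolding I_def by (rule approx_index_measurable[OF \<phi>])
  note nL = L2_C_per_norm[OF \<phi>]
  note [measurable] = L2_measurable[OF nL]
  define t where "t N x = norm (\<phi> x) * indicator {x\<in>\<Omega>. N < I x} x" for N x
  have Am: "{x\<in>\<Omega>. N < I x} \<in> sets ?M" "{x\<in>\<Omega>. I x = N} \<in> sets ?M" for N
  proof -
    have "{x\<in>space ?M. N < I x} \<in> sets ?M" by measurable
    then show "{x\<in>\<Omega>. N < I x} \<in> sets ?M" by simp
    have "{x\<in>space ?M. I x = N} \<in> sets ?M" by measurable
    then show "{x\<in>\<Omega>. I x = N} \<in> sets ?M" by simp
  qed
  have tm: "t N \<in> borel_measurable ?M" for N unfolding t_def[abs_def] using Am(1)[of N] by measurable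
  have tL: "t N \<in> L2 ?M" for N
    by (rule L2_bound(1)[OF nL tm]) (auto simp: t_def indicator_def)
  have "(\<lambda>N. \<integral>x. (t N x)\<^sup>2 \<partial>?M) \<longlonglongrightarrow> (\<integral>x. 0 \<partial>?M)"
  proof (rule integral_dominated_convergence)
    show "integrable ?M (\<lambda>x. (norm (\<phi> x))\<^sup>2)" using nL by (simp add: L2_real_iff)
    show "AE x in ?M. (\<lambda>N. (t N x)\<^sup>2) \<longlonglongrightarrow> 0"
    proof (intro AE_I2)
      fix x
      have "\<forall>\<^sub>F N in sequentially. 0 = (t N x)\<^sup>2"
        using eventually_ge_at_top[of "I x"] by eventually_elim (simp add: t_def)
      then show "(\<lambda>N. (t N x)\<^sup>2) \<longlonglongrightarrow> 0" by (rule Lim_transform_eventually[OF tendsto_const])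
    qed
    show "AE x in ?M. norm ((t N x)\<^sup>2) \<le> (norm (\<phi> x))\<^sup>2" for N
      by (intro AE_I2) (simp add: t_def indicator_def)
    show "(\<lambda>x. (t N x)\<^sup>2) \<in> borel_measurable ?M" for N using tm[of N] by measurable
  qed simp
  from tendsto_real_sqrt[OF this] have "(\<lambda>N. L2_norm ?M (t N)) \<longlonglongrightarrow> 0" by (simp add: L2_norm_def)
  then obtain N where N: "L2_norm ?M (t N) < e/2" using LIMSEQ_D[of _ 0 "e/2"] e by fastforce
  define m where "m x = d + t N x" for x
  define \<psi> where "\<psi> x y = (\<Sum>i\<le>N. indicator {x\<in>\<Omega>. I x = i} x * rational_trig_sum i y)" for x :: "real^3" and y :: "real^'m"
  show thesis
  proof
    show "\<psi> \<in> oscillating \<Omega>"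
      unfolding \<psi>_def[abs_def] rational_trig_sum_def using Am(2) by (intro oscillating_sum oscillating_trig_sum) auto
    have dL: "(\<lambda>x. d * 1) \<in> L2 ?M" by (intro L2_scale) (simp add: L2_real_iff)
    then show "m \<in> L2 ?M" unfolding m_def[abs_def] using L2_add[OF dL tL] by simp
    have "L2_norm ?M m \<le> L2_norm ?M (\<lambda>x. d * 1) + L2_norm ?M (t N)"
      unfolding m_def[abs_def] using L2_norm_triangle[OF dL tL] by simp
    also have "L2_norm ?M (\<lambda>x. d * 1) = d * \<mu>"
      using d by (simp add: L2_norm_def \<mu>_def real_sqrt_mult)
    finally show "L2_norm ?M m < e" using N d\<mu> by linarith
    fix x y assume x: "x \<in> \<Omega>"
    have close: "\<bar>\<phi> x y - rational_trig_sum (I x) y\<bar> < d" unfolding I_def by (rule approx_index[OF \<phi> d x])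
    show "\<bar>\<phi> x y - \<psi> x y\<bar> \<le> m x"
    proof (cases "I x \<le> N")
      case True
      have "\<psi> x y = (\<Sum>i\<le>N. if i = I x then rational_trig_sum i y else 0)"
        unfolding \<psi>_def using x by (intro sum.cong) (auto simp: indicator_def)
      also have "\<dots> = rational_trig_sum (I x) y" using True by (simp add: sum.delta)
      finally show ?thesis using close True by (simp add: m_def t_def)
    next
      case False
      then have "\<psi> x y = 0" unfolding \<psi>_def by (intro sum.neutral) (auto simp: indicator_def)
      then show ?thesis using False x norm_bounded[of "\<phi> x" y] d by (simp add: m_def t_def)
    qed
  qed
qed


section \<open>Lebesgue measure on products\<close>

text \<open>A Lebesgue set is a Borel set together with a part of a Borel null set, and the product of a null
  set with the whole space is again a null set.\<close>

lemma lebesgue_Times: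
  fixes S :: "'a::euclidean_space set" and T :: "'b::euclidean_space set"
  assumes S: "S \<in> sets lebesgue" and T: "T \<in> sets lebesgue"
  shows "S \<times> T \<in> sets lebesgue"
    and "emeasure lebesgue (S \<times> T) = emeasure lebesgue S * emeasure lebesgue T"
proof -
  obtain A N N' where A: "S = A \<union> N" "N \<subseteq> N'" "N' \<in> null_sets lborel" "A \<in> sets lborel"
    using S by (rule sets_completionE)
  obtain B P P' where B: "T = B \<union> P" "P \<subseteq> P'" "P' \<in> null_sets lborel" "B \<in> sets lborel"
    using T by (rule sets_completionE)
  have times: "X \<times> Z \<in> sets lborel" "emeasure lborel (X \<times> Z) = emeasure lborel X * emeasure lborel Z"
    if "X \<in> sets lborel" "Z \<in> sets lborel" for X :: "'a set" and Z :: "'b set"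
  proof -
    have "X \<times> Z \<in> sets (lborel \<Otimes>\<^sub>M lborel)" using that by (rule pair_measureI)
    then show "X \<times> Z \<in> sets lborel" by (simp only: lborel_prod)
    have "emeasure (lborel \<Otimes>\<^sub>M lborel) (X \<times> Z) = emeasure lborel X * emeasure lborel Z"
      using that by (rule lborel.emeasure_pair_measure_Times)
    then show "emeasure lborel (X \<times> Z) = emeasure lborel X * emeasure lborel Z" by (simp only: lborel_prod)
  qed
  let ?Z = "N' \<times> UNIV \<union> UNIV \<times> P'"
  have "N' \<times> (UNIV :: 'b set) \<in> null_sets lborel" "(UNIV :: 'a set) \<times> P' \<in> null_sets lborel"
    using A(3) B(3) times[of N' UNIV] times[of UNIV P'] by (auto intro!: null_setsI simp: null_sets_def)
  then have Z: "?Z \<in> null_sets lborel" by (rule null_sets.Un)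
  have eq: "S \<times> T = A \<times> B \<union> (S \<times> T - A \<times> B)" using A(1) B(1) by auto
  have sub: "S \<times> T - A \<times> B \<subseteq> ?Z" using A(1,2) B(1,2) by auto
  show "S \<times> T \<in> sets lebesgue"
    by (rule sets_completionI[OF eq sub Z times(1)[OF A(4) B(4)]])
  have n: "S \<times> T - A \<times> B \<in> null_sets lebesgue" using sub null_sets_completionI[OF Z] by (rule null_sets_completion_subset)
  have m: "emeasure lebesgue X = emeasure lborel X" if "X \<in> sets lborel" for X :: "'c::euclidean_space set"
    using that by simp
  have NS: "N \<in> null_sets lebesgue" "P \<in> null_sets lebesgue"
    using null_sets_completion_subset[OF A(2) null_sets_completionI[OF A(3)]]
      null_sets_completion_subset[OF B(2) null_sets_completionI[OF B(3)]] .
  have "emeasure lebesgue (S \<times> T) = emeasure lebesgue (A \<times> B \<union> (S \<times> T - A \<times> B))" using eq by simp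
  also have "\<dots> = emeasure lebesgue (A \<times> B)" using n times(1)[OF A(4) B(4)] by (intro emeasure_Un_null_set) auto
  also have "\<dots> = emeasure lebesgue A * emeasure lebesgue B"
    using times[OF A(4) B(4)] A(4) B(4) by (simp only: m)
  also have "emeasure lebesgue A = emeasure lebesgue S"
    unfolding A(1) using NS(1) A(4) by (intro emeasure_Un_null_set[symmetric]) auto
  also have "emeasure lebesgue B = emeasure lebesgue T"
    unfolding B(1) using NS(2) B(4) by (intro emeasure_Un_null_set[symmetric]) auto
  finally show "emeasure lebesgue (S \<times> T) = emeasure lebesgue S * emeasure lebesgue T" .
qed

lemma lebesgue_on_pair_measurable_ident:
  fixes A :: "'a::euclidean_space set" and B :: "'b::euclidean_space set"
  assumes "A \<in> sets lebesgue" "B \<in> sets lebesgue"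
  shows "(\<lambda>z. z) \<in> measurable (lebesgue_on (A \<times> B)) (lebesgue_on A \<Otimes>\<^sub>M lebesgue_on B)"
proof -
  have AB: "A \<times> B \<in> sets lebesgue" using assms by (rule lebesgue_Times)
  have "fst \<in> measurable (lebesgue_on (A \<times> B)) (lebesgue_on A)"
  proof (rule measurableI)
    fix S assume S: "S \<in> sets (lebesgue_on A)"
    then have "S \<in> sets lebesgue" "S \<subseteq> A" using assms by (auto simp: sets_restrict_space_iff)
    moreover have "fst -` S \<inter> space (lebesgue_on (A \<times> B)) = S \<times> B" using \<open>S \<subseteq> A\<close> by auto
    ultimately show "fst -` S \<inter> space (lebesgue_on (A \<times> B)) \<in> sets (lebesgue_on (A \<times> B))"
      using assms AB lebesgue_Times(1) by (auto simp: sets_restrict_space_iff)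
  qed auto
  moreover have "snd \<in> measurable (lebesgue_on (A \<times> B)) (lebesgue_on B)"
  proof (rule measurableI)
    fix S assume S: "S \<in> sets (lebesgue_on B)"
    then have "S \<in> sets lebesgue" "S \<subseteq> B" using assms by (auto simp: sets_restrict_space_iff)
    moreover have "snd -` S \<inter> space (lebesgue_on (A \<times> B)) = A \<times> S" using \<open>S \<subseteq> B\<close> by auto
    ultimately show "snd -` S \<inter> space (lebesgue_on (A \<times> B)) \<in> sets (lebesgue_on (A \<times> B))"
      using assms AB lebesgue_Times(1) by (auto simp: sets_restrict_space_iff)
  qed auto
  ultimately have "(\<lambda>z. (fst z, snd z)) \<in> measurable (lebesgue_on (A \<times> B)) (lebesgue_on A \<Otimes>\<^sub>M lebesgue_on B)"
    by (rule measurable_Pair)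
  then show ?thesis by simp
qed

text \<open>The product of two completed measures has fewer measurable sets than the completed product. The two
  measures are compared along the identity map, and Fubini's theorem becomes available for functions
  that are measurable with respect to the smaller \<open>\<sigma>\<close>-algebra.\<close>

lemma lebesgue_on_Times_distr:
  fixes A :: "'a::euclidean_space set" and B :: "'b::euclidean_space set"
  assumes A: "A \<in> sets lebesgue" "finite_measure (lebesgue_on A)" and B: "B \<in> sets lebesgue" "finite_measure (lebesgue_on B)"
  shows "lebesgue_on A \<Otimes>\<^sub>M lebesgue_on B = distr (lebesgue_on (A \<times> B)) (lebesgue_on A \<Otimes>\<^sub>M lebesgue_on B) (\<lambda>z. z)"
proof (rule pair_measure_eqI)
  interpret A: finite_measure "lebesgue_on A" by fact
  interpret B: finite_measure "lebesgue_on B" by fact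
  show "sigma_finite_measure (lebesgue_on A)" "sigma_finite_measure (lebesgue_on B)" by unfold_locales
  show "sets (lebesgue_on A \<Otimes>\<^sub>M lebesgue_on B) = sets (distr (lebesgue_on (A \<times> B)) (lebesgue_on A \<Otimes>\<^sub>M lebesgue_on B) (\<lambda>z. z))" by simp
  fix S T assume S: "S \<in> sets (lebesgue_on A)" and T: "T \<in> sets (lebesgue_on B)"
  then have ST: "S \<in> sets lebesgue" "S \<subseteq> A" "T \<in> sets lebesgue" "T \<subseteq> B"
    using A B by (auto simp: sets_restrict_space_iff)
  have "emeasure (distr (lebesgue_on (A \<times> B)) (lebesgue_on A \<Otimes>\<^sub>M lebesgue_on B) (\<lambda>z. z)) (S \<times> T)
      = emeasure (lebesgue_on (A \<times> B)) (S \<times> T)"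
    using ST S T by (subst emeasure_distr[OF lebesgue_on_pair_measurable_ident[OF A(1) B(1)]])
      (auto intro!: arg_cong[where f = "emeasure _"])
  also have "\<dots> = emeasure lebesgue (S \<times> T)"
    using ST lebesgue_Times(1)[OF A(1) B(1)] by (intro emeasure_restrict_space) auto
  also have "\<dots> = emeasure lebesgue S * emeasure lebesgue T" using ST by (intro lebesgue_Times)
  also have "emeasure lebesgue S = emeasure (lebesgue_on A) S" using ST A by (intro emeasure_restrict_space[symmetric]) auto
  also have "emeasure lebesgue T = emeasure (lebesgue_on B) T" using ST B by (intro emeasure_restrict_space[symmetric]) auto
  finally show "emeasure (lebesgue_on A) S * emeasure (lebesgue_on B) T =
     emeasure (distr (lebesgue_on (A \<times> B)) (lebesgue_on A \<Otimes>\<^sub>M lebesgue_on B) (\<lambda>z. z)) (S \<times> T)" by simp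
qed

lemma lebesgue_on_Times_integral:
  fixes A :: "'a::euclidean_space set" and B :: "'b::euclidean_space set" and f :: "'a \<times> 'b \<Rightarrow> real"
  assumes A: "A \<in> sets lebesgue" "finite_measure (lebesgue_on A)" and B: "B \<in> sets lebesgue" "finite_measure (lebesgue_on B)"
    and f: "f \<in> borel_measurable (lebesgue_on A \<Otimes>\<^sub>M lebesgue_on B)"
  shows "f \<in> borel_measurable (lebesgue_on (A \<times> B))"
    and "(\<integral>z. f z \<partial>lebesgue_on (A \<times> B)) = (\<integral>z. f z \<partial>(lebesgue_on A \<Otimes>\<^sub>M lebesgue_on B))"
    and "integrable (lebesgue_on (A \<times> B)) f \<longleftrightarrow> integrable (lebesgue_on A \<Otimes>\<^sub>M lebesgue_on B) f"
proof -
  note id = lebesgue_on_pair_measurable_ident[OF A(1) B(1)]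
  show "f \<in> borel_measurable (lebesgue_on (A \<times> B))" using measurable_compose[OF id f] .
  show "(\<integral>z. f z \<partial>lebesgue_on (A \<times> B)) = (\<integral>z. f z \<partial>(lebesgue_on A \<Otimes>\<^sub>M lebesgue_on B))"
    unfolding integral_distr[OF id f, symmetric]
    by (rule arg_cong[OF lebesgue_on_Times_distr[OF A B, symmetric], where f = "\<lambda>M. integral\<^sup>L M f"])
  show "integrable (lebesgue_on (A \<times> B)) f \<longleftrightarrow> integrable (lebesgue_on A \<Otimes>\<^sub>M lebesgue_on B) f"
    unfolding integrable_distr_eq[OF id f, symmetric]
    by (rule arg_cong[OF lebesgue_on_Times_distr[OF A B, symmetric], where f = "\<lambda>M. integrable M f"])
qed

lemma lebesgue_on_Times_L2:
  fixes A :: "'a::euclidean_space set" and B :: "'b::euclidean_space set" and f :: "'a \<times> 'b \<Rightarrow> real"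
  assumes A: "A \<in> sets lebesgue" "finite_measure (lebesgue_on A)" and B: "B \<in> sets lebesgue" "finite_measure (lebesgue_on B)"
    and f: "f \<in> L2 (lebesgue_on A \<Otimes>\<^sub>M lebesgue_on B)"
  shows "f \<in> L2 (lebesgue_on (A \<times> B))"
proof -
  have "(\<lambda>z. (f z)\<^sup>2) \<in> borel_measurable (lebesgue_on A \<Otimes>\<^sub>M lebesgue_on B)"
    using L2_measurable[OF f] by measurable
  from lebesgue_on_Times_integral(3)[OF A B this] lebesgue_on_Times_integral(1)[OF A B L2_measurable[OF f]]
  show ?thesis using f by (simp add: L2_real_iff)
qed


section \<open>Waves on the unit cell\<close>

lemma unit_cell_box: "unit_cell = box 0 (1::real^'m)"
  by (auto simp: unit_cell_def mem_box_cart)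

lemma one_inner_Basis: "b \<in> Basis \<Longrightarrow> (1::real^'m) \<bullet> b = 1"
  by (auto simp: Basis_vec_def inner_axis)

lemma unit_cell_facts:
  shows "open (unit_cell :: (real^'m) set)" "bounded (unit_cell :: (real^'m) set)"
    and "measure (lebesgue_on (unit_cell :: (real^'m) set)) unit_cell = 1"
proof -
  show "open (unit_cell :: (real^'m) set)" "bounded (unit_cell :: (real^'m) set)"
    by (auto simp: unit_cell_box open_box)
  have "measure (lebesgue_on (unit_cell :: (real^'m) set)) unit_cell = measure lborel (box 0 (1::real^'m))"
    unfolding unit_cell_box by (subst measure_restrict_space) auto
  also have "\<dots> = 1" by (simp add: measure_lborel_box_eq one_inner_Basis)
  finally show "measure (lebesgue_on (unit_cell :: (real^'m) set)) unit_cell = 1" .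
qed

lemma exponential_integral_unit_interval:
  fixes n :: int
  assumes "n \<noteq> 0"
  shows "(\<integral>t. indicator {0<..<1::real} t *\<^sub>R exp (2 * of_real pi * \<i> * of_int n * of_real t) \<partial>lborel) = (0::complex)"
proof -
  let ?a = "2 * of_real pi * \<i> * of_int n :: complex"
  have a: "?a \<noteq> 0" using assms by simp
  have "(\<integral>t. indicator {0<..<1::real} t *\<^sub>R exp (?a * of_real t) \<partial>lborel) = (\<integral>t. indicator {0..1::real} t *\<^sub>R exp (?a * of_real t) \<partial>lborel)"
  proof (rule integral_cong_AE)
    have "AE t in lborel. t \<noteq> (0::real)" "AE t in lborel. t \<noteq> (1::real)" by (rule AE_lborel_singleton)+
    then show "AE t in lborel. indicator {0<..<1::real} t *\<^sub>R exp (?a * of_real t) = indicator {0..1::real} t *\<^sub>R exp (?a * of_real t)"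
      by eventually_elim (auto simp: indicator_def)
  qed measurable
  also have "\<dots> = exp (?a * of_real 1) / ?a - exp (?a * of_real 0) / ?a"
  proof (rule integral_FTC_Icc)
    fix t :: real
    have "((\<lambda>z. exp (?a * z) / ?a) has_field_derivative exp (?a * of_real t)) (at (of_real t))"
      using a by (auto intro!: derivative_eq_intros)
    then have "((\<lambda>t. exp (?a * of_real t) / ?a) has_vector_derivative exp (?a * of_real t)) (at t)"
      by (rule has_vector_derivative_real_field)
    then show "((\<lambda>t. exp (?a * of_real t) / ?a) has_vector_derivative exp (?a * of_real t)) (at t within {0..1})"
      by (rule has_vector_derivative_at_within)
  qed (auto intro!: continuous_intros)
  also have "\<dots> = 0" using exp_integer_2pi[of "of_int n"] by (simp add: mult.commute mult.left_commute)
  finally show ?thesis by simp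
qed

text \<open>The integral is the product of the integrals over the coordinates, and a coordinate with
  \<open>k $ i \<noteq> 0\<close> contributes the factor \<open>0\<close>.\<close>

lemma exponential_integral_unit_cell:
  assumes "k \<noteq> (0 :: int^'m)"
  shows "(\<integral>y. indicator unit_cell y *\<^sub>R exp (2 * of_real pi * \<i> * of_real (freq k \<bullet> y)) \<partial>lborel) = (0::complex)"
proof -
  interpret product_sigma_finite "\<lambda>b::real^'m. (lborel :: real measure)" by standard
  define g where "g b t = indicator {0<..<1::real} t *\<^sub>R exp (2 * of_real pi * \<i> * of_real (freq k \<bullet> b) * of_real t :: complex)" for b :: "real^'m" and t
  let ?F = "\<lambda>y::real^'m. indicator unit_cell y *\<^sub>R exp (2 * of_real pi * \<i> * of_real (freq k \<bullet> y) :: complex)"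
  have F: "?F (\<Sum>b\<in>Basis. f b *\<^sub>R b) = (\<Prod>b\<in>Basis. g b (f b))" for f
  proof -
    have inn: "(\<Sum>b\<in>Basis. f b *\<^sub>R b) \<bullet> c = f c" if "c \<in> Basis" for c :: "real^'m"
      using that by (simp add: inner_sum_left inner_Basis if_distrib sum.delta cong: if_cong)
    have "indicator unit_cell (\<Sum>b\<in>Basis. f b *\<^sub>R b) = (\<Prod>b\<in>Basis. indicator {0<..<1::real} (f b) :: real)"
    proof (cases "\<forall>b\<in>Basis. 0 < f b \<and> f b < 1")
      case True
      then have "(\<Sum>b\<in>Basis. f b *\<^sub>R b) \<in> (unit_cell :: (real^'m) set)"
        unfolding unit_cell_box mem_box by (simp add: inn one_inner_Basis)
      with True show ?thesis by simp
    next
      case False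
      then obtain b where b: "b \<in> Basis" "\<not> (0 < f b \<and> f b < 1)" by blast
      then have "(\<Sum>b\<in>Basis. f b *\<^sub>R b) \<notin> (unit_cell :: (real^'m) set)"
        unfolding unit_cell_box mem_box using inn[OF b(1)] one_inner_Basis[OF b(1)] b by fastforce
      moreover have "(\<Prod>b\<in>Basis. indicator {0<..<1::real} (f b) :: real) = 0"
        using b by (intro prod_zero bexI[OF _ b(1)]) auto
      ultimately show ?thesis by simp
    qed
    moreover have "exp (2 * of_real pi * \<i> * of_real (freq k \<bullet> (\<Sum>b\<in>Basis. f b *\<^sub>R b)) :: complex) =
       (\<Prod>b\<in>Basis. exp (2 * of_real pi * \<i> * of_real (freq k \<bullet> b) * of_real (f b)))"
      by (simp add: exp_sum[symmetric] inner_sum_right sum_distrib_left mult.assoc mult.commute mult.left_commute)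
    ultimately show ?thesis unfolding g_def scaleR_conv_of_real by (simp add: prod.distrib)
  qed
  have gint: "integrable lborel (g b)" for b
  proof -
    have "integrable lborel (\<lambda>t. indicator {0..1::real} t *\<^sub>R exp (2 * of_real pi * \<i> * of_real (freq k \<bullet> b) * of_real t :: complex))"
      unfolding set_integrable_def[symmetric]
      by (rule borel_integrable_atLeastAtMost') (auto intro!: continuous_intros)
    then show ?thesis
    proof (rule Bochner_Integration.integrable_bound)
      show "g b \<in> borel_measurable lborel" unfolding g_def[abs_def] by measurable
    qed (auto simp: g_def indicator_def)
  qed
  have "(\<integral>y. ?F y \<partial>lborel) = (\<integral>f. ?F (\<Sum>b\<in>Basis. f b *\<^sub>R b) \<partial>(\<Pi>\<^sub>M b\<in>Basis. lborel))"
    by (subst lborel_eq, subst integral_distr) (auto simp: unit_cell_box)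
  also have "\<dots> = (\<integral>f. (\<Prod>b\<in>Basis. g b (f b)) \<partial>(\<Pi>\<^sub>M b\<in>Basis. lborel))" by (simp only: F)
  also have "\<dots> = (\<Prod>b\<in>Basis. \<integral>t. g b t \<partial>lborel)"
    by (rule product_integral_prod) (auto intro: gint)
  also have "\<dots> = 0"
  proof -
    obtain i where i: "k $ i \<noteq> 0" using assms by (auto simp: vec_eq_iff)
    have "(\<integral>t. g (axis i 1) t \<partial>lborel) = 0"
      using exponential_integral_unit_interval[OF i] by (simp add: g_def inner_axis freq_def)
    moreover have "axis i 1 \<in> (Basis :: (real^'m) set)" by (simp add: axis_in_Basis_iff)
    ultimately show ?thesis by (intro prod_zero) auto
  qed
  finally show ?thesis by simp
qed

lemma wave_integral_unit_cell:
  "(\<integral>y. wave k c y \<partial>lebesgue_on unit_cell) = (if k = 0 then cos c else 0)"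
proof (cases "k = 0")
  case True
  then show ?thesis by (simp add: wave_def freq_0 unit_cell_facts(3))
next
  case False
  let ?E = "\<lambda>y. indicator unit_cell y *\<^sub>R exp (2 * of_real pi * \<i> * of_real (freq k \<bullet> y)) :: complex"
  have int: "integrable lborel ?E"
  proof (rule Bochner_Integration.integrable_bound)
    show "integrable lborel (indicator (unit_cell :: (real^'a) set) :: _ \<Rightarrow> real)"
      using emeasure_bounded_finite[OF bounded_box[of 0 "1::real^'a"]]
      by (intro integrable_real_indicator) (simp_all add: unit_cell_box)
    show "?E \<in> borel_measurable lborel" by (simp add: unit_cell_box)
    show "AE y in lborel. norm (?E y) \<le> norm (indicator (unit_cell :: (real^'a) set) y :: real)"
      by (intro AE_I2) (auto simp: indicator_def)
  qed
  have "(\<integral>y. wave k c y \<partial>lebesgue_on unit_cell) = (\<integral>y. indicator unit_cell y * wave k c y \<partial>lborel)"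
    by (rule lebesgue_on_integral_borel(1)) (auto simp: unit_cell_box)
  also have "\<dots> = (\<integral>y. Re (cis c * ?E y) \<partial>lborel)"
  proof (rule Bochner_Integration.integral_cong[OF refl])
    fix y :: "real^'a"
    have "exp (2 * of_real pi * \<i> * of_real (freq k \<bullet> y)) = cis (2 * pi * (freq k \<bullet> y))"
      by (simp add: cis_conv_exp mult.assoc mult.left_commute)
    then have eq: "cis c * ?E y = indicator unit_cell y *\<^sub>R cis (c + 2 * pi * (freq k \<bullet> y))"
      by (simp add: cis_mult)
    show "indicator unit_cell y * wave k c y = Re (cis c * ?E y)"
      unfolding eq by (simp add: wave_def add.commute)
  qed
  also have "\<dots> = Re (\<integral>y. cis c * ?E y \<partial>lborel)" by (intro integral_Re integrable_mult_right int)
  also have "\<dots> = 0" using exponential_integral_unit_cell[OF False]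
    by (simp only: Bochner_Integration.integral_mult_right_zero mult_zero_right zero_complex.sel)
  finally show ?thesis using False by simp
qed

lemma fourier_coeff_waves:
  assumes f: "integrable (lebesgue_on unit_cell) f"
  shows "fourier_coeff f (freq k) = of_real (\<integral>y. f y * wave k 0 y \<partial>lebesgue_on unit_cell)
     - \<i> * of_real (\<integral>y. f y * wave k (- pi / 2) y \<partial>lebesgue_on unit_cell)"
proof -
  let ?Y = "lebesgue_on unit_cell"
  have int: "integrable ?Y (\<lambda>y. f y * wave k c y)" for c
  proof (rule Bochner_Integration.integrable_bound[OF f])
    show "(\<lambda>y. f y * wave k c y) \<in> borel_measurable ?Y"
      using borel_measurable_integrable[OF f] borel_measurable_lebesgue_on[OF borel_measurable_wave] by measurable
    show "AE y in ?Y. norm (f y * wave k c y) \<le> norm (f y)"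
    proof (intro AE_I2)
      fix y
      have "\<bar>f y\<bar> * \<bar>wave k c y\<bar> \<le> \<bar>f y\<bar> * 1" by (intro mult_left_mono) auto
      then show "norm (f y * wave k c y) \<le> norm (f y)" by (simp add: abs_mult)
    qed
  qed
  have e: "of_real (f y) * exp (- 2 * of_real pi * \<i> * of_real (freq k \<bullet> y)) =
     of_real (f y * wave k 0 y) - \<i> * of_real (f y * wave k (- pi / 2) y)" for y
  proof -
    have "exp (- 2 * of_real pi * \<i> * of_real (freq k \<bullet> y)) = cis (- (2 * pi * (freq k \<bullet> y)))"
      by (simp add: cis_conv_exp mult.assoc mult.left_commute)
    moreover have "wave k (- pi / 2) y = sin (2 * pi * (freq k \<bullet> y))" by (simp add: wave_def cos_diff)
    moreover have "wave k 0 y = cos (2 * pi * (freq k \<bullet> y))" by (simp add: wave_def)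
    ultimately show ?thesis by (simp add: complex_eq_iff)
  qed
  have "integrable ?Y (\<lambda>y. complex_of_real (f y * wave k c y))" for c
    using int[of c] by (rule integrable_of_real)
  then have "fourier_coeff f (freq k) = (\<integral>y. complex_of_real (f y * wave k 0 y) \<partial>?Y) - \<i> * (\<integral>y. complex_of_real (f y * wave k (- pi / 2) y) \<partial>?Y)"
    unfolding fourier_coeff_def e by (subst Bochner_Integration.integral_diff) auto
  then show ?thesis by (simp only: integral_complex_of_real)
qed


section \<open>Two-scale compactness\<close>

locale two_scale_setting =
  fixes \<Omega> :: "(real^3) set" and R :: "real^3^'m" and \<eta> :: "nat \<Rightarrow> real"
  assumes \<Omega>: "open \<Omega>" "bounded \<Omega>"
    and nonresonant: "\<And>k. k \<in> int_lattice \<Longrightarrow> k \<noteq> 0 \<Longrightarrow> transpose R *v k \<noteq> 0"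
    and \<eta>: "\<And>n. \<eta> n > 0" "\<eta> \<longlonglongrightarrow> 0"
begin

abbreviation "M \<equiv> lebesgue_on \<Omega>"
abbreviation "Y \<equiv> lebesgue_on (unit_cell :: (real^'m) set)"
abbreviation "MY \<equiv> M \<Otimes>\<^sub>M Y"
abbreviation "osc \<phi> n x \<equiv> \<phi> x ((R *v x) /\<^sub>R \<eta> n)"

sublocale M: finite_measure M by (rule finite_measure_bounded_open[OF \<Omega>])
sublocale Y: finite_measure Y by (rule finite_measure_bounded_open[OF unit_cell_facts(1,2)])
sublocale MY: pair_sigma_finite M Y by unfold_locales
sublocale MYf: finite_measure MY by (rule finite_measure_pair_measure) unfold_locales

lemma Omega_lebesgue: "\<Omega> \<in> sets lebesgue" using \<Omega> by simp
lemma Y_lebesgue: "(unit_cell :: (real^'m) set) \<in> sets lebesgue"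
  by (simp add: unit_cell_facts(1))

lemmas Times_facts = Omega_lebesgue M.finite_measure_axioms Y_lebesgue Y.finite_measure_axioms

lemma measurable_MY: "f \<in> borel_measurable (M \<Otimes>\<^sub>M borel) \<Longrightarrow> f \<in> borel_measurable MY"
proof -
  assume f: "f \<in> borel_measurable (M \<Otimes>\<^sub>M borel)"
  have "(\<lambda>y. y) \<in> measurable Y borel" by (rule borel_measurable_lebesgue_on) simp
  then have "(\<lambda>z. (fst z, snd z)) \<in> measurable MY (M \<Otimes>\<^sub>M borel)"
    by (intro measurable_Pair measurable_fst measurable_compose[OF measurable_snd])
  from measurable_compose[OF this f] show ?thesis by simp
qed

lemma measurable_osc:
  assumes "case_prod \<phi> \<in> borel_measurable (M \<Otimes>\<^sub>M borel)"
  shows "(\<lambda>x. osc \<phi> n x) \<in> borel_measurable M"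
proof -
  have "(\<lambda>x. (R *v x) /\<^sub>R \<eta> n) \<in> borel_measurable borel"
    by (intro borel_measurable_continuous_onI continuous_intros matrix_vector_mult_linear_continuous_on)
  then have "(\<lambda>x. (R *v x) /\<^sub>R \<eta> n) \<in> borel_measurable M" by (rule borel_measurable_lebesgue_on)
  then have "(\<lambda>x. (x, (R *v x) /\<^sub>R \<eta> n)) \<in> measurable M (M \<Otimes>\<^sub>M borel)" by (intro measurable_Pair) auto
  from measurable_compose[OF this assms] show ?thesis by simp
qed

text \<open>Along \<open>y = R x / \<eta>\<close>, a wave of frequency \<open>k\<close> in \<open>y\<close> is a wave of frequency \<open>R\<^sup>T k / \<eta>\<close> in \<open>x\<close>.\<close>

lemma wave_osc: "wave k c ((R *v x) /\<^sub>R \<eta> n) = cos ((((2 * pi) *\<^sub>R (transpose R *v freq k)) /\<^sub>R \<eta> n) \<bullet> x + c)"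
  by (simp add: wave_def transpose_matrix_vector dot_lmul_matrix mult.assoc)

lemma wave_osc_measurable [measurable]: "(\<lambda>x. wave k c ((R *v x) /\<^sub>R \<eta> n)) \<in> borel_measurable M"
  unfolding wave_osc by (rule borel_measurable_cos_affine)

lemma nonresonant_freq: "k \<noteq> 0 \<Longrightarrow> transpose R *v freq k \<noteq> 0"
  using nonresonant[of "freq k"] range_freq freq_eq_0_iff by blast

lemma oscillating_L2:
  assumes "\<phi> \<in> oscillating \<Omega>"
  shows "(\<lambda>x. osc \<phi> n x) \<in> L2 M" "case_prod \<phi> \<in> L2 MY"
proof -
  obtain C where C: "\<And>x y. x \<in> \<Omega> \<Longrightarrow> \<bar>\<phi> x y\<bar> \<le> C" using oscillating_bounded[OF assms] by blast
  show "(\<lambda>x. osc \<phi> n x) \<in> L2 M"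
    by (rule M.L2_bounded[OF measurable_osc[OF oscillating_measurable[OF assms]]]) (use C in auto)
  show "case_prod \<phi> \<in> L2 MY"
    by (rule MYf.L2_bounded[OF measurable_MY[OF oscillating_measurable[OF assms]]]) (use C in \<open>auto simp: space_pair_measure\<close>)
qed

lemma L2_fst:
  fixes f :: "real^3 \<Rightarrow> real"
  assumes f: "f \<in> L2 M"
  shows "(\<lambda>(x, y). f x) \<in> L2 MY" "(\<integral>(x, y). (f x)\<^sup>2 \<partial>MY) = (\<integral>x. (f x)\<^sup>2 \<partial>M)"
proof -
  note [measurable] = L2_measurable[OF f]
  have int: "integrable MY (\<lambda>(x, y). (f x)\<^sup>2)"
  proof (rule MY.Fubini_integrable)
    show "integrable M (\<lambda>x. \<integral>y. norm (case (x, y) of (x, y) \<Rightarrow> (f x)\<^sup>2) \<partial>Y)"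
    proof -
      have "integrable M (\<lambda>x. norm ((f x)\<^sup>2))" using f by (intro integrable_norm) (simp add: L2_real_iff)
      then show ?thesis by (simp add: unit_cell_facts(3))
    qed
  qed (auto, measurable)
  have "(\<lambda>(x, y). f x) \<in> borel_measurable MY" by measurable
  with int show "(\<lambda>(x, y). f x) \<in> L2 MY" by (simp add: L2_real_iff case_prod_beta')
  have "(\<integral>z. (case z of (x, y) \<Rightarrow> (f x)\<^sup>2) \<partial>MY) = (\<integral>x. \<integral>y. (f x)\<^sup>2 \<partial>Y \<partial>M)"
    using MY.integral_fst'[OF int] by simp
  then show "(\<integral>(x, y). (f x)\<^sup>2 \<partial>MY) = (\<integral>x. (f x)\<^sup>2 \<partial>M)" by (simp add: unit_cell_facts(3))
qed

lemma wave_pairing: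
  assumes f: "f \<in> L2 M" and a: "a \<in> borel_measurable M" "\<And>x. x \<in> \<Omega> \<Longrightarrow> \<bar>a x\<bar> \<le> C"
  shows "(\<integral>(x, y). f x * (a x * wave k c y) \<partial>MY) = (\<integral>x. f x * a x \<partial>M) * (if k = 0 then cos c else 0)"
proof -
  have osc: "(\<lambda>x y. a x * wave k c y) \<in> oscillating \<Omega>" using a by (rule oscillating.wave)
  have "integrable MY (\<lambda>z. (case z of (x, y) \<Rightarrow> f x) * (case z of (x, y) \<Rightarrow> a x * wave k c y))"
    by (rule L2_mult_integrable[OF L2_fst(1)[OF f] oscillating_L2(2)[OF osc]])
  then have int: "integrable MY (\<lambda>(x, y). f x * (a x * wave k c y))" by (simp add: case_prod_beta')
  have "(\<integral>(x, y). f x * (a x * wave k c y) \<partial>MY) = (\<integral>x. \<integral>y. f x * (a x * wave k c y) \<partial>Y \<partial>M)"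
    using MY.integral_fst'[OF int] by simp
  also have "\<dots> = (\<integral>x. f x * a x \<partial>M) * (if k = 0 then cos c else 0)"
    by (simp only: mult.assoc[symmetric] Bochner_Integration.integral_mult_right_zero wave_integral_unit_cell
        Bochner_Integration.integral_mult_left_zero)
  finally show ?thesis .
qed

text \<open>For waves with \<open>k \<noteq> 0\<close> both sides vanish, the left one by the Riemann--Lebesgue lemma.\<close>

lemma oscillating_mean_value:
  assumes f: "f \<in> L2 M" and \<phi>: "\<phi> \<in> oscillating \<Omega>"
  shows "(\<lambda>n. \<integral>x. f x * osc \<phi> n x \<partial>M) \<longlonglongrightarrow> (\<integral>(x, y). f x * \<phi> x y \<partial>MY)"
  using \<phi>
proof induction
  case zero
  show ?case by simp
next
  case (wave a C k c)
  have fa: "(\<lambda>x. f x * a x) \<in> L2 M" using wave by (intro L2_mult_bounded(1)[OF f]) auto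
  note limit = wave_pairing[OF f wave, of k c]
  have "(\<lambda>n. \<integral>x. (f x * a x) * wave k c ((R *v x) /\<^sub>R \<eta> n) \<partial>M) \<longlonglongrightarrow> (\<integral>x. f x * a x \<partial>M) * (if k = 0 then cos c else 0)"
  proof (cases "k = 0")
    case True
    then show ?thesis by (simp add: wave_def freq_0)
  next
    case False
    then have "(2 * pi) *\<^sub>R (transpose R *v freq k) \<noteq> 0" using nonresonant_freq by simp
    from Riemann_Lebesgue[OF \<Omega> fa this \<eta>, of c] show ?thesis using False by (simp add: wave_osc)
  qed
  then show ?case using limit by (simp add: mult.assoc)
next
  case (add \<phi> \<psi>)
  have eq1: "(\<integral>x. f x * (osc \<phi> n x + osc \<psi> n x) \<partial>M) = (\<integral>x. f x * osc \<phi> n x \<partial>M) + (\<integral>x. f x * osc \<psi> n x \<partial>M)" for n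
    using L2_mult_integrable[OF f oscillating_L2(1)[OF add(1)], of n] L2_mult_integrable[OF f oscillating_L2(1)[OF add(2)], of n]
    by (simp add: distrib_left)
  have "(\<integral>(x, y). f x * (\<phi> x y + \<psi> x y) \<partial>MY) = (\<integral>(x, y). f x * \<phi> x y \<partial>MY) + (\<integral>(x, y). f x * \<psi> x y \<partial>MY)"
    using L2_mult_integrable[OF L2_fst(1)[OF f] oscillating_L2(2)[OF add(1)]] L2_mult_integrable[OF L2_fst(1)[OF f] oscillating_L2(2)[OF add(2)]]
    by (simp add: case_prod_beta' distrib_left)
  then show ?case unfolding eq1 using tendsto_add[OF add.IH] by simp
qed

text \<open>The limit \<open>L \<phi>\<close> of the pairings is linear in \<open>\<phi>\<close>. The Cauchy--Schwarz inequality bounds it by \<open>C\<close>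
  times the limit of the norms of \<open>\<phi>(x, R x / \<eta>)\<close>, which by the mean value property for \<open>\<phi>\<^sup>2\<close> is the norm
  of \<open>\<phi>\<close> on the product space. So \<open>L\<close> is represented by a function there.\<close>

lemma two_scale_limit_exists:
  fixes f :: "nat \<Rightarrow> real^3 \<Rightarrow> real"
  assumes f: "\<And>n. f n \<in> L2 M" and bound: "\<And>n. L2_norm M (f n) \<le> C"
    and conv: "\<And>k b. \<exists>h. weakly_tendsto M (\<lambda>n x. f n x * wave k (if b then - pi / 2 else 0) ((R *v x) /\<^sub>R \<eta> n)) h"
  obtains u0 where "u0 \<in> L2 MY" "\<And>\<phi>. \<phi> \<in> oscillating \<Omega> \<Longrightarrow>
      (\<lambda>n. \<integral>x. f n x * osc \<phi> n x \<partial>M) \<longlonglongrightarrow> (\<integral>(x, y). u0 (x, y) * \<phi> x y \<partial>MY)"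
proof -
  have lim: "convergent (\<lambda>n. \<integral>x. f n x * osc \<phi> n x \<partial>M)" if "\<phi> \<in> oscillating \<Omega>" for \<phi>
    using that
  proof induction
    case zero
    show ?case by (simp add: convergent_const)
  next
    case (wave a D k c)
    have a: "a \<in> L2 M" using wave by (intro M.L2_bounded) auto
    let ?w = "\<lambda>c n x. wave k c ((R *v x) /\<^sub>R \<eta> n)"
    have "convergent (\<lambda>n. \<integral>x. (f n x * ?w (if b then - pi / 2 else 0) n x) * a x \<partial>M)" for b
      using conv[of k b] a unfolding weakly_tendsto_def convergent_def by blast
    from this[of False] this[of True]
    have c: "convergent (\<lambda>n. \<integral>x. (f n x * ?w 0 n x) * a x \<partial>M)" "convergent (\<lambda>n. \<integral>x. (f n x * ?w (- pi / 2) n x) * a x \<partial>M)"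
      by simp_all
    have int: "integrable M (\<lambda>x. (f n x * ?w d n x) * a x)" for n d
      by (rule L2_mult_integrable[OF L2_mult_bounded(1)[OF f wave_osc_measurable] a]) (rule wave_le_1)
    \<comment> \<open>The phases \<open>0\<close> and \<open>- pi / 2\<close> span all others.\<close>
    have split: "?w c n x = cos c * ?w 0 n x - sin c * ?w (- pi / 2) n x" for n x
      by (simp add: wave_def cos_add cos_diff)
    have "(\<integral>x. f n x * (a x * ?w c n x) \<partial>M) = cos c * (\<integral>x. (f n x * ?w 0 n x) * a x \<partial>M) - sin c * (\<integral>x. (f n x * ?w (- pi / 2) n x) * a x \<partial>M)" for n
    proof -
      have "(\<integral>x. f n x * (a x * ?w c n x) \<partial>M) = (\<integral>x. cos c * ((f n x * ?w 0 n x) * a x) - sin c * ((f n x * ?w (- pi / 2) n x) * a x) \<partial>M)"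
        unfolding split by (intro Bochner_Integration.integral_cong refl) (simp add: algebra_simps)
      then show ?thesis using int by simp
    qed
    then show ?case
      using convergent_diff[OF convergent_mult[OF convergent_const c(1)] convergent_mult[OF convergent_const c(2)], of "cos c" "sin c"] by simp
  next
    case (add \<phi> \<psi>)
    have "(\<integral>x. f n x * (osc \<phi> n x + osc \<psi> n x) \<partial>M) = (\<integral>x. f n x * osc \<phi> n x \<partial>M) + (\<integral>x. f n x * osc \<psi> n x \<partial>M)" for n
      using L2_mult_integrable[OF f oscillating_L2(1)[OF add(1)], of n n] L2_mult_integrable[OF f oscillating_L2(1)[OF add(2)], of n n]
      by (simp add: distrib_left)
    then show ?case using convergent_add[OF add.IH] by simp
  qed
  define V where "V = case_prod ` (oscillating \<Omega> :: (real^3 \<Rightarrow> real^'m \<Rightarrow> real) set)"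
  define L where "L \<Phi> = lim (\<lambda>n. \<integral>x. f n x * \<Phi> (x, (R *v x) /\<^sub>R \<eta> n) \<partial>M)" for \<Phi>
  have Llim: "(\<lambda>n. \<integral>x. f n x * osc \<phi> n x \<partial>M) \<longlonglongrightarrow> L (case_prod \<phi>)" if "\<phi> \<in> oscillating \<Omega>" for \<phi>
    using lim[OF that] by (simp add: L_def convergent_LIMSEQ_iff)
  have C: "0 \<le> C" using bound[of 0] L2_norm_nonneg[of M "f 0"] by linarith
  obtain u0 where u0: "u0 \<in> L2 MY" "\<And>\<Phi>. \<Phi> \<in> V \<Longrightarrow> (\<integral>z. u0 z * \<Phi> z \<partial>MY) = L \<Phi>"
  proof (rule MYf.L2_Riesz[of V L C])
    show "V \<subseteq> L2 MY" using oscillating_L2(2) by (auto simp: V_def)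
    show "(\<lambda>z. 0) \<in> V" unfolding V_def using imageI[OF oscillating.zero, of case_prod] by (simp add: case_prod_beta')
    show "(\<lambda>z. \<Phi> z + \<Psi> z) \<in> V" "L (\<lambda>z. \<Phi> z + \<Psi> z) = L \<Phi> + L \<Psi>" if V: "\<Phi> \<in> V" "\<Psi> \<in> V" for \<Phi> \<Psi>
    proof -
      obtain \<phi> \<psi> where p: "\<Phi> = case_prod \<phi>" "\<Psi> = case_prod \<psi>" "\<phi> \<in> oscillating \<Omega>" "\<psi> \<in> oscillating \<Omega>"
        using V by (auto simp: V_def)
      have eq: "(\<lambda>z. \<Phi> z + \<Psi> z) = case_prod (\<lambda>x y. \<phi> x y + \<psi> x y)" by (auto simp: p)
      note s = oscillating.add[OF p(3,4)]
      show "(\<lambda>z. \<Phi> z + \<Psi> z) \<in> V" unfolding eq V_def using s by (rule imageI)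
      have "(\<integral>x. f n x * (osc \<phi> n x + osc \<psi> n x) \<partial>M) = (\<integral>x. f n x * osc \<phi> n x \<partial>M) + (\<integral>x. f n x * osc \<psi> n x \<partial>M)" for n
        using L2_mult_integrable[OF f oscillating_L2(1)[OF p(3)], of n n] L2_mult_integrable[OF f oscillating_L2(1)[OF p(4)], of n n]
        by (simp add: distrib_left)
      then have "(\<lambda>n. \<integral>x. f n x * (osc \<phi> n x + osc \<psi> n x) \<partial>M) \<longlonglongrightarrow> L \<Phi> + L \<Psi>"
        using tendsto_add[OF Llim[OF p(3)] Llim[OF p(4)]] p by simp
      from LIMSEQ_unique[OF Llim[OF s] this] show "L (\<lambda>z. \<Phi> z + \<Psi> z) = L \<Phi> + L \<Psi>" by (simp only: eq)
    qed
    show "(\<lambda>z. r * \<Phi> z) \<in> V" "L (\<lambda>z. r * \<Phi> z) = r * L \<Phi>" if V: "\<Phi> \<in> V" for \<Phi> r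
    proof -
      obtain \<phi> where p: "\<Phi> = case_prod \<phi>" "\<phi> \<in> oscillating \<Omega>" using V by (auto simp: V_def)
      have eq: "(\<lambda>z. r * \<Phi> z) = case_prod (\<lambda>x y. r * \<phi> x y)" by (auto simp: p)
      note s = oscillating_scale[OF p(2), of r]
      show "(\<lambda>z. r * \<Phi> z) \<in> V" unfolding eq V_def using s by (rule imageI)
      have "(\<integral>x. f n x * (r * osc \<phi> n x) \<partial>M) = r * (\<integral>x. f n x * osc \<phi> n x \<partial>M)" for n
        by (subst Bochner_Integration.integral_mult_right_zero[symmetric]) (simp add: mult.left_commute)
      then have "(\<lambda>n. \<integral>x. f n x * (r * osc \<phi> n x) \<partial>M) \<longlonglongrightarrow> r * L \<Phi>"
        using tendsto_mult_left[OF Llim[OF p(2)], of r] p by simp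
      from LIMSEQ_unique[OF Llim[OF s] this] show "L (\<lambda>z. r * \<Phi> z) = r * L \<Phi>" by (simp only: eq)
    qed
    show "\<bar>L \<Phi>\<bar> \<le> C * L2_norm MY \<Phi>" if V: "\<Phi> \<in> V" for \<Phi>
    proof -
      obtain \<phi> where p: "\<Phi> = case_prod \<phi>" "\<phi> \<in> oscillating \<Omega>" using V by (auto simp: V_def)
      have one: "(\<lambda>x. 1::real) \<in> L2 M" by (simp add: L2_real_iff)
      have "(\<lambda>n. \<integral>x. 1 * (osc \<phi> n x * osc \<phi> n x) \<partial>M) \<longlonglongrightarrow> (\<integral>(x, y). 1 * (\<phi> x y * \<phi> x y) \<partial>MY)"
        by (rule oscillating_mean_value[OF one oscillating_mult[OF p(2) p(2)]])
      then have "(\<lambda>n. \<integral>x. (osc \<phi> n x)\<^sup>2 \<partial>M) \<longlonglongrightarrow> (\<integral>z. (\<Phi> z)\<^sup>2 \<partial>MY)"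
        by (simp add: p power2_eq_square case_prod_beta')
      from tendsto_real_sqrt[OF this] have "(\<lambda>n. C * L2_norm M (osc \<phi> n)) \<longlonglongrightarrow> C * L2_norm MY \<Phi>"
        by (intro tendsto_mult_left) (simp add: L2_norm_def)
      moreover have "(\<lambda>n. \<bar>\<integral>x. f n x * osc \<phi> n x \<partial>M\<bar>) \<longlonglongrightarrow> \<bar>L \<Phi>\<bar>" using tendsto_rabs[OF Llim[OF p(2)]] p by simp
      moreover have "\<bar>\<integral>x. f n x * osc \<phi> n x \<partial>M\<bar> \<le> C * L2_norm M (osc \<phi> n)" for n
        using L2_Cauchy_Schwarz[OF f oscillating_L2(1)[OF p(2)], of n n] mult_right_mono[OF bound[of n] L2_norm_nonneg[of M "osc \<phi> n"]]
        by linarith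
      ultimately show ?thesis by (intro LIMSEQ_le) auto
    qed
  qed (rule that)
  show thesis
  proof (rule that[OF u0(1)])
    fix \<phi> :: "real^3 \<Rightarrow> real^'m \<Rightarrow> real" assume \<phi>: "\<phi> \<in> oscillating \<Omega>"
    have "(\<integral>(x, y). u0 (x, y) * \<phi> x y \<partial>MY) = L (case_prod \<phi>)"
      using u0(2)[of "case_prod \<phi>"] \<phi> by (simp add: V_def case_prod_beta')
    then show "(\<lambda>n. \<integral>x. f n x * osc \<phi> n x \<partial>M) \<longlonglongrightarrow> (\<integral>(x, y). u0 (x, y) * \<phi> x y \<partial>MY)"
      using Llim[OF \<phi>] by simp
  qed
qed

text \<open>Both sides of the limit relation change by at most a fixed multiple of the norm of \<open>m\<close> when \<open>\<phi>\<close> is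
  replaced by an oscillating test function that differs from it by at most \<open>m x\<close>, uniformly in \<open>n\<close>.\<close>

lemma two_scale_weakI:
  fixes f :: "nat \<Rightarrow> real^3 \<Rightarrow> real"
  assumes f: "\<And>n. f n \<in> L2 M" and bound: "\<And>n. L2_norm M (f n) \<le> C" and u0: "u0 \<in> L2 MY"
    and lim: "\<And>\<phi>. \<phi> \<in> oscillating \<Omega> \<Longrightarrow>
      (\<lambda>n. \<integral>x. f n x * osc \<phi> n x \<partial>M) \<longlonglongrightarrow> (\<integral>(x, y). u0 (x, y) * \<phi> x y \<partial>MY)"
  shows "two_scale_weak \<Omega> R \<eta> f u0"
  unfolding two_scale_weak_def
proof (intro conjI allI ballI)
  show "f n \<in> L2 M" for n by (rule f)
  show "u0 \<in> L2 (lebesgue_on (\<Omega> \<times> unit_cell))" by (rule lebesgue_on_Times_L2[OF Times_facts u0])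
  fix \<phi> :: "real^3 \<Rightarrow> ((real^'m) \<Rightarrow>\<^sub>C real)" assume \<phi>: "\<phi> \<in> L2_C_per \<Omega>"
  let ?\<phi> = "\<lambda>x y. apply_bcontfun (\<phi> x) y"
  note \<phi>m = L2_C_per_measurable[OF \<phi>]
  have C: "0 \<le> C" using bound[of 0] L2_norm_nonneg[of M "f 0"] by linarith
  note nL = L2_C_per_norm[OF \<phi>]
  have oscL: "(\<lambda>x. osc ?\<phi> n x) \<in> L2 M" for n
  proof (rule L2_bound(1)[OF nL measurable_osc[OF \<phi>m]])
    show "AE x in M. \<bar>osc ?\<phi> n x\<bar> \<le> \<bar>norm (\<phi> x)\<bar>"
      using norm_bounded[of "\<phi> _"] by (intro AE_I2) auto
  qed
  have \<phi>L: "case_prod ?\<phi> \<in> L2 MY"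
  proof (rule L2_bound(1)[OF L2_fst(1)[OF nL] measurable_MY[OF \<phi>m]])
    show "AE z in MY. \<bar>case_prod ?\<phi> z\<bar> \<le> \<bar>case z of (x, y) \<Rightarrow> norm (\<phi> x)\<bar>"
      using norm_bounded[of "\<phi> _"] by (intro AE_I2) auto
  qed
  have u0\<phi>m: "(\<lambda>(x, y). u0 (x, y) * \<phi> x y) \<in> borel_measurable MY"
    using borel_measurable_times[OF L2_measurable[OF u0] L2_measurable[OF \<phi>L]] by (simp add: case_prod_beta')
  have "(\<lambda>n. \<integral>x. f n x * osc ?\<phi> n x \<partial>M) \<longlonglongrightarrow> (\<integral>(x, y). u0 (x, y) * \<phi> x y \<partial>MY)"
  proof (rule LIMSEQ_I)
    fix e :: real assume e: "0 < e"
    define D where "D = C + L2_norm MY u0 + 1"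
    have D: "0 < D" "C \<le> D" "L2_norm MY u0 \<le> D" using C L2_norm_nonneg[of MY u0] unfolding D_def by linarith+
    have "0 < e / (3 * D)" using e D by simp
    then obtain \<psi> m where \<psi>: "\<psi> \<in> oscillating \<Omega>" and m: "m \<in> L2 M" "L2_norm M m < e / (3 * D)"
      and close: "\<And>x y. x \<in> \<Omega> \<Longrightarrow> \<bar>\<phi> x y - \<psi> x y\<bar> \<le> m x"
      using oscillating_dense[OF \<Omega> \<phi>] by blast
    have mD: "D * L2_norm M m < e / 3" using m(2) D by (simp add: field_simps)
    have d1: "\<bar>(\<integral>x. f n x * osc ?\<phi> n x \<partial>M) - (\<integral>x. f n x * osc \<psi> n x \<partial>M)\<bar> < e / 3" for n
    proof -
      note dL = L2_diff[OF oscL[of n] oscillating_L2(1)[OF \<psi>, of n]]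
      have "(\<integral>x. f n x * osc ?\<phi> n x \<partial>M) - (\<integral>x. f n x * osc \<psi> n x \<partial>M) = (\<integral>x. f n x * (osc ?\<phi> n x - osc \<psi> n x) \<partial>M)"
        using L2_mult_integrable[OF f oscL] L2_mult_integrable[OF f oscillating_L2(1)[OF \<psi>]]
        by (simp add: right_diff_distrib)
      also have "\<bar>\<dots>\<bar> \<le> L2_norm M (f n) * L2_norm M (\<lambda>x. osc ?\<phi> n x - osc \<psi> n x)"
        by (rule L2_Cauchy_Schwarz[OF f dL])
      also have "\<dots> \<le> D * L2_norm M m"
      proof (rule mult_mono)
        show "L2_norm M (f n) \<le> D" using bound[of n] D by simp
        show "L2_norm M (\<lambda>x. osc ?\<phi> n x - osc \<psi> n x) \<le> L2_norm M m"
          by (rule L2_bound(2)[OF m(1) L2_measurable[OF dL]]) (use close in \<open>auto intro!: AE_I2 order_trans[OF _ abs_ge_self]\<close>)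
      qed (use D in auto)
      finally show ?thesis using mD by simp
    qed
    have d2: "\<bar>(\<integral>(x, y). u0 (x, y) * \<phi> x y \<partial>MY) - (\<integral>(x, y). u0 (x, y) * \<psi> x y \<partial>MY)\<bar> < e / 3"
    proof -
      note dL = L2_diff[OF \<phi>L oscillating_L2(2)[OF \<psi>]]
      have "(\<integral>(x, y). u0 (x, y) * \<phi> x y \<partial>MY) - (\<integral>(x, y). u0 (x, y) * \<psi> x y \<partial>MY) = (\<integral>z. u0 z * (case_prod ?\<phi> z - case_prod \<psi> z) \<partial>MY)"
        using L2_mult_integrable[OF u0 \<phi>L] L2_mult_integrable[OF u0 oscillating_L2(2)[OF \<psi>]]
        by (simp add: right_diff_distrib case_prod_beta')
      also have "\<bar>\<dots>\<bar> \<le> L2_norm MY u0 * L2_norm MY (\<lambda>z. case_prod ?\<phi> z - case_prod \<psi> z)"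
        by (rule L2_Cauchy_Schwarz[OF u0 dL])
      also have "\<dots> \<le> D * L2_norm M m"
      proof (rule mult_mono)
        have "L2_norm MY (\<lambda>z. case_prod ?\<phi> z - case_prod \<psi> z) \<le> L2_norm MY (\<lambda>(x, y). m x)"
          by (rule L2_bound(2)[OF L2_fst(1)[OF m(1)] L2_measurable[OF dL]])
            (use close in \<open>auto intro!: AE_I2 order_trans[OF _ abs_ge_self] simp: space_pair_measure\<close>)
        also have "\<dots> = L2_norm M m" using L2_fst(2)[OF m(1)] by (simp add: L2_norm_def case_prod_beta')
        finally show "L2_norm MY (\<lambda>z. case_prod ?\<phi> z - case_prod \<psi> z) \<le> L2_norm M m" .
      qed (use D in auto)
      finally show ?thesis using mD by simp
    qed
    obtain N where N: "\<And>n. n \<ge> N \<Longrightarrow> \<bar>(\<integral>x. f n x * osc \<psi> n x \<partial>M) - (\<integral>(x, y). u0 (x, y) * \<psi> x y \<partial>MY)\<bar> < e / 3"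
      using LIMSEQ_D[OF lim[OF \<psi>], of "e/3"] e by auto
    show "\<exists>N. \<forall>n\<ge>N. norm ((\<integral>x. f n x * osc ?\<phi> n x \<partial>M) - (\<integral>(x, y). u0 (x, y) * \<phi> x y \<partial>MY)) < e"
    proof (intro exI[of _ N] allI impI)
      fix n assume "N \<le> n"
      from N[OF this] d1[of n] d2 show "norm ((\<integral>x. f n x * osc ?\<phi> n x \<partial>M) - (\<integral>(x, y). u0 (x, y) * \<phi> x y \<partial>MY)) < e"
        unfolding real_norm_def abs_less_iff by linarith
    qed
  qed
  then show "(\<lambda>n. \<integral>x. f n x * osc ?\<phi> n x \<partial>M) \<longlonglongrightarrow> (\<integral>(x, y). u0 (x, y) * \<phi> x y \<partial>lebesgue_on (\<Omega> \<times> unit_cell))"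
    using lebesgue_on_Times_integral(2)[OF Times_facts u0\<phi>m] by simp
qed

lemma oscillating_pairing_of_strong_limit:
  fixes f :: "nat \<Rightarrow> real^3 \<Rightarrow> real"
  assumes f: "\<And>n. f n \<in> L2 M" and v: "v \<in> L2 M"
    and lim: "(\<lambda>n. L2_norm M (\<lambda>x. f n x - v x)) \<longlonglongrightarrow> 0" and \<phi>: "\<phi> \<in> oscillating \<Omega>"
  shows "(\<lambda>n. \<integral>x. f n x * osc \<phi> n x \<partial>M) \<longlonglongrightarrow> (\<integral>(x, y). v x * \<phi> x y \<partial>MY)"
proof -
  obtain C where C: "\<And>x y. x \<in> \<Omega> \<Longrightarrow> \<bar>\<phi> x y\<bar> \<le> C" using oscillating_bounded[OF \<phi>] by blast
  have "(\<lambda>n. (\<integral>x. f n x * osc \<phi> n x \<partial>M) - (\<integral>x. v x * osc \<phi> n x \<partial>M)) \<longlonglongrightarrow> 0"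
  proof (rule Lim_null_comparison)
    let ?m = "sqrt (measure M (space M))"
    show "(\<lambda>n. L2_norm M (\<lambda>x. f n x - v x) * (\<bar>C\<bar> * ?m)) \<longlonglongrightarrow> 0" using tendsto_mult_right[OF lim] by simp
    show "\<forall>\<^sub>F n in sequentially. norm ((\<integral>x. f n x * osc \<phi> n x \<partial>M) - (\<integral>x. v x * osc \<phi> n x \<partial>M)) \<le> L2_norm M (\<lambda>x. f n x - v x) * (\<bar>C\<bar> * ?m)"
    proof (intro always_eventually allI)
      fix n
      note oL = oscillating_L2(1)[OF \<phi>, of n]
      have one: "(\<lambda>x. 1::real) \<in> L2 M" by (simp add: L2_real_iff)
      have "L2_norm M (\<lambda>x. 1 * osc \<phi> n x) \<le> \<bar>C\<bar> * L2_norm M (\<lambda>x. 1::real)"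
        by (rule L2_mult_bounded(2)[OF one L2_measurable[OF oL]]) (use C in auto)
      then have le: "L2_norm M (osc \<phi> n) \<le> \<bar>C\<bar> * ?m" unfolding M.L2_norm_one by simp
      have "(\<integral>x. f n x * osc \<phi> n x \<partial>M) - (\<integral>x. v x * osc \<phi> n x \<partial>M) = (\<integral>x. (f n x - v x) * osc \<phi> n x \<partial>M)"
        using L2_mult_integrable[OF f oL] L2_mult_integrable[OF v oL] by (simp add: left_diff_distrib)
      then have "norm ((\<integral>x. f n x * osc \<phi> n x \<partial>M) - (\<integral>x. v x * osc \<phi> n x \<partial>M)) \<le> L2_norm M (\<lambda>x. f n x - v x) * L2_norm M (osc \<phi> n)"
        using L2_Cauchy_Schwarz[OF L2_diff[OF f v] oL, of n] by simp
      also have "\<dots> \<le> L2_norm M (\<lambda>x. f n x - v x) * (\<bar>C\<bar> * ?m)" by (intro mult_left_mono le) simp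
      finally show "norm ((\<integral>x. f n x * osc \<phi> n x \<partial>M) - (\<integral>x. v x * osc \<phi> n x \<partial>M)) \<le> L2_norm M (\<lambda>x. f n x - v x) * (\<bar>C\<bar> * ?m)" .
    qed
  qed
  from tendsto_add[OF this oscillating_mean_value[OF v \<phi>]] show ?thesis by simp
qed

end

context two_scale_setting
begin


section \<open>Two-scale limits of gradients\<close>

lemma section_wave_integrable:
  assumes "w \<in> L2 MY"
  shows "integrable MY (\<lambda>(x, y). w (x, y) * wave k c y)"
proof -
  have m: "(\<lambda>z. wave k c (snd z)) \<in> borel_measurable MY"
    using borel_measurable_lebesgue_on[OF borel_measurable_wave] by measurable
  have "(\<lambda>z. w z * wave k c (snd z)) \<in> L2 MY" by (rule L2_mult_bounded(1)[OF assms m]) (rule wave_le_1)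
  from MYf.L2_integrable[OF this] show ?thesis by (simp add: case_prod_beta')
qed

lemma wave_coefficient_pairing:
  assumes w: "w \<in> L2 MY" and \<psi>: "\<psi> \<in> test_functions \<Omega>"
  shows "(\<integral>(x, y). w (x, y) * (\<psi> x * wave k c y) \<partial>MY) = (\<integral>x. (\<integral>y. w (x, y) * wave k c y \<partial>Y) * \<psi> x \<partial>M)"
    and "integrable M (\<lambda>x. (\<integral>y. w (x, y) * wave k c y \<partial>Y) * \<psi> x)"
proof -
  obtain B where B: "\<And>x. \<bar>\<psi> x\<bar> \<le> B" using test_function_bounded[OF \<psi>] by blast
  have "(\<lambda>x y. \<psi> x * wave k c y) \<in> oscillating \<Omega>"
    by (rule oscillating.wave[OF borel_measurable_lebesgue_on[OF test_function_measurable(1)[OF \<psi>]] B])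
  from L2_mult_integrable[OF w oscillating_L2(2)[OF this]]
  have int: "integrable MY (\<lambda>(x, y). w (x, y) * (\<psi> x * wave k c y))" by (simp add: case_prod_beta')
  have eq: "(\<integral>y. w (x, y) * (\<psi> x * wave k c y) \<partial>Y) = (\<integral>y. w (x, y) * wave k c y \<partial>Y) * \<psi> x" for x
    by (subst Bochner_Integration.integral_mult_left_zero[symmetric]) (simp add: ac_simps)
  show "(\<integral>(x, y). w (x, y) * (\<psi> x * wave k c y) \<partial>MY) = (\<integral>x. (\<integral>y. w (x, y) * wave k c y \<partial>Y) * \<psi> x \<partial>M)"
    using MY.integral_fst'[OF int] by (simp add: eq)
  show "integrable M (\<lambda>x. (\<integral>y. w (x, y) * wave k c y \<partial>Y) * \<psi> x)"
    using MY.integrable_fst'[OF int] by (simp add: eq)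
qed

lemma wave_coefficient_integrable:
  assumes "w \<in> L2 MY"
  shows "integrable M (\<lambda>x. \<integral>y. w (x, y) * wave k c y \<partial>Y)"
  using MY.integrable_fst'[OF section_wave_integrable[OF assms, of k c]] by simp

text \<open>The vector \<open>W\<close> of wave coefficients is shown to be parallel to \<open>\<xi>\<close> by pairing it with
  \<open>z = \<xi>\<^sub>i e\<^sub>j - \<xi>\<^sub>j e\<^sub>i\<close>. The gradients are tested in this direction against \<open>\<psi> x\<close> times the wave: as \<open>z\<close> is
  orthogonal to \<open>\<xi>\<close>, integration by parts leaves only the derivative of \<open>\<psi>\<close>, and the resulting
  pairing of \<open>u n\<close> with a wave of nonzero frequency tends to \<open>0\<close>.\<close>

lemma gradient_limit_waves_parallel:
  fixes u :: "nat \<Rightarrow> real^3 \<Rightarrow> real" and g :: "nat \<Rightarrow> real^3 \<Rightarrow> real^3" and w :: "3 \<Rightarrow> (real^3) \<times> (real^'m) \<Rightarrow> real" and c :: real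
  assumes u: "\<And>n. u n \<in> L2 M" and g: "\<And>n. g n \<in> L2 M" and ug: "\<And>n. has_weak_grad \<Omega> (u n) (g n)"
    and v: "v \<in> L2 M" and strong: "(\<lambda>n. L2_norm M (\<lambda>x. u n x - v x)) \<longlonglongrightarrow> 0"
    and w: "\<And>j. w j \<in> L2 MY" and wlim: "\<And>j \<phi>. \<phi> \<in> oscillating \<Omega> \<Longrightarrow>
      (\<lambda>n. \<integral>x. g n x $ j * osc \<phi> n x \<partial>M) \<longlonglongrightarrow> (\<integral>(x, y). w j (x, y) * \<phi> x y \<partial>MY)"
    and k: "k \<noteq> 0"
  defines "\<xi> \<equiv> transpose R *v freq k" and "W \<equiv> \<lambda>j x. \<integral>y. w j (x, y) * wave k c y \<partial>Y"
  shows "AE x in M. \<xi> $ i * W j x - \<xi> $ j * W i x = 0"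
proof (rule fundamental_lemma[OF \<Omega>(1)])
  have Wint: "integrable M (W j)" for j unfolding W_def by (rule wave_coefficient_integrable[OF w])
  show "integrable M (\<lambda>x. \<xi> $ i * W j x - \<xi> $ j * W i x)" using Wint by simp
  fix \<psi> assume \<psi>: "\<psi> \<in> test_functions \<Omega>"
  define z where "z = \<xi> $ i *\<^sub>R axis j 1 - \<xi> $ j *\<^sub>R (axis i 1 :: real^3)"
  have \<xi>z: "\<xi> \<bullet> z = 0" by (simp add: z_def inner_diff_right inner_axis)
  have gz: "y \<bullet> z = \<xi> $ i * y $ j - \<xi> $ j * y $ i" for y by (simp add: z_def inner_diff_right inner_axis)
  obtain B where B: "\<And>x. \<bar>\<psi> x\<bar> \<le> B" using test_function_bounded[OF \<psi>] by blast
  obtain D where D: "\<And>x. \<bar>frechet_derivative \<psi> (at x) z\<bar> \<le> D" using test_function_directional(2)[OF \<psi>] by metis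
  note dm = borel_measurable_lebesgue_on[OF test_function_directional(1)[OF \<psi>, of z], of \<Omega>]
  have o1: "(\<lambda>x y. \<psi> x * wave k c y) \<in> oscillating \<Omega>"
    by (rule oscillating.wave[OF borel_measurable_lebesgue_on[OF test_function_measurable(1)[OF \<psi>]] B])
  have o2: "(\<lambda>x y. frechet_derivative \<psi> (at x) z * wave k c y) \<in> oscillating \<Omega>"
    by (rule oscillating.wave[OF dm D])
  let ?w = "\<lambda>n x. wave k c ((R *v x) /\<^sub>R \<eta> n)"
  have parts: "(\<integral>x. (g n x \<bullet> z) * (\<psi> x * ?w n x) \<partial>M) = - (\<integral>x. u n x * (frechet_derivative \<psi> (at x) z * ?w n x) \<partial>M)" for n
  proof -
    let ?a = "((2 * pi) *\<^sub>R \<xi>) /\<^sub>R \<eta> n"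
    have wave: "?w n x = cos (?a \<bullet> x + c)" for x unfolding \<xi>_def by (rule wave_osc)
    note t = modulated_test_function[OF \<psi>, of ?a c]
    have "?a \<bullet> z = 0" using \<xi>z by simp
    then have "frechet_derivative (\<lambda>x. \<psi> x * cos (?a \<bullet> x + c)) (at x) z = frechet_derivative \<psi> (at x) z * cos (?a \<bullet> x + c)" for x
      unfolding t(2) by simp
    then show ?thesis unfolding wave
      using weak_grad_directional[OF \<Omega> u g ug t(1), of n z] by simp
  qed
  have lhs: "(\<lambda>n. \<integral>x. (g n x \<bullet> z) * (\<psi> x * ?w n x) \<partial>M) \<longlonglongrightarrow> (\<integral>x. (\<xi> $ i * W j x - \<xi> $ j * W i x) * \<psi> x \<partial>M)"
  proof -
    have gj: "(\<lambda>x. g n x $ j) \<in> L2 M" for n j using L2_component(1)[OF g[of n], of "axis j 1"] by (simp add: inner_axis)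
    have "(\<integral>x. (g n x \<bullet> z) * (\<psi> x * ?w n x) \<partial>M) =
       \<xi> $ i * (\<integral>x. g n x $ j * (\<psi> x * ?w n x) \<partial>M) - \<xi> $ j * (\<integral>x. g n x $ i * (\<psi> x * ?w n x) \<partial>M)" for n
      using L2_mult_integrable[OF gj oscillating_L2(1)[OF o1]] by (simp add: gz left_diff_distrib mult.assoc)
    moreover have "(\<lambda>n. \<xi> $ i * (\<integral>x. g n x $ j * (\<psi> x * ?w n x) \<partial>M) - \<xi> $ j * (\<integral>x. g n x $ i * (\<psi> x * ?w n x) \<partial>M))
      \<longlonglongrightarrow> \<xi> $ i * (\<integral>(x, y). w j (x, y) * (\<psi> x * wave k c y) \<partial>MY) - \<xi> $ j * (\<integral>(x, y). w i (x, y) * (\<psi> x * wave k c y) \<partial>MY)"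
      by (intro tendsto_diff tendsto_mult_left wlim[OF o1])
    moreover have "\<xi> $ i * (\<integral>(x, y). w j (x, y) * (\<psi> x * wave k c y) \<partial>MY) - \<xi> $ j * (\<integral>(x, y). w i (x, y) * (\<psi> x * wave k c y) \<partial>MY)
       = (\<integral>x. (\<xi> $ i * W j x - \<xi> $ j * W i x) * \<psi> x \<partial>M)"
      unfolding wave_coefficient_pairing(1)[OF w \<psi>] using wave_coefficient_pairing(2)[OF w \<psi>, of _ k c]
      by (simp add: W_def left_diff_distrib mult.assoc)
    ultimately show ?thesis by simp
  qed
  have rhs: "(\<lambda>n. - (\<integral>x. u n x * (frechet_derivative \<psi> (at x) z * ?w n x) \<partial>M)) \<longlonglongrightarrow> - 0"
  proof (rule tendsto_minus)
    have "(\<integral>(x, y). v x * (frechet_derivative \<psi> (at x) z * wave k c y) \<partial>MY) = 0"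
      using wave_pairing[OF v dm D, of k c] k by simp
    then show "(\<lambda>n. \<integral>x. u n x * (frechet_derivative \<psi> (at x) z * ?w n x) \<partial>M) \<longlonglongrightarrow> 0"
      using oscillating_pairing_of_strong_limit[OF u v strong o2] by simp
  qed
  show "(\<integral>x. (\<xi> $ i * W j x - \<xi> $ j * W i x) * \<psi> x \<partial>M) = 0"
    using LIMSEQ_unique[OF lhs rhs[folded parts]] by simp
qed

text \<open>Both functions describe the limit of the pairings with test functions that do not oscillate; the
  factor \<open>wave 0 0\<close> is the constant \<open>1\<close>.\<close>

lemma mean_of_two_scale_limit:
  fixes f :: "nat \<Rightarrow> real^3 \<Rightarrow> real"
  assumes h: "weakly_tendsto M f h" and w: "w \<in> L2 MY"
    and wlim: "\<And>\<phi>. \<phi> \<in> oscillating \<Omega> \<Longrightarrow>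
      (\<lambda>n. \<integral>x. f n x * osc \<phi> n x \<partial>M) \<longlonglongrightarrow> (\<integral>(x, y). w (x, y) * \<phi> x y \<partial>MY)"
  shows "AE x in M. (\<integral>y. w (x, y) * wave 0 0 y \<partial>Y) - h x = 0"
proof (rule fundamental_lemma[OF \<Omega>(1)])
  have hL: "h \<in> L2 M" using h by (simp add: weakly_tendsto_def)
  show "integrable M (\<lambda>x. (\<integral>y. w (x, y) * wave 0 0 y \<partial>Y) - h x)"
    using wave_coefficient_integrable[OF w] M.L2_integrable[OF hL] by simp
  fix \<psi> assume \<psi>: "\<psi> \<in> test_functions \<Omega>"
  obtain B where B: "\<And>x. \<bar>\<psi> x\<bar> \<le> B" using test_function_bounded[OF \<psi>] by blast
  have o1: "(\<lambda>x y. \<psi> x * wave 0 0 y) \<in> oscillating \<Omega>"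
    by (rule oscillating.wave[OF borel_measurable_lebesgue_on[OF test_function_measurable(1)[OF \<psi>]] B])
  note \<psi>L = test_function_L2[OF \<Omega> \<psi>]
  have one: "wave 0 0 y = 1" for y :: "real^'m" by (simp add: wave_def freq_0)
  have "(\<lambda>n. \<integral>x. f n x * \<psi> x \<partial>M) \<longlonglongrightarrow> (\<integral>x. h x * \<psi> x \<partial>M)" using h \<psi>L by (simp add: weakly_tendsto_def)
  moreover have "(\<lambda>n. \<integral>x. f n x * \<psi> x \<partial>M) \<longlonglongrightarrow> (\<integral>x. (\<integral>y. w (x, y) * wave 0 0 y \<partial>Y) * \<psi> x \<partial>M)"
    using wlim[OF o1] unfolding wave_coefficient_pairing(1)[OF w \<psi>] by (simp add: one)
  ultimately have "(\<integral>x. h x * \<psi> x \<partial>M) = (\<integral>x. (\<integral>y. w (x, y) * wave 0 0 y \<partial>Y) * \<psi> x \<partial>M)" by (rule LIMSEQ_unique)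
  then show "(\<integral>x. ((\<integral>y. w (x, y) * wave 0 0 y \<partial>Y) - h x) * \<psi> x \<partial>M) = 0"
    using wave_coefficient_pairing(2)[OF w \<psi>, of 0 0] L2_mult_integrable[OF hL \<psi>L] by (simp add: left_diff_distrib)
qed

text \<open>Composition with this map extends a function from the unit cell periodically.\<close>

definition fractional :: "real^'m \<Rightarrow> real^'m" where
  "fractional y = (\<chi> i. frac (y $ i))"

lemma fractional_unit_cell: "y \<in> unit_cell \<Longrightarrow> fractional y = y"
  by (auto simp: fractional_def unit_cell_def vec_eq_iff frac_eq less_imp_le)

lemma fractional_add_lattice: "k \<in> int_lattice \<Longrightarrow> fractional (y + k) = fractional y"
  by (auto simp: fractional_def int_lattice_def vec_eq_iff frac_def elim!: Ints_cases)

text \<open>The Fourier coefficient of \<open>G\<close> at \<open>k\<close> combines the wave coefficients with phases \<open>0\<close> and \<open>- pi / 2\<close>.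
  For \<open>k \<noteq> 0\<close> it is parallel to \<open>R\<^sup>T k\<close>, and its quotient by \<open>2 \<pi> i R\<^sup>T k\<close>, read off in a component where
  \<open>R\<^sup>T k\<close> does not vanish, is the coefficient of the potential. At \<open>k = 0\<close> it vanishes since \<open>h\<close> is the mean.\<close>

lemma corrector_is_grad_R:
  fixes w :: "3 \<Rightarrow> (real^3) \<times> (real^'m) \<Rightarrow> real" and h :: "real^3 \<Rightarrow> real^3"
  defines "W \<equiv> \<lambda>j k c x. \<integral>y. w j (x, y) * wave k c y \<partial>Y"
  assumes w: "\<And>j. w j \<in> L2 MY" and h: "h \<in> L2 M"
    and parallel: "\<And>k c i j. k \<noteq> 0 \<Longrightarrow>
      AE x in M. (transpose R *v freq k) $ i * W j k c x - (transpose R *v freq k) $ j * W i k c x = 0"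
    and mean: "\<And>j. AE x in M. W j 0 0 x - h x $ j = 0"
  defines "G \<equiv> \<lambda>(x, y). (\<chi> j. w j (x, fractional y)) - h x"
  shows "G \<in> L2_grad_R \<Omega> R"
proof -
  have comp: "G (x, y) $ j = w j (x, y) - h x $ j" if "y \<in> unit_cell" for x y j
    using that by (simp add: G_def fractional_unit_cell)
  have per: "cell_periodic (\<lambda>y. G (x, y))" for x
    by (auto simp: cell_periodic_def G_def fractional_add_lattice)
  have hj: "(\<lambda>x. h x $ j) \<in> L2 M" for j using L2_component(1)[OF h, of "axis j 1"] by (simp add: inner_axis)
  have GL: "G \<in> L2 (lebesgue_on (\<Omega> \<times> unit_cell))"
  proof (rule L2_vecI)
    fix j
    have "(\<lambda>z. w j z - (case z of (x, y) \<Rightarrow> h x $ j)) \<in> L2 (lebesgue_on (\<Omega> \<times> unit_cell))"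
      by (rule lebesgue_on_Times_L2[OF Times_facts L2_diff[OF w L2_fst(1)[OF hj]]])
    moreover have "G z $ j = w j z - (case z of (x, y) \<Rightarrow> h x $ j)" if "z \<in> space (lebesgue_on (\<Omega> \<times> unit_cell))" for z
      using that comp by (cases z) auto
    ultimately show "(\<lambda>z. G z $ j) \<in> L2 (lebesgue_on (\<Omega> \<times> unit_cell))"
      by (subst L2_cong) auto
  qed
  have sec: "AE x in M. (\<lambda>y. w j (x, y)) \<in> L2 Y" for j
  proof -
    have "integrable MY (\<lambda>(x, y). (w j (x, y))\<^sup>2)" using w[of j] by (simp add: L2_real_iff case_prod_beta')
    from MY.AE_integrable_fst'[OF this] have "AE x in M. integrable Y (\<lambda>y. (w j (x, y))\<^sup>2)" by simp
    moreover have "AE x in M. (\<lambda>y. w j (x, y)) \<in> borel_measurable Y"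
      using measurable_Pair2[OF L2_measurable[OF w[of j]]] by (intro AE_I2)
    ultimately show ?thesis by eventually_elim (simp add: L2_real_iff)
  qed
  have sec': "AE x in M. \<forall>j. (\<lambda>y. w j (x, y)) \<in> L2 Y" using sec by (intro eventually_all_finite)
  have mean': "AE x in M. \<forall>j. W j 0 0 x - h x $ j = 0" using mean by (intro eventually_all_finite)
  have parallel': "AE x in M. \<forall>k. \<forall>b. \<forall>i. \<forall>j. k \<noteq> 0 \<longrightarrow> (transpose R *v freq k) $ i * W j k (if b then - pi / 2 else 0) x
      - (transpose R *v freq k) $ j * W i k (if b then - pi / 2 else 0) x = 0"
  proof (subst AE_all_countable, intro allI eventually_all_finite)
    fix k b i j
    show "AE x in M. k \<noteq> 0 \<longrightarrow> (transpose R *v freq k) $ i * W j k (if b then - pi / 2 else 0) x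
      - (transpose R *v freq k) $ j * W i k (if b then - pi / 2 else 0) x = 0"
      using parallel by (cases "k = 0") simp_all
  qed
  have "AE x in M. is_grad_R R (\<lambda>y. G (x, y))"
    using sec' mean' parallel'
  proof eventually_elim
    fix x
    assume sec: "\<forall>j. (\<lambda>y. w j (x, y)) \<in> L2 Y" and mean: "\<forall>j. W j 0 0 x - h x $ j = 0"
      and par: "\<forall>k. \<forall>b. \<forall>i. \<forall>j. k \<noteq> 0 \<longrightarrow> (transpose R *v freq k) $ i * W j k (if b then - pi / 2 else 0) x
      - (transpose R *v freq k) $ j * W i k (if b then - pi / 2 else 0) x = 0"
    have c: "(\<lambda>y. h x $ j) \<in> L2 Y" for j by (simp add: L2_real_iff)
    have dL: "(\<lambda>y. w j (x, y) - h x $ j) \<in> L2 Y" for j using L2_diff[OF sec[rule_format] c] .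
    have GL: "(\<lambda>y. G (x, y)) \<in> L2 Y"
    proof (rule L2_vecI)
      fix j show "(\<lambda>y. G (x, y) $ j) \<in> L2 Y"
        using dL[of j] by (subst L2_cong[OF comp]) auto
    qed
    have four: "fourier_coeff (\<lambda>y. G (x, y) $ j) (freq k) =
        (if k = 0 then 0 else of_real (W j k 0 x) - \<i> * of_real (W j k (- pi / 2) x))" for j k
    proof -
      have wint: "integrable Y (\<lambda>y. w j (x, y) * wave k c y)" for c
      proof (rule Y.L2_integrable, rule L2_mult_bounded(1)[OF sec[rule_format, of j]])
        show "wave k c \<in> borel_measurable Y" by (rule borel_measurable_lebesgue_on[OF borel_measurable_wave])
      qed (rule wave_le_1)
      have cint: "integrable Y (wave k c)" for c
        by (rule Y.integrable_const_bound[of _ 1]) (auto intro: borel_measurable_lebesgue_on[OF borel_measurable_wave])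
      have I: "(\<integral>y. (w j (x, y) - h x $ j) * wave k c y \<partial>Y) = W j k c x - h x $ j * (if k = 0 then cos c else 0)" for c
        using wint[of c] cint[of c] by (simp add: left_diff_distrib W_def wave_integral_unit_cell)
      have W0: "W j 0 (- pi / 2) x = 0" by (simp add: W_def wave_def freq_0)
      have "fourier_coeff (\<lambda>y. G (x, y) $ j) (freq k) = fourier_coeff (\<lambda>y. w j (x, y) - h x $ j) (freq k)"
        unfolding fourier_coeff_def using comp by (intro Bochner_Integration.integral_cong) auto
      also have "\<dots> = of_real (W j k 0 x - h x $ j * (if k = 0 then cos 0 else 0))
          - \<i> * of_real (W j k (- pi / 2) x - h x $ j * (if k = 0 then cos (- pi / 2) else 0))"
        unfolding fourier_coeff_waves[OF Y.L2_integrable[OF dL]] I ..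
      also have "\<dots> = (if k = 0 then 0 else of_real (W j k 0 x) - \<i> * of_real (W j k (- pi / 2) x))"
        using mean W0 by (cases "k = 0") simp_all
      finally show ?thesis .
    qed
    have "\<exists>p. \<forall>j. fourier_coeff (\<lambda>y. G (x, y) $ j) k = 2 * of_real pi * \<i> * of_real ((transpose R *v k) $ j) * p"
      if "k \<in> int_lattice" for k
    proof -
      have "k \<in> range freq" using that by (simp only: range_freq)
      then obtain l where k: "k = freq l" by (rule rangeE)
      show ?thesis
      proof (cases "l = 0")
        case True
        then show ?thesis unfolding k four by (intro exI[of _ 0]) simp
      next
        case False
        define \<xi> where "\<xi> = transpose R *v freq l"
        have "\<xi> \<noteq> 0" unfolding \<xi>_def using nonresonant_freq[OF False] .
        then obtain i where i: "\<xi> $ i \<noteq> 0" by (auto simp: vec_eq_iff)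
        define C where "C j = complex_of_real (W j l 0 x) - \<i> * of_real (W j l (- pi / 2) x)" for j
        have "\<xi> $ i * W j l 0 x = \<xi> $ j * W i l 0 x" "\<xi> $ i * W j l (- pi / 2) x = \<xi> $ j * W i l (- pi / 2) x" for j
          using par[rule_format, OF False, of i j False] par[rule_format, OF False, of i j True] by (simp_all add: \<xi>_def)
        then have CC: "of_real (\<xi> $ i) * C j = of_real (\<xi> $ j) * C i" for j
          by (simp add: complex_eq_iff C_def)
        have "fourier_coeff (\<lambda>y. G (x, y) $ j) k = 2 * of_real pi * \<i> * of_real ((transpose R *v k) $ j) * (C i / (2 * of_real pi * \<i> * of_real (\<xi> $ i)))" for j
        proof -
          have "C j = of_real (\<xi> $ j) * C i / of_real (\<xi> $ i)" using CC[of j] i by (simp add: field_simps)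
          then have "C j = 2 * of_real pi * \<i> * of_real (\<xi> $ j) * (C i / (2 * of_real pi * \<i> * of_real (\<xi> $ i)))" by simp
          then show ?thesis using False unfolding k four by (simp add: C_def \<xi>_def)
        qed
        then show ?thesis by blast
      qed
    qed
    then have "\<exists>p. \<forall>k\<in>int_lattice. \<forall>j. fourier_coeff (\<lambda>y. G (x, y) $ j) k = 2 * of_real pi * \<i> * of_real ((transpose R *v k) $ j) * p k"
      by (intro bchoice) blast
    then show "is_grad_R R (\<lambda>y. G (x, y))"
      using GL per by (simp add: is_grad_R_def L2_per_def)
  qed
  then show ?thesis using GL per by (simp add: L2_grad_R_def L2_L2_per_def)
qed

end

lemma two_scale_setting_subsequence:
  assumes "two_scale_setting \<Omega> R \<eta>" "strict_mono s"
  shows "two_scale_setting \<Omega> R (\<eta> \<circ> s)"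
proof -
  interpret two_scale_setting \<Omega> R \<eta> by fact
  show ?thesis
    using \<Omega> nonresonant \<eta>(1) LIMSEQ_subseq_LIMSEQ[OF \<eta>(2) assms(2)] by unfold_locales auto
qed

lemma W12_norm_bounds: "L2_norm (lebesgue_on \<Omega>) u \<le> W12_norm \<Omega> u" "L2_norm (lebesgue_on \<Omega>) (weak_grad \<Omega> u) \<le> W12_norm \<Omega> u"
  unfolding W12_norm_def by (auto intro!: real_le_rsqrt)

theorem proposition4:
  fixes \<Omega> :: "(real^3) set"
    and R :: "real^3^'m"
    and \<eta> :: "nat \<Rightarrow> real"
    and u :: "nat \<Rightarrow> real^3 \<Rightarrow> real"
  assumes "open \<Omega>" and "bounded \<Omega>" and "lipschitz_boundary \<Omega>"
    and "CARD('m) > 3"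
    and "\<forall>k\<in>int_lattice - {0}. transpose R *v k \<noteq> 0"
    and "\<forall>n. \<eta> n > 0" and "\<eta> \<longlonglongrightarrow> 0"
    and "\<forall>n. u n \<in> W12 \<Omega>"
    and "\<exists>C. \<forall>n. W12_norm \<Omega> (u n) \<le> C"
  shows "\<exists>(s :: nat \<Rightarrow> nat) v G.
           strict_mono s \<and> v \<in> W12 \<Omega> \<and> G \<in> L2_grad_R \<Omega> R \<and>
           two_scale_strong \<Omega> R (\<eta> \<circ> s) (u \<circ> s) (\<lambda>(x, y). v x) \<and>
           two_scale_weak_vec \<Omega> R (\<eta> \<circ> s) (\<lambda>n. weak_grad \<Omega> (u (s n)))
             (\<lambda>(x, y). weak_grad \<Omega> v x + G (x, y))"
proof -
  note \<Omega> = assms(1,2)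
  interpret S0: two_scale_setting \<Omega> R \<eta> using assms by unfold_locales auto
  let ?M = "lebesgue_on \<Omega>"
  define g where "g n = weak_grad \<Omega> (u n)" for n
  have u: "u n \<in> L2 ?M" and g: "g n \<in> L2 ?M" and ug: "has_weak_grad \<Omega> (u n) (g n)" for n
    using W12_weak_grad[of "u n" \<Omega>] assms(8) by (auto simp: g_def)
  obtain C where C: "\<And>n. W12_norm \<Omega> (u n) \<le> C" using assms(9) by blast
  have uC: "L2_norm ?M (u n) \<le> C" and gC: "L2_norm ?M (g n) \<le> C" for n
    using W12_norm_bounds[where \<Omega> = \<Omega> and u = "u n"] C[of n] by (auto simp: g_def intro: order_trans)
  have gj: "(\<lambda>x. g n x $ j) \<in> L2 ?M" "L2_norm ?M (\<lambda>x. g n x $ j) \<le> C" for n j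
    using L2_component[OF g[of n], of "axis j 1"] gC[of n] by (auto simp: inner_axis norm_axis_1)
  let ?ph = "\<lambda>b. if b then - pi / 2 else 0 :: real"
  \<comment> \<open>The component \<open>j\<close> of the gradients has the index \<open>d = axis j 1\<close>, taken from a countable type;
      the index \<open>None\<close> stands for the functions themselves.\<close>
  define F :: "((int^3) \<times> (int^'m) \<times> bool) option \<Rightarrow> nat \<Rightarrow> real^3 \<Rightarrow> real" where
    "F = (\<lambda>i n x. case i of None \<Rightarrow> u n x
       | Some (d, k, b) \<Rightarrow> (g n x \<bullet> freq d) * wave k (?ph b) ((R *v x) /\<^sub>R \<eta> n))"
  define B :: "((int^3) \<times> (int^'m) \<times> bool) option \<Rightarrow> real" where
    "B = (\<lambda>i. case i of None \<Rightarrow> C | Some (d, k, b) \<Rightarrow> norm (freq d) * C)"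
  have FL: "F i n \<in> L2 ?M \<and> L2_norm ?M (F i n) \<le> B i" for i n
  proof (cases i)
    case None
    then show ?thesis using u uC by (simp add: F_def B_def)
  next
    case (Some t)
    obtain d k b where t: "t = (d, k, b)" by (cases t)
    note c = L2_component[OF g[of n], of "freq d"]
    note m = L2_mult_bounded[OF c(1) S0.wave_osc_measurable[of k "?ph b" n] wave_le_1]
    have "L2_norm ?M (\<lambda>x. g n x \<bullet> freq d) \<le> norm (freq d) * C"
      using c(2) mult_left_mono[OF gC[of n] norm_ge_zero[of "freq d"]] by linarith
    then show ?thesis using m by (simp add: F_def B_def Some t)
  qed
  obtain s H where s: "strict_mono s" and H: "\<And>i. weakly_tendsto ?M (\<lambda>n. F i (s n)) (H i)"
    using S0.M.L2_bounded_family_weak_subsequence[of F B] FL by metis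
  interpret S: two_scale_setting \<Omega> R "\<eta> \<circ> s"
    by (rule two_scale_setting_subsequence[OF S0.two_scale_setting_axioms s])
  define v where "v = H None"
  have uv: "weakly_tendsto ?M (\<lambda>n. u (s n)) v" using H[of None] by (simp add: F_def v_def)
  then have v: "v \<in> L2 ?M" by (simp add: weakly_tendsto_def)
  have freq_axis: "freq (axis j 1) = axis j 1" for j :: 3 by (auto simp: freq_def axis_def vec_eq_iff)
  have gw: "weakly_tendsto ?M (\<lambda>n x. g (s n) x $ j * wave k (?ph b) ((R *v x) /\<^sub>R (\<eta> \<circ> s) n)) (H (Some (axis j 1, k, b)))" for j k b
    using H[of "Some (axis j 1, k, b)"] by (simp add: F_def freq_axis inner_axis)
  define h where "h x = (\<chi> j. H (Some (axis j 1, 0, False)) x)" for x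
  have gh: "weakly_tendsto ?M (\<lambda>n x. g (s n) x $ j) (\<lambda>x. h x $ j)" for j
    using gw[of j 0 False] by (simp add: h_def wave_def freq_0)
  have h: "h \<in> L2 ?M" by (rule L2_vecI) (use gh in \<open>simp add: weakly_tendsto_def\<close>)
  have vh: "has_weak_grad \<Omega> v h"
    unfolding has_weak_grad_def
  proof (intro ballI)
    fix \<psi> and b :: "real^3" assume \<psi>: "\<psi> \<in> test_functions \<Omega>" and b: "b \<in> Basis"
    obtain j where j: "b = axis j 1" using b by (auto simp: Basis_vec_def)
    note dL = test_function_derivative_L2[OF \<Omega> \<psi>, of b]
    have "(\<lambda>n. \<integral>x. u (s n) x * frechet_derivative \<psi> (at x) b \<partial>?M) \<longlonglongrightarrow> (\<integral>x. v x * frechet_derivative \<psi> (at x) b \<partial>?M)"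
      using uv dL by (simp add: weakly_tendsto_def)
    moreover have "(\<lambda>n. - (\<integral>x. (g (s n) x \<bullet> b) * \<psi> x \<partial>?M)) \<longlonglongrightarrow> - (\<integral>x. (h x \<bullet> b) * \<psi> x \<partial>?M)"
      using gh[of j] test_function_L2[OF \<Omega> \<psi>] by (intro tendsto_minus) (simp add: weakly_tendsto_def j inner_axis)
    moreover have "(\<integral>x. u (s n) x * frechet_derivative \<psi> (at x) b \<partial>?M) = - (\<integral>x. (g (s n) x \<bullet> b) * \<psi> x \<partial>?M)" for n
      using ug[unfolded has_weak_grad_def, rule_format, OF \<psi> b] .
    ultimately show "(\<integral>x. v x * frechet_derivative \<psi> (at x) b \<partial>?M) = - (\<integral>x. (h x \<bullet> b) * \<psi> x \<partial>?M)"
      using LIMSEQ_unique by simp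
  qed
  have vW: "v \<in> W12 \<Omega>" using v h vh by (auto simp: W12_def)
  note wv = W12_weak_grad[OF vW]
  have wg_h: "AE x in ?M. weak_grad \<Omega> v x = h x" by (rule weak_grad_unique[OF \<Omega> wv(2) h wv(3) vh])
  have strong: "(\<lambda>n. L2_norm ?M (\<lambda>x. u (s n) x - v x)) \<longlonglongrightarrow> 0"
  proof (rule Rellich[OF assms(1,2,3)])
    show "(\<lambda>x. u (s n) x - v x) \<in> L2 ?M" for n by (rule L2_diff[OF u v])
    show "(\<lambda>x. g (s n) x - h x) \<in> L2 ?M" for n by (rule L2_vec_diff[OF g h])
    show "has_weak_grad \<Omega> (\<lambda>x. u (s n) x - v x) (\<lambda>x. g (s n) x - h x)" for n
      by (rule has_weak_grad_diff[OF \<Omega> u v g h ug vh])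
    let ?C = "C + L2_norm ?M v + L2_norm ?M h"
    show "L2_norm ?M (\<lambda>x. u (s n) x - v x) \<le> ?C" for n
      using L2_vec_diff(2)[OF u[of "s n"] v] uC[of "s n"] L2_norm_nonneg[of ?M h] by linarith
    show "L2_norm ?M (\<lambda>x. g (s n) x - h x) \<le> ?C" for n
      using L2_vec_diff(2)[OF g[of "s n"] h] gC[of "s n"] L2_norm_nonneg[of ?M v] by linarith
    show "weakly_tendsto ?M (\<lambda>n x. u (s n) x - v x) (\<lambda>x. 0)"
      unfolding weakly_tendsto_def
    proof (intro conjI ballI)
      show "(\<lambda>x. 0::real) \<in> L2 ?M" by (rule L2_zero)
      fix a :: "real^3 \<Rightarrow> real" assume a: "a \<in> L2 ?M"
      have "(\<lambda>n. (\<integral>x. u (s n) x * a x \<partial>?M) - (\<integral>x. v x * a x \<partial>?M)) \<longlonglongrightarrow> (\<integral>x. v x * a x \<partial>?M) - (\<integral>x. v x * a x \<partial>?M)"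
        using uv a by (intro tendsto_diff tendsto_const) (simp add: weakly_tendsto_def)
      moreover have "(\<integral>x. (u (s n) x - v x) * a x \<partial>?M) = (\<integral>x. u (s n) x * a x \<partial>?M) - (\<integral>x. v x * a x \<partial>?M)" for n
        using L2_mult_integrable[OF u a] L2_mult_integrable[OF v a] by (simp add: left_diff_distrib)
      ultimately show "(\<lambda>n. \<integral>x. (u (s n) x - v x) * a x \<partial>?M) \<longlonglongrightarrow> (\<integral>x. 0 * a x \<partial>?M)" by simp
    qed
  qed
  have ex: "\<exists>w. w \<in> L2 S.MY \<and> (\<forall>\<phi>\<in>oscillating \<Omega>.
      (\<lambda>n. \<integral>x. g (s n) x $ j * \<phi> x ((R *v x) /\<^sub>R (\<eta> \<circ> s) n) \<partial>?M) \<longlonglongrightarrow> (\<integral>(x, y). w (x, y) * \<phi> x y \<partial>S.MY))" for j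
  proof -
    have conv: "\<exists>h. weakly_tendsto ?M (\<lambda>n x. g (s n) x $ j * wave k (?ph b) ((R *v x) /\<^sub>R (\<eta> \<circ> s) n)) h" for k b
      using gw[of j k b] by blast
    show ?thesis
    proof (rule S.two_scale_limit_exists[where f = "\<lambda>n x. g (s n) x $ j", OF gj(1) gj(2) conv])
      fix w assume "w \<in> L2 S.MY" "\<And>\<phi>. \<phi> \<in> oscillating \<Omega> \<Longrightarrow>
        (\<lambda>n. \<integral>x. g (s n) x $ j * \<phi> x ((R *v x) /\<^sub>R (\<eta> \<circ> s) n) \<partial>?M) \<longlonglongrightarrow> (\<integral>(x, y). w (x, y) * \<phi> x y \<partial>S.MY)"
      then show ?thesis by (intro exI[of _ w] conjI ballI)
    qed
  qed
  have "\<exists>w. \<forall>j. w j \<in> L2 S.MY \<and> (\<forall>\<phi>\<in>oscillating \<Omega>.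
      (\<lambda>n. \<integral>x. g (s n) x $ j * \<phi> x ((R *v x) /\<^sub>R (\<eta> \<circ> s) n) \<partial>?M) \<longlonglongrightarrow> (\<integral>(x, y). w j (x, y) * \<phi> x y \<partial>S.MY))"
    by (rule choice) (intro allI ex)
  then obtain w where W: "\<forall>j. w j \<in> L2 S.MY \<and> (\<forall>\<phi>\<in>oscillating \<Omega>.
      (\<lambda>n. \<integral>x. g (s n) x $ j * \<phi> x ((R *v x) /\<^sub>R (\<eta> \<circ> s) n) \<partial>?M) \<longlonglongrightarrow> (\<integral>(x, y). w j (x, y) * \<phi> x y \<partial>S.MY))"
    by (rule exE)
  note w = W[THEN spec, THEN conjunct1]
    and wlim = W[THEN spec, THEN conjunct2, THEN bspec]
  define G where "G = (\<lambda>(x, y). (\<chi> j. w j (x, S.fractional y)) - weak_grad \<Omega> v x)"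
  have G: "G \<in> L2_grad_R \<Omega> R"
    unfolding G_def
  proof (rule S.corrector_is_grad_R[OF w wv(2)])
    show "AE x in ?M. (transpose R *v freq k) $ i * (\<integral>y. w j (x, y) * wave k c y \<partial>S.Y)
        - (transpose R *v freq k) $ j * (\<integral>y. w i (x, y) * wave k c y \<partial>S.Y) = 0" if "k \<noteq> 0" for k c i j
      by (rule S.gradient_limit_waves_parallel[OF u g ug v strong w wlim that])
    show "AE x in ?M. (\<integral>y. w j (x, y) * wave 0 0 y \<partial>S.Y) - weak_grad \<Omega> v x $ j = 0" for j
    proof -
      have "AE x in ?M. (\<integral>y. w j (x, y) * wave 0 0 y \<partial>S.Y) - h x $ j = 0"
        by (rule S.mean_of_two_scale_limit[OF gh w wlim])
      with wg_h show ?thesis by eventually_elim simp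
    qed
  qed
  have "two_scale_strong \<Omega> R (\<eta> \<circ> s) (u \<circ> s) (\<lambda>(x, y). v x)"
    unfolding two_scale_strong_def
  proof
    show "two_scale_weak \<Omega> R (\<eta> \<circ> s) (u \<circ> s) (\<lambda>(x, y). v x)"
    proof (rule S.two_scale_weakI)
      show "(u \<circ> s) n \<in> L2 ?M" "L2_norm ?M ((u \<circ> s) n) \<le> C" for n using u uC by auto
      show "(\<lambda>(x, y). v x) \<in> L2 S.MY" by (rule S.L2_fst(1)[OF v])
      show "(\<lambda>n. \<integral>x. (u \<circ> s) n x * \<phi> x ((R *v x) /\<^sub>R (\<eta> \<circ> s) n) \<partial>?M) \<longlonglongrightarrow> (\<integral>(x, y). (case (x, y) of (x, y) \<Rightarrow> v x) * \<phi> x y \<partial>S.MY)"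
        if "\<phi> \<in> oscillating \<Omega>" for \<phi>
        using S.oscillating_pairing_of_strong_limit[OF u v strong that] by simp
    qed
    have "(\<integral>z. (case z of (x, y) \<Rightarrow> v x)\<^sup>2 \<partial>lebesgue_on (\<Omega> \<times> (unit_cell :: (real^'m) set))) = (\<integral>z. (case z of (x, y) \<Rightarrow> v x)\<^sup>2 \<partial>S.MY)"
      by (rule lebesgue_on_Times_integral(2)[OF S.Times_facts borel_measurable_power[OF L2_measurable[OF S.L2_fst(1)[OF v]]]])
    also have "\<dots> = (\<integral>x. (v x)\<^sup>2 \<partial>?M)" using S.L2_fst(2)[OF v] by (simp add: case_prod_beta')
    finally have "L2_norm (lebesgue_on (\<Omega> \<times> (unit_cell :: (real^'m) set))) (\<lambda>(x, y). v x) = L2_norm ?M v"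
      by (simp add: L2_norm_def)
    moreover have "(\<lambda>n. L2_norm ?M ((u \<circ> s) n)) \<longlonglongrightarrow> L2_norm ?M v"
    proof (rule LIM_zero_cancel, rule Lim_null_comparison[OF _ strong])
      show "\<forall>\<^sub>F n in sequentially. norm (L2_norm ?M ((u \<circ> s) n) - L2_norm ?M v) \<le> L2_norm ?M (\<lambda>x. u (s n) x - v x)"
        using L2_norm_triangle_diff[OF u v] by (intro always_eventually) simp
    qed
    ultimately show "(\<lambda>n. L2_norm ?M ((u \<circ> s) n)) \<longlonglongrightarrow> L2_norm (lebesgue_on (\<Omega> \<times> (unit_cell :: (real^'m) set))) (\<lambda>(x, y). v x)"
      by simp
  qed
  moreover have "two_scale_weak_vec \<Omega> R (\<eta> \<circ> s) (\<lambda>n. weak_grad \<Omega> (u (s n))) (\<lambda>(x, y). weak_grad \<Omega> v x + G (x, y))"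
    unfolding two_scale_weak_vec_def
  proof
    fix j
    have eq: "(case z of (x, y) \<Rightarrow> weak_grad \<Omega> v x + G (x, y)) $ j = w j z" if "z \<in> space S.MY" for z
      using that by (cases z) (simp add: G_def space_pair_measure S.fractional_unit_cell)
    show "two_scale_weak \<Omega> R (\<eta> \<circ> s) (\<lambda>n x. weak_grad \<Omega> (u (s n)) x $ j) (\<lambda>z. (case z of (x, y) \<Rightarrow> weak_grad \<Omega> v x + G (x, y)) $ j)"
      unfolding g_def[symmetric]
    proof (rule S.two_scale_weakI)
      show "(\<lambda>x. g (s n) x $ j) \<in> L2 ?M" "L2_norm ?M (\<lambda>x. g (s n) x $ j) \<le> C" for n by (rule gj)+
      show "(\<lambda>z. (case z of (x, y) \<Rightarrow> weak_grad \<Omega> v x + G (x, y)) $ j) \<in> L2 S.MY"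
        using w[of j] eq by (subst L2_cong[where g = "w j"]) auto
      fix \<phi> :: "real^3 \<Rightarrow> real^'m \<Rightarrow> real" assume \<phi>: "\<phi> \<in> oscillating \<Omega>"
      have "(\<integral>(x, y). (case (x, y) of (x, y) \<Rightarrow> weak_grad \<Omega> v x + G (x, y)) $ j * \<phi> x y \<partial>S.MY) = (\<integral>(x, y). w j (x, y) * \<phi> x y \<partial>S.MY)"
        by (rule Bochner_Integration.integral_cong[OF refl]) (use eq in \<open>auto simp: space_pair_measure\<close>)
      then show "(\<lambda>n. \<integral>x. g (s n) x $ j * \<phi> x ((R *v x) /\<^sub>R (\<eta> \<circ> s) n) \<partial>?M)
          \<longlonglongrightarrow> (\<integral>(x, y). (case (x, y) of (x, y) \<Rightarrow> weak_grad \<Omega> v x + G (x, y)) $ j * \<phi> x y \<partial>S.MY)"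
        using wlim[OF \<phi>] by simp
    qed
  qed
  ultimately show ?thesis using s vW G by blast
qed

end
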